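(* For every real constant $C>0$ and every $\delta>0$ there exists $k_0$ (depending only on $C$ and $\delta$) such that for all integers $k\geq k_0$ and all integers $\ell$ with $1\leq \ell\leq C\cdot k$ we have \[\operatorname{ind}(k,\ell)\leq \frac{1}{e}+\delta.\] (Equivalently: $\operatorname{ind}(k,\ell)\leq e^{-1}+o_k(1)$ for $1\le \ell\le Ck$, where the $o_k(1)$ term depends only on $k$ and $C$ and tends to $0$ as $k\to\infty$.)
   Context: For integers $n\geq k\geq 1$ and $0\leq \ell\leq \binom{k}{2}$, let $I(n,k,\ell)$ be the maximum, over all (simple) graphs $G$ on $n$ vertices, of the probability that a uniformly random $k$-vertex subset of $V(G)$ spans exactly $\ell$ edges of $G$. $I(n,k,\ell)$ is non-increasing in $n$, and the edge-inducibility is $\operatorname{ind}(k,\ell)=\lim_{n\to\infty}I(n,k,\ell)$. *)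

theory Defs
  imports "HOL-Analysis.Analysis" "HOL-Library.Ramsey"
begin

text \<open>
  A simple graph on the vertex set \<open>V\<close> is given by its edge set \<open>E \<subseteq> [V]\<^bsup>2\<^esup>\<close>,
  where \<open>[V]\<^bsup>2\<^esup>\<close> is the set of two-element subsets of \<open>V\<close>.
\<close>

definition edges_in :: "'a set set \<Rightarrow> 'a set \<Rightarrow> 'a set set"
  where "edges_in E S = {e \<in> E. e \<subseteq> S}"

definition span_prob :: "'a set \<Rightarrow> 'a set set \<Rightarrow> nat \<Rightarrow> nat \<Rightarrow> real"
  where "span_prob V E k l =
    real (card {S \<in> [V]\<^bsup>k\<^esup>. card (edges_in E S) = l}) / real (card ([V]\<^bsup>k\<^esup>))"

text \<open>
  Up to isomorphism it suffices to consider the vertex set \<open>{..<n}\<close>; see \<open>span_prob_le_max_span_prob\<close>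
  below. The value is only meaningful for \<open>n \<ge> k\<close>; it is \<open>0\<close> for \<open>n < k\<close>.
\<close>

definition max_span_prob :: "nat \<Rightarrow> nat \<Rightarrow> nat \<Rightarrow> real"
  where "max_span_prob n k l = (MAX E \<in> Pow ([{..<n}]\<^bsup>2\<^esup>). span_prob {..<n} E k l)"

text \<open>The limit exists; see \<open>max_span_prob_tendsto_edge_inducibility\<close> below.\<close>

definition edge_inducibility :: "nat \<Rightarrow> nat \<Rightarrow> real"
  where "edge_inducibility k l = lim (\<lambda>n. max_span_prob n k l)"

lemma span_prob_relabel:
  assumes f: "bij_betw f V W" and E: "E \<subseteq> [V]\<^bsup>2\<^esup>"
  shows "span_prob W ((`) f ` E) k l = span_prob V E k l"
proof -
  have inj: "inj_on f V" and im: "f ` V = W"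
    using f by (auto simp: bij_betw_def)
  have injP: "inj_on ((`) f) (Pow V)"
    using inj by (rule inj_on_image_Pow)
  have EP: "E \<subseteq> Pow V"
    using E by (auto simp: nsets_def)
  have edges: "card (edges_in ((`) f ` E) (f ` S)) = card (edges_in E S)" if S: "S \<subseteq> V" for S
  proof -
    have "f ` e \<subseteq> f ` S \<longleftrightarrow> e \<subseteq> S" if "e \<in> E" for e
      using that EP S inj by (meson PowD inj_on_image_subset_iff subsetD)
    then have "edges_in ((`) f ` E) (f ` S) = (`) f ` edges_in E S"
      by (auto simp: edges_in_def)
    moreover have "inj_on ((`) f) (edges_in E S)"
      using injP EP by (auto simp: edges_in_def intro: inj_on_subset)
    ultimately show ?thesis
      by (simp add: card_image)
  qed
  have bij: "bij_betw ((`) f) ([V]\<^bsup>k\<^esup>) ([W]\<^bsup>k\<^esup>)"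
    using f by (rule bij_betw_nsets)
  have kP: "[V]\<^bsup>k\<^esup> \<subseteq> Pow V"
    by (auto simp: nsets_def)
  have "{T \<in> [W]\<^bsup>k\<^esup>. card (edges_in ((`) f ` E) T) = l}
      = (`) f ` {S \<in> [V]\<^bsup>k\<^esup>. card (edges_in E S) = l}" (is "?L = (`) f ` ?R")
  proof -
    have "[W]\<^bsup>k\<^esup> = (`) f ` ([V]\<^bsup>k\<^esup>)"
      using bij by (simp add: bij_betw_def)
    moreover have "card (edges_in ((`) f ` E) (f ` S)) = card (edges_in E S)" if "S \<in> [V]\<^bsup>k\<^esup>" for S
      using edges that kP by blast
    ultimately show ?thesis
      by auto
  qed
  moreover have "inj_on ((`) f) ?R"
    using injP kP by (auto intro: inj_on_subset)
  ultimately have "card ?L = card ?R"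
    by (simp add: card_image)
  then show ?thesis
    using bij_betw_same_card[OF bij] by (simp add: span_prob_def)
qed

lemma span_prob_le_max_span_prob:
  assumes "finite V" and "E \<subseteq> [V]\<^bsup>2\<^esup>"
  shows "span_prob V E k l \<le> max_span_prob (card V) k l"
proof -
  obtain f where f: "bij_betw f V {..<card V}"
    using ex_bij_betw_finite_nat[OF \<open>finite V\<close>] by (auto simp: atLeast0LessThan)
  have "(`) f ` E \<subseteq> [{..<card V}]\<^bsup>2\<^esup>"
    using bij_betw_nsets[OF f, of 2] assms(2) by (auto simp: bij_betw_def)
  then have "span_prob {..<card V} ((`) f ` E) k l \<le> max_span_prob (card V) k l"
    unfolding max_span_prob_def
    by (intro Max_ge) (auto simp: finite_imp_finite_nsets)
  then show ?thesis
    by (simp add: span_prob_relabel[OF f assms(2)])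
qed

lemma card_nsets_binomial: "finite A \<Longrightarrow> card ([A]\<^bsup>k\<^esup>) = card A choose k"
  unfolding nsets_def
  by (simp add: n_subsets[symmetric] finite_subset cong: conj_cong)

lemma max_span_prob_attained:
  obtains E where "E \<subseteq> [{..<n}]\<^bsup>2\<^esup>" "max_span_prob n k l = span_prob {..<n} E k l"
proof -
  let ?M = "(\<lambda>E. span_prob {..<n} E k l) ` Pow ([{..<n}]\<^bsup>2\<^esup>)"
  have "Max ?M \<in> ?M"
    by (rule Max_in) (auto simp: finite_imp_finite_nsets)
  then show ?thesis
    using that by (auto simp: max_span_prob_def)
qed

lemma max_span_prob_nonneg: "0 \<le> max_span_prob n k l"
proof -
  obtain E where "max_span_prob n k l = span_prob {..<n} E k l"
    using max_span_prob_attained by blast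
  then show ?thesis
    by (simp add: span_prob_def)
qed

lemma max_span_prob_Suc_le:
  assumes "k \<le> n"
  shows "max_span_prob (Suc n) k l \<le> max_span_prob n k l"
proof -
  let ?V = "{..<Suc n}"
  obtain E where E: "E \<subseteq> [?V]\<^bsup>2\<^esup>" and max: "max_span_prob (Suc n) k l = span_prob ?V E k l"
    using max_span_prob_attained by blast
  define G where "G = {S \<in> [?V]\<^bsup>k\<^esup>. card (edges_in E S) = l}"
  define H where "H v = {S \<in> G. v \<notin> S}" for v
  have finG: "finite G"
    by (simp add: G_def finite_imp_finite_nsets)
  have H_le: "real (card (H v)) \<le> max_span_prob n k l * real (n choose k)" if v: "v \<in> ?V" for v
  proof -
    let ?W = "?V - {v}"
    let ?E = "edges_in E ?W"
    have cW: "card ?W = n"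
      using v by simp
    have "edges_in ?E S = edges_in E S" if "S \<subseteq> ?W" for S
      using that by (auto simp: edges_in_def)
    moreover have "S \<in> [?W]\<^bsup>k\<^esup> \<longleftrightarrow> S \<in> [?V]\<^bsup>k\<^esup> \<and> v \<notin> S" for S
      by (auto simp: nsets_def)
    moreover have "S \<subseteq> ?W" if "S \<in> [?W]\<^bsup>k\<^esup>" for S
      using that by (auto simp: nsets_def)
    ultimately have "{S \<in> [?W]\<^bsup>k\<^esup>. card (edges_in ?E S) = l} = H v"
      by (auto simp: H_def G_def)
    then have sp: "span_prob ?W ?E k l = real (card (H v)) / real (n choose k)"
      using cW by (simp add: span_prob_def card_nsets_binomial)
    have "?E \<subseteq> [?W]\<^bsup>2\<^esup>"
      using E by (auto simp: edges_in_def nsets_def)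
    then have "span_prob ?W ?E k l \<le> max_span_prob n k l"
      using span_prob_le_max_span_prob[of ?W ?E k l] cW by simp
    then show ?thesis
      using sp assms by (simp add: divide_simps)
  qed
  have "(\<Sum>v\<in>?V. card (H v)) = (\<Sum>v\<in>?V. \<Sum>S\<in>G. if v \<notin> S then 1 else 0)"
    using finG by (intro sum.cong refl) (simp add: H_def sum.If_cases Int_def)
  also have "\<dots> = (\<Sum>S\<in>G. \<Sum>v\<in>?V. if v \<notin> S then 1 else 0)"
    by (rule sum.swap)
  also have "\<dots> = (\<Sum>S\<in>G. Suc n - k)"
  proof (rule sum.cong[OF refl])
    fix S assume "S \<in> G"
    then have S: "S \<subseteq> ?V" "finite S" "card S = k"
      by (auto simp: G_def nsets_def)
    have "(\<Sum>v\<in>?V. if v \<notin> S then 1 else 0) = card (?V - S)"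
      by (simp add: sum.If_cases Int_def set_diff_eq del: sum.lessThan_Suc)
    also have "\<dots> = Suc n - k"
      using S by (simp add: card_Diff_subset)
    finally show "(\<Sum>v\<in>?V. if v \<notin> S then 1 else 0) = Suc n - k" .
  qed
  finally have "(\<Sum>v\<in>?V. card (H v)) = card G * (Suc n - k)"
    by simp
  then have "real (card G) * real (Suc n - k) = (\<Sum>v\<in>?V. real (card (H v)))"
    by (metis of_nat_mult of_nat_sum)
  also have "\<dots> \<le> (\<Sum>v\<in>?V. max_span_prob n k l * real (n choose k))"
    by (intro sum_mono H_le)
  also have "\<dots> = max_span_prob n k l * real (Suc n * (n choose k))"
    by simp (simp add: algebra_simps)
  also have "Suc n * (n choose k) = (Suc n - k) * (Suc n choose k)"
    using binomial_absorb_comp[of "Suc n" k] by simp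
  also have "max_span_prob n k l * real ((Suc n - k) * (Suc n choose k))
      = max_span_prob n k l * real (Suc n choose k) * real (Suc n - k)"
    by simp
  finally have "real (card G) \<le> max_span_prob n k l * real (Suc n choose k)"
    using assms by (simp add: mult_le_cancel_right)
  moreover have "span_prob ?V E k l = real (card G) / real (Suc n choose k)"
    by (simp add: span_prob_def G_def card_nsets_binomial)
  moreover have "0 < real (Suc n choose k)"
    using assms by (simp del: binomial_Suc_Suc)
  ultimately show ?thesis
    using max by (simp add: pos_divide_le_eq del: binomial_Suc_Suc)
qed

lemma max_span_prob_tendsto_edge_inducibility:
  "(\<lambda>n. max_span_prob n k l) \<longlonglongrightarrow> edge_inducibility k l"
proof -
  have "decseq (\<lambda>n. max_span_prob (n + k) k l)"
    by (intro decseq_SucI) (simp add: max_span_prob_Suc_le)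
  then have "convergent (\<lambda>n. max_span_prob (n + k) k l)"
    by (metis decseq_convergent max_span_prob_nonneg convergentI)
  then have "convergent (\<lambda>n. max_span_prob n k l)"
    unfolding convergent_def by (blast intro: LIMSEQ_offset)
  then show ?thesis
    by (simp add: edge_inducibility_def convergent_LIMSEQ_iff)
qed

end

theory Submission
  imports Defs
begin

text \<open>
  A uniformly random \<open>k\<close>-subset of a very large vertex set is almost the same as \<open>k\<close> independent uniform
  vertices. All constants below are chosen before \<open>k\<close>.

  If the edge density is at least \<open>K / k\<close>, then the sample spans more than \<open>C k\<close> edges with high
  probability.

  Otherwise let \<open>H\<close> consist of vertices of density at least \<open>M / k\<close>, and let \<open>N\<close> be the binomial number
  of sampled vertices in \<open>H\<close>. Replacing a sampled vertex outside \<open>H\<close> by one in \<open>H\<close> increases the number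
  of edges, so at most one value of \<open>N\<close> is good, and each value \<open>N \<ge> 1\<close> has probability at most about
  \<open>1 / e\<close>. If \<open>H\<close> can be chosen of measure \<open>1 / k\<close>, then this also holds for \<open>N = 0\<close>. If not, a pigeonhole
  argument over growing thresholds makes a gap between the densities in \<open>H\<close> and those outside \<open>H\<close>, so
  that either only \<open>N = 0\<close> matters or the vertices outside \<open>H\<close> alone are unlikely to span \<open>l\<close> edges.

  It remains to treat graphs with all densities at most \<open>M / k\<close>. If the expected number of edges is
  large, then after exposing all but a few sampled vertices the number of edges is a sum of i.i.d.
  degrees whose parities vary, and the Littlewood--Offord argument shows that every value is unlikely.
  If it is bounded, then the sample may be replaced by a Bernoulli random set. Exposing greedily an
  independent set \<open>X\<close> of sampled vertices, the number of edges is strictly increasing in the sampled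
  part of the neighbourhood of \<open>X\<close>, and the LYM inequality bounds the probability of \<open>l \<ge> 1\<close> edges by the
  maximal point probability of a binomial distribution outside \<open>0\<close>, which is at most about \<open>1 / e\<close>.
\<close>

subsection \<open>Means over tuples\<close>

text \<open>Total division makes the mean over an empty set 0, so facts about the mean of a constant
  ask for a nonempty set.\<close>

definition mean :: "'a set \<Rightarrow> ('a \<Rightarrow> real) \<Rightarrow> real"
  where "mean A g = (\<Sum>x\<in>A. g x) / real (card A)"

text \<open>Expectation over \<open>m\<close> independent uniform draws with replacement. The
  recursion exposes one draw at a time, so properties of \<open>mean\<close> lift by induction on
  \<open>m\<close>; \<open>tuple_mean_eq_sum\<close> recovers the explicit average over
  lists.\<close>

primrec tuple_mean :: "'a set \<Rightarrow> nat \<Rightarrow> ('a list \<Rightarrow> real) \<Rightarrow> real" where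
  "tuple_mean A 0 = (\<lambda>f. f [])"
| "tuple_mean A (Suc m) = (\<lambda>f. mean A (\<lambda>x. tuple_mean A m (\<lambda>xs. f (x # xs))))"

lemma mean_mono: "(\<And>x. x \<in> A \<Longrightarrow> g x \<le> h x) \<Longrightarrow> mean A g \<le> mean A h"
  unfolding mean_def by (intro divide_right_mono sum_mono) auto

lemma mean_cong: "(\<And>x. x \<in> A \<Longrightarrow> g x = h x) \<Longrightarrow> mean A g = mean A h"
  unfolding mean_def by (metis (mono_tags, lifting) sum.cong)

lemma mean_add: "mean A (\<lambda>x. g x + h x) = mean A g + mean A h"
  unfolding mean_def by (simp add: sum.distrib add_divide_distrib)

lemma mean_diff: "mean A (\<lambda>x. g x - h x) = mean A g - mean A h"
  unfolding mean_def by (simp add: sum_subtractf diff_divide_distrib)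

lemma mean_cmult: "mean A (\<lambda>x. c * g x) = c * mean A g"
  unfolding mean_def by (simp add: sum_distrib_left)

lemma mean_multc: "mean A (\<lambda>x. g x * c) = mean A g * c"
  unfolding mean_def by (simp add: sum_distrib_right)

lemma mean_const: "finite A \<Longrightarrow> A \<noteq> {} \<Longrightarrow> mean A (\<lambda>x. c) = c"
  unfolding mean_def by simp

lemma mean_nonneg: "(\<And>x. x \<in> A \<Longrightarrow> 0 \<le> g x) \<Longrightarrow> 0 \<le> mean A g"
  unfolding mean_def by (simp add: sum_nonneg)

lemma mean_le_const: "finite A \<Longrightarrow> A \<noteq> {} \<Longrightarrow> (\<And>x. x \<in> A \<Longrightarrow> g x \<le> c) \<Longrightarrow> mean A g \<le> c"
  using mean_mono[of A g "\<lambda>_. c"] by (simp add: mean_const)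

lemma mean_swap: "mean A (\<lambda>x. mean B (\<lambda>y. f x y)) = mean B (\<lambda>y. mean A (\<lambda>x. f x y))"
  unfolding mean_def sum_divide_distrib[symmetric]
  by (subst sum.swap) simp

lemma mean_sum: "mean A (\<lambda>x. \<Sum>i\<in>I. f i x) = (\<Sum>i\<in>I. mean A (f i))"
  unfolding mean_def sum_divide_distrib[symmetric] by (subst sum.swap) simp

lemma abs_mean_le: "\<bar>mean A g\<bar> \<le> mean A (\<lambda>x. \<bar>g x\<bar>)"
  unfolding mean_def by (simp add: abs_divide divide_right_mono)

lemma mean_union:
  assumes "finite A" "A = H \<union> L" "H \<inter> L = {}"
  shows "mean A g = card H / card A * mean H g + card L / card A * mean L g"
proof -
  have f: "finite H" "finite L" using assms by auto
  have "(\<Sum>x\<in>A. g x) = (\<Sum>x\<in>H. g x) + (\<Sum>x\<in>L. g x)"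
    using assms f by (simp add: sum.union_disjoint)
  moreover have "card H * mean H g = (\<Sum>x\<in>H. g x)" "card L * mean L g = (\<Sum>x\<in>L. g x)"
    using f by (auto simp: mean_def)
  ultimately show ?thesis
    unfolding mean_def[of A] by (simp add: add_divide_distrib mult.commute)
qed

lemma mean_power2_deviation:
  assumes "finite A" "A \<noteq> {}"
  shows "mean A (\<lambda>x. (g x - mean A g)\<^sup>2) = mean A (\<lambda>x. (g x)\<^sup>2) - (mean A g)\<^sup>2"
proof -
  have "mean A (\<lambda>x. (g x - mean A g)\<^sup>2) = mean A (\<lambda>x. (g x)\<^sup>2 - (2 * mean A g) * g x + (mean A g)\<^sup>2)"
    by (rule mean_cong) (simp add: power2_diff algebra_simps)
  also have "\<dots> = mean A (\<lambda>x. (g x)\<^sup>2) - (2 * mean A g) * mean A g + (mean A g)\<^sup>2"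
    using assms by (simp add: mean_add mean_diff mean_cmult mean_const)
  finally show ?thesis by (simp add: power2_eq_square)
qed

lemma tuple_mean_mono:
  "(\<And>xs. set xs \<subseteq> A \<Longrightarrow> length xs = m \<Longrightarrow> f xs \<le> g xs) \<Longrightarrow> tuple_mean A m f \<le> tuple_mean A m g"
  by (induction m arbitrary: f g) (auto intro!: mean_mono)

lemma tuple_mean_cong:
  "(\<And>xs. set xs \<subseteq> A \<Longrightarrow> length xs = m \<Longrightarrow> f xs = g xs) \<Longrightarrow> tuple_mean A m f = tuple_mean A m g"
  by (intro antisym tuple_mean_mono) auto

lemma tuple_mean_add: "tuple_mean A m (\<lambda>xs. f xs + g xs) = tuple_mean A m f + tuple_mean A m g"
  by (induction m arbitrary: f g) (auto simp: mean_add)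

lemma tuple_mean_diff: "tuple_mean A m (\<lambda>xs. f xs - g xs) = tuple_mean A m f - tuple_mean A m g"
  by (induction m arbitrary: f g) (auto simp: mean_diff)

lemma tuple_mean_cmult: "tuple_mean A m (\<lambda>xs. c * f xs) = c * tuple_mean A m f"
  by (induction m arbitrary: f) (auto simp: mean_cmult)

lemma tuple_mean_const: "finite A \<Longrightarrow> A \<noteq> {} \<Longrightarrow> tuple_mean A m (\<lambda>xs. c) = c"
  by (induction m) (auto simp: mean_const)

lemma tuple_mean_nonneg:
  "(\<And>xs. set xs \<subseteq> A \<Longrightarrow> length xs = m \<Longrightarrow> 0 \<le> f xs) \<Longrightarrow> 0 \<le> tuple_mean A m f"
  by (induction m arbitrary: f) (auto intro!: mean_nonneg)

lemma tuple_mean_le_const: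
  "finite A \<Longrightarrow> A \<noteq> {} \<Longrightarrow> (\<And>xs. set xs \<subseteq> A \<Longrightarrow> length xs = m \<Longrightarrow> f xs \<le> c) \<Longrightarrow> tuple_mean A m f \<le> c"
  using tuple_mean_mono[of A m f "\<lambda>_. c"] by (simp add: tuple_mean_const)

lemma tuple_mean_sum: "tuple_mean A m (\<lambda>xs. \<Sum>i\<in>I. f i xs) = (\<Sum>i\<in>I. tuple_mean A m (f i))"
  by (induction m arbitrary: f) (auto simp: mean_sum)

lemma tuple_mean_append:
  "tuple_mean A (m + m') f = tuple_mean A m (\<lambda>xs. tuple_mean A m' (\<lambda>ys. f (xs @ ys)))"
  by (induction m arbitrary: f) auto

lemma mean_tuple_mean_swap:
  "mean B (\<lambda>v. tuple_mean A m (\<lambda>xs. f v xs)) = tuple_mean A m (\<lambda>xs. mean B (\<lambda>v. f v xs))"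
proof (induction m arbitrary: f)
  case (Suc m)
  have "mean B (\<lambda>v. tuple_mean A (Suc m) (\<lambda>xs. f v xs))
      = mean A (\<lambda>x. mean B (\<lambda>v. tuple_mean A m (\<lambda>xs. f v (x # xs))))"
    by (simp add: mean_swap[of B])
  then show ?case
    by (simp add: Suc.IH)
qed simp

lemma tuple_mean_take:
  assumes "finite A" "A \<noteq> {}" "j \<le> m"
  shows "tuple_mean A m (\<lambda>xs. f (take j xs)) = tuple_mean A j f"
proof -
  have "tuple_mean A (j + (m - j)) (\<lambda>xs. f (take j xs)) = tuple_mean A j f"
    unfolding tuple_mean_append
    by (rule tuple_mean_cong) (use assms in \<open>simp add: tuple_mean_const\<close>)
  then show ?thesis using assms by simp
qed

lemma tuple_mean_prod_list:
  "tuple_mean A m (\<lambda>xs. prod_list (map h xs)) = mean A h ^ m"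
  by (induction m) (auto simp: tuple_mean_cmult mean_multc)

lemma tuple_mean_sum_list:
  assumes "finite A" "A \<noteq> {}"
  shows "tuple_mean A m (\<lambda>xs. sum_list (map h xs)) = real m * mean A h"
  using assms by (induction m) (auto simp: tuple_mean_add tuple_mean_const mean_add mean_const algebra_simps)

lemma tuple_mean_markov:
  assumes "\<And>xs. set xs \<subseteq> A \<Longrightarrow> length xs = m \<Longrightarrow> 0 \<le> f xs" and "c > 0"
  shows "tuple_mean A m (\<lambda>xs. of_bool (f xs \<ge> c)) \<le> tuple_mean A m f / c"
proof -
  have "tuple_mean A m (\<lambda>xs. of_bool (f xs \<ge> c)) \<le> tuple_mean A m (\<lambda>xs. (1 / c) * f xs)"
    using assms by (intro tuple_mean_mono) (auto simp: field_simps)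
  then show ?thesis by (simp only: tuple_mean_cmult) simp
qed

section \<open>Exponential bound for the lower tail of an i.i.d. sum\<close>

lemma two_powr_minus_le:
  assumes "0 \<le> x" "x \<le> 1"
  shows "2 powr (- x) \<le> 1 - x / (2::real)"
proof -
  \<comment> \<open>The chord of the convex function \<open>exp\<close> between the points 0 and
    \<open>- ln 2\<close>.\<close>
  have "exp ((1 - x) *\<^sub>R 0 + x *\<^sub>R (- ln 2)) \<le> (1 - x) * exp 0 + x * exp (- ln 2 :: real)"
    using assms by (intro convex_onD[OF exp_convex]) auto
  then show ?thesis
    by (simp add: powr_def exp_minus)
qed

lemma one_minus_power_le_exp:
  assumes "0 \<le> y" "y \<le> (1::real)"
  shows "(1 - y) ^ m \<le> exp (- real m * y)"
proof -
  have "(1 - y) ^ m \<le> exp (- y) ^ m"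
    using assms exp_ge_add_one_self[of "-y"] by (intro power_mono) auto
  then show ?thesis by (simp add: exp_of_nat_mult[symmetric])
qed

text \<open>Chernoff's method with base 2: the indicator is at most 2 to the power \<open>a\<close>
  minus the sum, whose expectation factors over the independent draws, and each factor is at most
  \<open>1 - mean A g / 2\<close>.\<close>

lemma tuple_mean_lower_tail:
  assumes "finite A" "A \<noteq> {}" and g: "\<And>x. x \<in> A \<Longrightarrow> 0 \<le> g x \<and> g x \<le> 1"
  shows "tuple_mean A m (\<lambda>xs. of_bool (sum_list (map g xs) \<le> a)) \<le> 2 powr a * exp (- (real m * mean A g / 2))"
proof -
  have prod: "2 powr (- sum_list (map g xs)) = prod_list (map (\<lambda>x. 2 powr (- g x)) xs)" for xs
    by (induction xs) (simp_all add: powr_diff powr_minus field_simps)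
  have "tuple_mean A m (\<lambda>xs. of_bool (sum_list (map g xs) \<le> a))
      \<le> tuple_mean A m (\<lambda>xs. 2 powr a * 2 powr (- sum_list (map g xs)))"
    by (rule tuple_mean_mono) (auto simp: powr_add[symmetric] ge_one_powr_ge_zero)
  also have "\<dots> = 2 powr a * mean A (\<lambda>x. 2 powr (- g x)) ^ m"
    by (simp add: prod tuple_mean_cmult tuple_mean_prod_list)
  finally have *: "tuple_mean A m (\<lambda>xs. of_bool (sum_list (map g xs) \<le> a)) \<le> 2 powr a * mean A (\<lambda>x. 2 powr (- g x)) ^ m" .
  have "mean A (\<lambda>x. 2 powr (- g x)) \<le> mean A (\<lambda>x. 1 - g x / 2)"
    by (rule mean_mono) (use g two_powr_minus_le in auto)
  also have "\<dots> = 1 - mean A g / 2"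
    using assms mean_cmult[of A "1/2" g] by (simp add: mean_diff mean_const)
  finally have "mean A (\<lambda>x. 2 powr (- g x)) ^ m \<le> (1 - mean A g / 2) ^ m"
    by (intro power_mono mean_nonneg) auto
  also have "\<dots> \<le> exp (- real m * (mean A g / 2))"
    using assms mean_nonneg[of A g] mean_le_const[of A g 1] by (intro one_minus_power_le_exp) auto
  finally have "2 powr a * mean A (\<lambda>x. 2 powr (- g x)) ^ m \<le> 2 powr a * exp (- (real m * mean A g / 2))"
    by (simp add: mult_left_mono)
  with * show ?thesis by linarith
qed

subsection \<open>Edges and densities\<close>

definition degree_in :: "('a \<Rightarrow> 'a \<Rightarrow> bool) \<Rightarrow> 'a \<Rightarrow> 'a list \<Rightarrow> nat"
  where "degree_in r x xs = length (filter (r x) xs)"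

text \<open>Pairs of positions are counted, each at its earlier entry, so repeated vertices count
  with multiplicity, as suits sampling with replacement. For the relation \<open>(=)\<close> this is
  the number of coincidences.\<close>

primrec edge_count :: "('a \<Rightarrow> 'a \<Rightarrow> bool) \<Rightarrow> 'a list \<Rightarrow> nat" where
  "edge_count r [] = 0"
| "edge_count r (x # xs) = degree_in r x xs + edge_count r xs"

definition vertex_density :: "('a \<Rightarrow> 'a \<Rightarrow> bool) \<Rightarrow> 'a set \<Rightarrow> 'a \<Rightarrow> real"
  where "vertex_density r A x = mean A (\<lambda>y. of_bool (r x y))"

definition edge_density :: "('a \<Rightarrow> 'a \<Rightarrow> bool) \<Rightarrow> 'a set \<Rightarrow> real"
  where "edge_density r A = mean A (vertex_density r A)"

lemma degree_in_Nil [simp]: "degree_in r x [] = 0"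
  by (simp add: degree_in_def)

lemma degree_in_Cons [simp]: "degree_in r x (y # ys) = of_bool (r x y) + degree_in r x ys"
  by (simp add: degree_in_def)

lemma degree_in_append [simp]: "degree_in r x (xs @ ys) = degree_in r x xs + degree_in r x ys"
  by (simp add: degree_in_def)

lemma degree_in_le_length: "degree_in r x xs \<le> length xs"
  by (simp add: degree_in_def)

lemma real_degree_in: "real (degree_in r x xs) = sum_list (map (\<lambda>y. of_bool (r x y)) xs)"
  by (induction xs) auto

lemma edge_count_append:
  assumes "symp r"
  shows "edge_count r (xs @ ys) = edge_count r xs + edge_count r ys + (\<Sum>y\<leftarrow>ys. degree_in r y xs)"
proof (induction xs)
  case Nil
  show ?case by (induction ys) auto
next
  case (Cons x xs)
  have "degree_in r x ys + (\<Sum>y\<leftarrow>ys. degree_in r y xs) = (\<Sum>y\<leftarrow>ys. of_bool (r y x) + degree_in r y xs)"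
    using assms by (induction ys) (auto dest: sympD)
  then show ?case using Cons by simp
qed

lemma edge_count_append_swap:
  "symp r \<Longrightarrow> edge_count r (us @ x # vs) = edge_count r (x # us @ vs)"
  by (induction us) (auto dest: sympD)

text \<open>By symmetry the head of one list can be moved to the front of the other. This later
  allows a sample to be sorted into its vertices of high density followed by the rest.\<close>

lemma edge_count_mset_cong:
  assumes "symp r" "mset xs = mset ys"
  shows "edge_count r xs = edge_count r ys"
  using assms(2)
proof (induction xs arbitrary: ys)
  case (Cons x xs)
  then have "x \<in> set ys" by (metis list.set_intros(1) mset_eq_setD)
  then obtain us vs where ys: "ys = us @ x # vs" by (meson split_list)
  then have m: "mset xs = mset (us @ vs)" using Cons.prems by simp
  have "degree_in r x xs = degree_in r x (us @ vs)"
    unfolding degree_in_def using m by (metis mset_filter size_mset)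
  then show ?case
    using Cons.IH[OF m] assms(1) by (simp add: ys edge_count_append_swap)
qed simp

lemma vertex_density_bounds:
  assumes "finite A" "A \<noteq> {}"
  shows "0 \<le> vertex_density r A x" "vertex_density r A x \<le> 1"
  unfolding vertex_density_def using assms by (auto intro!: mean_nonneg mean_le_const)

lemma edge_density_nonneg: "0 \<le> edge_density r A"
  unfolding edge_density_def vertex_density_def by (intro mean_nonneg) auto

lemma mean_degree_in:
  assumes "symp r"
  shows "mean A (\<lambda>y. real (degree_in r y xs)) = sum_list (map (vertex_density r A) xs)"
proof (induction xs)
  case Nil
  then show ?case by (simp add: mean_def)
next
  case (Cons x xs)
  have "mean A (\<lambda>y. real (degree_in r y (x # xs)))
     = mean A (\<lambda>y. of_bool (r x y) + real (degree_in r y xs))"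
    by (rule mean_cong) (use assms in \<open>auto dest: sympD\<close>)
  also have "\<dots> = mean A (\<lambda>y. of_bool (r x y)) + mean A (\<lambda>y. real (degree_in r y xs))"
    by (rule mean_add)
  finally show ?case using Cons by (simp add: vertex_density_def)
qed

lemma tuple_mean_degree_in:
  "finite A \<Longrightarrow> A \<noteq> {} \<Longrightarrow> tuple_mean A m (\<lambda>xs. real (degree_in r x xs)) = real m * vertex_density r A x"
  unfolding real_degree_in vertex_density_def by (rule tuple_mean_sum_list)

lemma tuple_mean_edge_count:
  assumes "finite A" "A \<noteq> {}"
  shows "tuple_mean A m (\<lambda>xs. real (edge_count r xs)) = real (m choose 2) * edge_density r A"
proof (induction m)
  case (Suc m)
  have "tuple_mean A (Suc m) (\<lambda>xs. real (edge_count r xs))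
      = mean A (\<lambda>x. real m * vertex_density r A x + real (m choose 2) * edge_density r A)"
    using assms Suc by (simp add: tuple_mean_add tuple_mean_degree_in)
  also have "\<dots> = real m * edge_density r A + real (m choose 2) * edge_density r A"
    using assms by (simp add: mean_add mean_cmult mean_const edge_density_def)
  finally show ?case
    by (simp add: numeral_2_eq_2 algebra_simps)
qed simp

text \<open>Two rounds of exposure, each with the lower tail bound. The first \<open>h\<close> draws
  have total density above \<open>c\<close> unless the first error occurs; then the degrees of the
  next \<open>h\<close> draws into them are large unless the second occurs. The remaining
  \<open>k - 2 * h\<close> draws can only add edges.\<close>

lemma few_edges_bound:
  assumes A: "finite A" "A \<noteq> {}" and sym: "symp r" and h: "1 \<le> h" "2 * h \<le> k"
  shows "tuple_mean A k (\<lambda>xs. of_bool (real (edge_count r xs) \<le> a))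
    \<le> 2 powr c * exp (- (real h * edge_density r A / 2)) + 2 powr (a / h) * exp (- (c / 2))"
proof -
  define s where "s xs = sum_list (map (vertex_density r A) xs)" for xs
  have "tuple_mean A (h + (h + (k - 2 * h))) (\<lambda>xs. of_bool (real (edge_count r xs) \<le> a))
      = tuple_mean A h (\<lambda>xs. tuple_mean A h (\<lambda>ys. tuple_mean A (k - 2 * h) (\<lambda>zs.
           of_bool (real (edge_count r (xs @ ys @ zs)) \<le> a))))"
    by (simp only: tuple_mean_append)
  also have "\<dots> \<le> tuple_mean A h (\<lambda>xs. of_bool (s xs \<le> c) + 2 powr (a / h) * exp (- (c / 2)))"
  proof (rule tuple_mean_mono)
    fix xs assume xs: "set xs \<subseteq> A" "length xs = h"
    \<comment> \<open>Division by \<open>h\<close> brings the degrees into the unit interval, as the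
      lower tail bound requires; the threshold \<open>a\<close> becomes
      \<open>a / h\<close>.\<close>
    let ?g = "\<lambda>y. real (degree_in r y xs) / real h"
    have "tuple_mean A h (\<lambda>ys. tuple_mean A (k - 2 * h) (\<lambda>zs.
           of_bool (real (edge_count r (xs @ ys @ zs)) \<le> a)))
        \<le> tuple_mean A h (\<lambda>ys. of_bool (sum_list (map ?g ys) \<le> a / h))"
    proof (intro tuple_mean_mono tuple_mean_le_const[OF A])
      fix ys zs :: "'a list"
      have "edge_count r (xs @ ys @ zs) \<ge> (\<Sum>y\<leftarrow>ys. degree_in r y xs)"
        using sym by (simp add: edge_count_append)
      moreover have "sum_list (map ?g ys) = real (\<Sum>y\<leftarrow>ys. degree_in r y xs) / real h"
        by (induction ys) (auto simp: add_divide_distrib)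
      ultimately show "(of_bool (real (edge_count r (xs @ ys @ zs)) \<le> a) :: real) \<le> of_bool (sum_list (map ?g ys) \<le> a / h)"
        using h by (auto simp: divide_right_mono)
    qed
    also have "\<dots> \<le> 2 powr (a / h) * exp (- (real h * mean A ?g / 2))"
      using h xs degree_in_le_length[of r _ xs] by (intro tuple_mean_lower_tail[OF A]) auto
    also have "real h * mean A ?g = s xs"
      using h mean_multc[of A "\<lambda>y. real (degree_in r y xs)" "1 / h"] mean_degree_in[OF sym, of A xs]
      by (simp add: s_def)
    also have "2 powr (a / h) * exp (- (s xs / 2)) \<le> 2 powr (a / h) * exp (- (c / 2))" if "s xs > c"
      using that by (intro mult_left_mono) auto
    finally have *: "tuple_mean A h (\<lambda>ys. tuple_mean A (k - 2 * h) (\<lambda>zs.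
           of_bool (real (edge_count r (xs @ ys @ zs)) \<le> a))) \<le> 2 powr (a / h) * exp (- (c / 2))" if "s xs > c"
      using that by blast
    have "tuple_mean A h (\<lambda>ys. tuple_mean A (k - 2 * h) (\<lambda>zs.
           of_bool (real (edge_count r (xs @ ys @ zs)) \<le> a))) \<le> 1"
      by (intro tuple_mean_le_const[OF A]) auto
    moreover have "0 \<le> 2 powr (a / h) * exp (- (c / 2))" by simp
    ultimately have "tuple_mean A h (\<lambda>ys. tuple_mean A (k - 2 * h) (\<lambda>zs.
           of_bool (real (edge_count r (xs @ ys @ zs)) \<le> a)))
        \<le> 1 + 2 powr (a / h) * exp (- (c / 2))"
      by linarith
    then show "tuple_mean A h (\<lambda>ys. tuple_mean A (k - 2 * h) (\<lambda>zs.
           of_bool (real (edge_count r (xs @ ys @ zs)) \<le> a)))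
        \<le> of_bool (s xs \<le> c) + 2 powr (a / h) * exp (- (c / 2))"
      using * by (cases "s xs \<le> c") auto
  qed
  also have "\<dots> \<le> 2 powr c * exp (- (real h * edge_density r A / 2)) + 2 powr (a / h) * exp (- (c / 2))"
    unfolding tuple_mean_add tuple_mean_const[OF A] s_def edge_density_def
    using vertex_density_bounds[OF A] by (intro add_mono tuple_mean_lower_tail[OF A]) auto
  finally show ?thesis
    using h by simp
qed

subsection \<open>Antichains and Bernoulli random sets\<close>

text \<open>Induction by deleting a point. If \<open>D\<close> lies in the antichain, it is the only
  member. Otherwise the weight of each \<open>A\<close>, multiplied by \<open>card D\<close>, equals
  the sum over the points \<open>x\<close> outside \<open>A\<close> of the weight of
  \<open>A\<close> in \<open>D - {x}\<close>, and for each \<open>x\<close> the members avoiding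
  \<open>x\<close> form an antichain there.\<close>

lemma lym_inequality:
  assumes "finite D" "F \<subseteq> Pow D" "\<And>A B. A \<in> F \<Longrightarrow> B \<in> F \<Longrightarrow> A \<subseteq> B \<Longrightarrow> A = B"
  shows "(\<Sum>A\<in>F. 1 / real (card D choose card A)) \<le> 1"
  using assms
proof (induction "card D" arbitrary: D F)
  case 0
  then have "D = {}" by simp
  then have "F = {} \<or> F = {{}}" using 0(3) by auto
  then show ?case using \<open>D = {}\<close> by auto
next
  case (Suc m)
  show ?case
  proof (cases "D \<in> F")
    case True
    then have "F = {D}" using Suc.prems by blast
    then show ?thesis by simp
  next
    case False
    have finF: "finite F" using Suc.prems by (meson finite_Pow_iff finite_subset)
    have D: "real (card D) > 0" using Suc.hyps(2) by linarith
    define w where "w A = 1 / real (m choose card A)" for A :: "'a set"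
    have 1: "card D * (1 / real (card D choose card A)) = (\<Sum>x\<in>D. if x \<notin> A then w A else 0)" if "A \<in> F" for A
    proof -
      have A: "A \<subset> D" using that Suc.prems False by blast
      then have lt: "card A < card D" using Suc.prems psubset_card_mono by blast
      have fA: "finite A" using A Suc.prems(1) finite_subset by blast
      have "(\<Sum>x\<in>D. if x \<notin> A then w A else 0) = (\<Sum>x\<in>D - A. w A)"
        using Suc.prems(1) by (intro sum.mono_neutral_cong_right) auto
      also have "\<dots> = real (card D - card A) * w A"
        using A fA by (simp add: card_Diff_subset)
      finally have s: "(\<Sum>x\<in>D. if x \<notin> A then w A else 0) = real (card D - card A) * w A" .
      have "(card D - card A) * (card D choose card A) = card D * (m choose card A)"
        using binomial_absorb_comp[of "card D" "card A"] Suc.hyps(2) by (metis diff_Suc_1)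
      then have "real (card D - card A) * real (card D choose card A) = real (card D) * real (m choose card A)"
        by (metis of_nat_mult)
      moreover have "real (m choose card A) > 0" "real (card D choose card A) > 0"
        using lt Suc.hyps(2) by (simp_all add: zero_less_binomial_iff)
      ultimately have "real (card D) / real (card D choose card A) = real (card D - card A) / real (m choose card A)"
        by (simp add: frac_eq_eq)
      then show ?thesis
        using s by (simp add: w_def)
    qed
    have 2: "(\<Sum>A\<in>F. if x \<notin> A then w A else 0) \<le> 1" if x: "x \<in> D" for x
    proof -
      have cd: "m = card (D - {x})" using x Suc.hyps(2) Suc.prems(1) by simp
      have "(\<Sum>A\<in>F. if x \<notin> A then w A else 0) = (\<Sum>A\<in>{A\<in>F. x \<notin> A}. w A)"
        using finF by (intro sum.mono_neutral_cong_right) auto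
      also have "\<dots> = (\<Sum>A\<in>{A\<in>F. x \<notin> A}. 1 / real (card (D - {x}) choose card A))"
        by (simp add: w_def cd)
      also have "\<dots> \<le> 1"
        using Suc.prems by (intro Suc.hyps(1)[OF cd]) auto
      finally show ?thesis .
    qed
    have "card D * (\<Sum>A\<in>F. 1 / real (card D choose card A)) = (\<Sum>A\<in>F. \<Sum>x\<in>D. if x \<notin> A then w A else 0)"
      unfolding sum_distrib_left using 1 by (intro sum.cong) auto
    also have "\<dots> = (\<Sum>x\<in>D. \<Sum>A\<in>F. if x \<notin> A then w A else 0)"
      by (rule sum.swap)
    also have "\<dots> \<le> (\<Sum>x\<in>D. 1)"
      using 2 by (rule sum_mono)
    finally show ?thesis
      using D by simp
  qed
qed

section \<open>Point probabilities of the binomial distribution\<close>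

lemma Bernstein_Suc_Suc:
  "Bernstein (Suc m) (Suc j) p = p * Bernstein m j p + (1 - p) * Bernstein m (Suc j) p"
proof (cases "j < m")
  case True
  then obtain i where "m = Suc (j + i)" by (auto simp: less_iff_Suc_add)
  then show ?thesis
    by (simp add: Bernstein_def algebra_simps)
next
  case False
  then consider "j = m" | "m < j" by linarith
  then show ?thesis
    by cases (simp_all add: Bernstein_def binomial_eq_0)
qed

lemma Bernstein_Suc_0: "Bernstein (Suc m) 0 p = (1 - p) * Bernstein m 0 p"
  by (simp add: Bernstein_def)

lemma x_exp_minus_le: "x * exp (- x) \<le> exp (- 1 :: real)"
proof -
  have "x \<le> exp (x - 1)" using exp_ge_add_one_self[of "x - 1"] by simp
  then have "x * exp (- x) \<le> exp (x - 1) * exp (- x)" by simp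
  also have "\<dots> = exp (- 1)" by (simp flip: exp_add)
  finally show ?thesis .
qed

text \<open>The source of the constant \<open>1 / e\<close>. For \<open>j = 1\<close> the value is
  \<open>m * p * (1 - p) ^ (m - 1)\<close>, where the exponent \<open>m - 1\<close> instead of
  \<open>m\<close> costs the factor \<open>exp p\<close>. For larger \<open>j\<close>, conditioning
  on one trial gives a convex combination of two values that obey the bound by the inductions on
  \<open>j\<close> and \<open>m\<close>.\<close>

lemma Bernstein_le:
  assumes "0 \<le> p" "p \<le> 1" "1 \<le> j"
  shows "Bernstein m j p \<le> exp (p - 1)"
  using assms(3)
proof (induction j arbitrary: m rule: nat_induct_at_least)
  case base
  show ?case
  proof (cases m)
    case 0
    then show ?thesis by (simp add: Bernstein_def)
  next
    case (Suc i)
    have "(1 - p) ^ i \<le> exp (- p) ^ i"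
      using assms exp_ge_add_one_self[of "-p"] by (intro power_mono) auto
    also have "\<dots> = exp (- (real m * p)) * exp p"
      by (simp add: Suc algebra_simps flip: exp_of_nat_mult exp_add)
    finally have "Bernstein m 1 p \<le> (real m * p) * (exp (- (real m * p)) * exp p)"
      using assms Suc by (simp add: Bernstein_def mult_left_mono)
    also have "\<dots> = (real m * p * exp (- (real m * p))) * exp p" by simp
    also have "\<dots> \<le> exp (- 1) * exp p"
      by (intro mult_right_mono x_exp_minus_le) auto
    finally show ?thesis by (simp flip: exp_add)
  qed
next
  case (Suc j)
  show ?case
  proof (induction m)
    case 0
    show ?case by (simp add: Bernstein_def)
  next
    case (Suc m)
    have "Bernstein (Suc m) (Suc j) p \<le> p * exp (p - 1) + (1 - p) * exp (p - 1)"
      unfolding Bernstein_Suc_Suc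
      using assms Suc.IH Suc.prems \<open>\<And>m. Bernstein m j p \<le> exp (p - 1)\<close>
      by (intro add_mono mult_left_mono) auto
    then show ?case by (simp add: algebra_simps)
  qed
qed

section \<open>Events of a Bernoulli random set\<close>

definition bernoulli_mean :: "real \<Rightarrow> 'a set \<Rightarrow> ('a set \<Rightarrow> real) \<Rightarrow> real"
  where "bernoulli_mean p A f = (\<Sum>B\<in>Pow A. p ^ card B * (1 - p) ^ (card A - card B) * f B)"

lemma bernoulli_mean_insert:
  assumes "finite A" "u \<notin> A"
  shows "bernoulli_mean p (insert u A) f
    = p * bernoulli_mean p A (\<lambda>B. f (insert u B)) + (1 - p) * bernoulli_mean p A f"
proof -
  have "bernoulli_mean p (insert u A) f
      = (\<Sum>B\<in>Pow A. p ^ card B * (1 - p) ^ (Suc (card A) - card B) * f B)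
      + (\<Sum>B\<in>insert u ` Pow A. p ^ card B * (1 - p) ^ (Suc (card A) - card B) * f B)"
    unfolding bernoulli_mean_def Pow_insert
    using assms by (subst sum.union_disjoint) (auto simp: card_insert_disjoint)
  also have "(\<Sum>B\<in>insert u ` Pow A. p ^ card B * (1 - p) ^ (Suc (card A) - card B) * f B)
      = (\<Sum>B\<in>Pow A. p ^ card (insert u B) * (1 - p) ^ (Suc (card A) - card (insert u B)) * f (insert u B))"
    using assms by (subst sum.reindex) (auto simp: inj_on_def)
  also have "\<dots> = (\<Sum>B\<in>Pow A. p * (p ^ card B * (1 - p) ^ (card A - card B) * f (insert u B)))"
  proof (rule sum.cong[OF refl])
    fix B assume "B \<in> Pow A"
    then have "card (insert u B) = Suc (card B)"
      using assms by (metis PowD card_insert_disjoint finite_subset subsetD)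
    then show "p ^ card (insert u B) * (1 - p) ^ (Suc (card A) - card (insert u B)) * f (insert u B)
      = p * (p ^ card B * (1 - p) ^ (card A - card B) * f (insert u B))" by simp
  qed
  also have "(\<Sum>B\<in>Pow A. p ^ card B * (1 - p) ^ (Suc (card A) - card B) * f B)
      = (\<Sum>B\<in>Pow A. (1 - p) * (p ^ card B * (1 - p) ^ (card A - card B) * f B))"
  proof (rule sum.cong[OF refl])
    fix B assume "B \<in> Pow A"
    then have "Suc (card A) - card B = Suc (card A - card B)"
      using assms by (simp add: Suc_diff_le card_mono)
    then show "p ^ card B * (1 - p) ^ (Suc (card A) - card B) * f B
      = (1 - p) * (p ^ card B * (1 - p) ^ (card A - card B) * f B)" by simp
  qed
  finally show ?thesis
    by (simp add: bernoulli_mean_def sum_distrib_left)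
qed

text \<open>The weight of a set \<open>B\<close> is a binomial point probability divided by the
  number of sets of its size. For nonempty \<open>B\<close> the numerator is at most
  \<open>exp (p - 1)\<close>, and LYM sums the rest to at most 1. The empty set is excluded because
  its probability may be close to 1.\<close>

lemma bernoulli_mean_antichain_le:
  assumes D: "finite D" and p: "0 \<le> p" "p \<le> 1"
    and anti: "\<And>A B. P A \<Longrightarrow> P B \<Longrightarrow> A \<subset> B \<Longrightarrow> B \<subseteq> D \<Longrightarrow> False" and "\<not> P {}"
  shows "bernoulli_mean p D (\<lambda>B. of_bool (P B)) \<le> exp (p - 1)"
proof -
  define F where "F = {B \<in> Pow D. P B}"
  have "bernoulli_mean p D (\<lambda>B. of_bool (P B)) = (\<Sum>B\<in>F. p ^ card B * (1 - p) ^ (card D - card B))"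
    unfolding bernoulli_mean_def F_def using D by (intro sum.mono_neutral_cong_right) auto
  also have "\<dots> \<le> (\<Sum>B\<in>F. exp (p - 1) * (1 / real (card D choose card B)))"
  proof (rule sum_mono)
    fix B assume "B \<in> F"
    then have B: "B \<subseteq> D" "B \<noteq> {}" using \<open>\<not> P {}\<close> by (auto simp: F_def)
    then have "1 \<le> card B" "card B \<le> card D"
      using D by (auto simp: card_mono Suc_le_eq card_gt_0_iff finite_subset)
    then have "Bernstein (card D) (card B) p \<le> exp (p - 1)" "real (card D choose card B) > 0"
      using p by (auto intro: Bernstein_le)
    then show "p ^ card B * (1 - p) ^ (card D - card B) \<le> exp (p - 1) * (1 / real (card D choose card B))"
      by (simp add: Bernstein_def field_simps)
  qed
  also have "\<dots> = exp (p - 1) * (\<Sum>B\<in>F. 1 / real (card D choose card B))"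
    by (simp add: sum_distrib_left)
  also have "\<dots> \<le> exp (p - 1) * 1"
  proof (intro mult_left_mono lym_inequality)
    show "F \<subseteq> Pow D" by (auto simp: F_def)
    show "A = B" if "A \<in> F" "B \<in> F" "A \<subseteq> B" for A B
      using anti[of A B] that by (auto simp: F_def)
  qed (use D in auto)
  finally show ?thesis by simp
qed

text \<open>
  Exposing the random set vertex by vertex, but skipping every vertex that already has a neighbour in
  the exposed part \<open>X\<close>, keeps \<open>X\<close> independent. At the end each unexposed vertex is adjacent to \<open>X\<close>,
  so the number of edges is strictly increasing in the unexposed part.
\<close>

lemma bernoulli_mean_edges_le_aux:
  assumes "finite U" "finite D" "finite X" and p: "0 \<le> p" "p \<le> 1" and l: "1 \<le> (l::nat)"
    and "U \<inter> D = {}" "X \<inter> (U \<union> D) = {}"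
    and "edges_in E X = {}" and "\<And>x u. x \<in> X \<Longrightarrow> u \<in> U \<Longrightarrow> {x, u} \<notin> E"
    and "\<And>y. y \<in> D \<Longrightarrow> \<exists>x\<in>X. {x, y} \<in> E" and E: "\<And>e. e \<in> E \<Longrightarrow> card e = 2"
  shows "bernoulli_mean p (U \<union> D) (\<lambda>B. of_bool (card (edges_in E (X \<union> B)) = l)) \<le> exp (p - 1)"
  using assms
proof (induction "card U" arbitrary: U D X rule: less_induct)
  case less
  show ?case
  proof (cases "U = {}")
    case True
    \<comment> \<open>The empty set is not in the family, because \<open>X\<close> spans no edge
      while \<open>l\<close> is positive.\<close>
    have "bernoulli_mean p D (\<lambda>B. of_bool (card (edges_in E (X \<union> B)) = l)) \<le> exp (p - 1)"
    proof (rule bernoulli_mean_antichain_le)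
      fix A B assume AB: "card (edges_in E (X \<union> A)) = l" "card (edges_in E (X \<union> B)) = l" "A \<subset> B" "B \<subseteq> D"
      then obtain y where y: "y \<in> B" "y \<notin> A" "y \<in> D" by blast
      then obtain x where x: "x \<in> X" "{x, y} \<in> E" using less.prems by blast
      have "y \<notin> X" using y less.prems by blast
      then have "{x, y} \<in> edges_in E (X \<union> B)" "{x, y} \<notin> edges_in E (X \<union> A)"
        using x y by (auto simp: edges_in_def)
      moreover have "edges_in E (X \<union> A) \<subseteq> edges_in E (X \<union> B)"
        using AB by (auto simp: edges_in_def)
      ultimately have "edges_in E (X \<union> A) \<subset> edges_in E (X \<union> B)"
        by blast
      moreover have "finite (edges_in E (X \<union> B))"
        using less.prems(2,3) AB by (intro finite_subset[of "edges_in E (X \<union> B)" "Pow (X \<union> D)"]) (auto simp: edges_in_def)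
      ultimately show False
        using AB psubset_card_mono by (metis less_irrefl)
    qed (use less.prems(2,4-6,9) in auto)
    then show ?thesis using True by simp
  next
    case False
    then obtain u where u: "u \<in> U" by blast
    \<comment> \<open>If \<open>u\<close> is sampled, it joins \<open>X\<close> and its neighbours
      \<open>N\<close> move from \<open>U\<close> to \<open>D\<close>; if not, \<open>u\<close> is
      discarded. Both cases leave a smaller \<open>U\<close>, and the mean is a convex combination
      of the two.\<close>
    define N where "N = {v \<in> U. {u, v} \<in> E}"
    have uN: "u \<notin> N" using E[of "{u}"] by (auto simp: N_def)
    let ?f = "\<lambda>X B. of_bool (card (edges_in E (X \<union> B)) = l) :: real"
    have split: "U \<union> D = insert u ((U - {u}) \<union> D)" "u \<notin> (U - {u}) \<union> D"
      using u less.prems(7) by auto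
    have U': "(U - {u}) \<union> D = (U - {u} - N) \<union> (D \<union> N)"
      using uN by (auto simp: N_def)
    have lt: "card (U - {u}) < card U" "card (U - {u} - N) < card U"
      using u less.prems(1) by (intro psubset_card_mono; force)+
    have 1: "bernoulli_mean p ((U - {u} - N) \<union> (D \<union> N)) (?f (insert u X)) \<le> exp (p - 1)"
    proof (rule less.hyps[OF lt(2)])
      show "edges_in E (insert u X) = {}"
      proof (rule ccontr)
        assume "edges_in E (insert u X) \<noteq> {}"
        then obtain e where e: "e \<in> E" "e \<subseteq> insert u X" by (auto simp: edges_in_def)
        then have "u \<in> e" using less.prems(9) by (auto simp: edges_in_def)
        moreover obtain a b where "e = {a, b}" "a \<noteq> b" using E[OF e(1)] by (auto simp: card_2_iff)
        ultimately obtain x where "e = {x, u}" "x \<noteq> u" by auto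
        then show False using less.prems(10)[of x u] u e by auto
      qed
      show "\<exists>x\<in>insert u X. {x, y} \<in> E" if "y \<in> D \<union> N" for y
        using that less.prems(11) by (auto simp: N_def)
      show "{x, v} \<notin> E" if "x \<in> insert u X" "v \<in> U - {u} - N" for x v
        using that less.prems(10) by (auto simp: N_def)
    qed (use less.prems(1-8) E u uN in \<open>auto simp: N_def\<close>)
    have 2: "bernoulli_mean p ((U - {u}) \<union> D) (?f X) \<le> exp (p - 1)"
      by (rule less.hyps[OF lt(1)]) (use less.prems(1-10) in \<open>auto intro: less.prems(11) E\<close>)
    have "bernoulli_mean p (U \<union> D) (?f X)
        = p * bernoulli_mean p ((U - {u}) \<union> D) (\<lambda>B. ?f X (insert u B)) + (1 - p) * bernoulli_mean p ((U - {u}) \<union> D) (?f X)"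
      unfolding split(1) using split(2) less.prems(1,2) by (subst bernoulli_mean_insert) auto
    also have "\<dots> \<le> p * exp (p - 1) + (1 - p) * exp (p - 1)"
      using 1 2 p by (intro add_mono mult_left_mono) (auto simp: U')
    finally show ?thesis by (simp add: algebra_simps)
  qed
qed

lemma bernoulli_mean_edges_le:
  assumes "finite V" "0 \<le> p" "p \<le> 1" "1 \<le> l" "E \<subseteq> [W]\<^bsup>2\<^esup>"
  shows "bernoulli_mean p V (\<lambda>B. of_bool (card (edges_in E B) = l)) \<le> exp (p - 1)"
proof -
  have E: "card e = 2" if "e \<in> E" for e using assms(5) that by (auto simp: nsets_def)
  then have "{} \<notin> E" by (metis card.empty zero_neq_numeral)
  then have "edges_in E {} = {}" by (auto simp: edges_in_def)
  then show ?thesis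
    using bernoulli_mean_edges_le_aux[of V "{}" "{}" p l E] assms E by auto
qed

text \<open>Conditioned on its size, a Bernoulli random set is uniform, so grouping the subsets by
  size gives a binomial mixture.\<close>

lemma bernoulli_mean_span_prob:
  assumes "finite V"
  shows "bernoulli_mean p V (\<lambda>B. of_bool (card (edges_in E B) = l))
    = (\<Sum>j\<le>card V. Bernstein (card V) j p * span_prob V E j l)"
proof -
  have "bernoulli_mean p V (\<lambda>B. of_bool (card (edges_in E B) = l))
      = (\<Sum>j\<le>card V. \<Sum>B\<in>{B\<in>Pow V. card B = j}. p ^ card B * (1 - p) ^ (card V - card B) * of_bool (card (edges_in E B) = l))"
    unfolding bernoulli_mean_def
    by (rule sum.group[symmetric]) (use assms in \<open>auto simp: card_mono\<close>)
  also have "\<dots> = (\<Sum>j\<le>card V. Bernstein (card V) j p * span_prob V E j l)"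
  proof (rule sum.cong[OF refl])
    fix j assume "j \<in> {..card V}"
    then have pos: "real (card V choose j) > 0" by simp
    have eq: "{B\<in>Pow V. card B = j} = [V]\<^bsup>j\<^esup>"
      using assms by (auto simp: nsets_def intro: finite_subset)
    have "(\<Sum>B\<in>[V]\<^bsup>j\<^esup>. p ^ card B * (1 - p) ^ (card V - card B) * of_bool (card (edges_in E B) = l))
       = (\<Sum>B\<in>[V]\<^bsup>j\<^esup>. p ^ j * (1 - p) ^ (card V - j) * of_bool (card (edges_in E B) = l))"
      by (rule sum.cong) (auto simp: nsets_def)
    also have "\<dots> = p ^ j * (1 - p) ^ (card V - j) * card {S \<in> [V]\<^bsup>j\<^esup>. card (edges_in E S) = l}"
      using assms by (simp add: finite_imp_finite_nsets Int_def flip: sum_distrib_left)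
    also have "\<dots> = Bernstein (card V) j p * span_prob V E j l"
      using pos assms by (simp add: Bernstein_def span_prob_def card_nsets_binomial)
    finally show "(\<Sum>B\<in>{B\<in>Pow V. card B = j}. p ^ card B * (1 - p) ^ (card V - card B) * of_bool (card (edges_in E B) = l))
       = Bernstein (card V) j p * span_prob V E j l"
      by (simp only: eq)
  qed
  finally show ?thesis .
qed

subsection \<open>Splitting off the vertices of high vertex_density\<close>

text \<open>The number \<open>N\<close> of draws in \<open>H\<close> is binomial; given
  \<open>N\<close>, the draws inside and outside \<open>H\<close> are independent uniform tuples.
  The induction conditions on the side of the first draw and recombines the weights by
  \<open>Bernstein_Suc_Suc\<close>.\<close>

lemma tuple_mean_filter_split:
  assumes A: "finite A" "A \<noteq> {}" "A = H \<union> L" "H \<inter> L = {}"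
  shows "tuple_mean A k (\<lambda>xs. F (filter (\<lambda>x. x \<in> H) xs) (filter (\<lambda>x. x \<notin> H) xs))
    = (\<Sum>N\<le>k. Bernstein k N (card H / card A) * tuple_mean H N (\<lambda>as. tuple_mean L (k - N) (\<lambda>ws. F as ws)))"
proof (induction k arbitrary: F)
  case 0
  then show ?case by (simp add: Bernstein_def)
next
  case (Suc k)
  define p where "p = real (card H) / real (card A)"
  have "card A = card H + card L"
    using A by (simp add: card_Un_disjoint)
  moreover have "card A > 0" using A by (simp add: card_gt_0_iff)
  ultimately have "p + real (card L) / real (card A) = 1"
    unfolding p_def by (simp del: of_nat_add flip: add_divide_distrib of_nat_add)
  then have q: "real (card L) / real (card A) = 1 - p" by linarith
  define G where "G N M = tuple_mean H N (\<lambda>as. tuple_mean L M (\<lambda>ws. F as ws))" for N M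
  have H: "mean H (\<lambda>x. tuple_mean A k (\<lambda>xs. F (filter (\<lambda>x. x \<in> H) (x # xs)) (filter (\<lambda>x. x \<notin> H) (x # xs))))
      = (\<Sum>N\<le>k. Bernstein k N p * G (Suc N) (k - N))"
  proof -
    have "mean H (\<lambda>x. tuple_mean A k (\<lambda>xs. F (filter (\<lambda>x. x \<in> H) (x # xs)) (filter (\<lambda>x. x \<notin> H) (x # xs))))
      = mean H (\<lambda>x. tuple_mean A k (\<lambda>xs. F (x # filter (\<lambda>x. x \<in> H) xs) (filter (\<lambda>x. x \<notin> H) xs)))"
      by (rule mean_cong) simp
    also have "\<dots> = mean H (\<lambda>x. \<Sum>N\<le>k. Bernstein k N p * tuple_mean H N (\<lambda>as. tuple_mean L (k - N) (\<lambda>ws. F (x # as) ws)))"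
      by (subst Suc.IH[of "\<lambda>as ws. F (x # as) ws" for x]) (simp add: p_def)
    also have "\<dots> = (\<Sum>N\<le>k. Bernstein k N p * G (Suc N) (k - N))"
      by (simp add: mean_sum mean_cmult G_def)
    finally show ?thesis .
  qed
  have L: "mean L (\<lambda>x. tuple_mean A k (\<lambda>xs. F (filter (\<lambda>x. x \<in> H) (x # xs)) (filter (\<lambda>x. x \<notin> H) (x # xs))))
      = (\<Sum>N\<le>k. Bernstein k N p * G N (Suc (k - N)))"
  proof -
    have "mean L (\<lambda>x. tuple_mean A k (\<lambda>xs. F (filter (\<lambda>x. x \<in> H) (x # xs)) (filter (\<lambda>x. x \<notin> H) (x # xs))))
      = mean L (\<lambda>x. tuple_mean A k (\<lambda>xs. F (filter (\<lambda>x. x \<in> H) xs) (x # filter (\<lambda>x. x \<notin> H) xs)))"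
    proof (rule mean_cong)
      fix x assume "x \<in> L"
      then have "x \<notin> H" using A(4) by blast
      then show "tuple_mean A k (\<lambda>xs. F (filter (\<lambda>x. x \<in> H) (x # xs)) (filter (\<lambda>x. x \<notin> H) (x # xs)))
        = tuple_mean A k (\<lambda>xs. F (filter (\<lambda>x. x \<in> H) xs) (x # filter (\<lambda>x. x \<notin> H) xs))"
        by simp
    qed
    also have "\<dots> = mean L (\<lambda>x. \<Sum>N\<le>k. Bernstein k N p * tuple_mean H N (\<lambda>as. tuple_mean L (k - N) (\<lambda>ws. F as (x # ws))))"
      by (subst Suc.IH[of "\<lambda>as ws. F as (x # ws)" for x]) (simp add: p_def)
    also have "\<dots> = (\<Sum>N\<le>k. Bernstein k N p * G N (Suc (k - N)))"
      by (simp add: mean_sum mean_cmult G_def mean_tuple_mean_swap)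
    finally show ?thesis .
  qed
  have "tuple_mean A (Suc k) (\<lambda>xs. F (filter (\<lambda>x. x \<in> H) xs) (filter (\<lambda>x. x \<notin> H) xs))
      = p * (\<Sum>N\<le>k. Bernstein k N p * G (Suc N) (k - N)) + (1 - p) * (\<Sum>N\<le>k. Bernstein k N p * G N (Suc (k - N)))"
    unfolding tuple_mean.simps mean_union[OF A(1) A(3,4)] H L q p_def[symmetric] ..
  also have "(\<Sum>N\<le>k. Bernstein k N p * G N (Suc (k - N)))
      = (\<Sum>N\<le>Suc k. Bernstein k N p * G N (Suc k - N))"
  proof -
    have "Bernstein k (Suc k) p = 0" by (simp add: Bernstein_def)
    then show ?thesis by (simp add: Suc_diff_le)
  qed
  also have "\<dots> = Bernstein k 0 p * G 0 (Suc k) + (\<Sum>N\<le>k. Bernstein k (Suc N) p * G (Suc N) (k - N))"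
    by (subst sum.atMost_Suc_shift) simp
  also have "p * (\<Sum>N\<le>k. Bernstein k N p * G (Suc N) (k - N)) +
      (1 - p) * (Bernstein k 0 p * G 0 (Suc k) + (\<Sum>N\<le>k. Bernstein k (Suc N) p * G (Suc N) (k - N)))
      = Bernstein (Suc k) 0 p * G 0 (Suc k) + (\<Sum>N\<le>k. Bernstein (Suc k) (Suc N) p * G (Suc N) (k - N))"
    by (simp add: Bernstein_Suc_Suc Bernstein_Suc_0 algebra_simps sum.distrib sum_subtractf sum_distrib_left)
  also have "\<dots> = (\<Sum>N\<le>Suc k. Bernstein (Suc k) N p * G N (Suc k - N))"
    by (subst sum.atMost_Suc_shift) simp
  finally show ?case by (simp add: p_def G_def)
qed

section \<open>Exchanging low vertices for high vertices in a sample\<close>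

text \<open>Independence of the entry at position \<open>j\<close> from the entries before it; the
  later entries integrate out.\<close>

lemma tuple_mean_nth_take:
  assumes "finite A" "A \<noteq> {}" "j < m"
  shows "tuple_mean A m (\<lambda>xs. f (xs ! j) (take j xs)) = tuple_mean A j (\<lambda>xs. mean A (\<lambda>x. f x xs))"
proof -
  have "tuple_mean A (j + Suc (m - Suc j)) (\<lambda>xs. f (xs ! j) (take j xs))
      = tuple_mean A j (\<lambda>xs. mean A (\<lambda>x. f x xs))"
    unfolding tuple_mean_append
    by (rule tuple_mean_cong) (use assms in \<open>simp add: nth_append tuple_mean_const\<close>)
  then show ?thesis using assms by simp
qed

lemma tuple_mean_nth:
  assumes "finite A" "A \<noteq> {}" "j < m"
  shows "tuple_mean A m (\<lambda>xs. f (xs ! j)) = mean A f"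
  using tuple_mean_nth_take[OF assms, of "\<lambda>x _. f x"] assms by (simp add: tuple_mean_const)

text \<open>Passing from \<open>N\<close> to \<open>Suc N\<close> high vertices deletes one low
  vertex and inserts one high vertex. The deleted vertex loses at most \<open>c\<close> edges to the
  low vertices and at most \<open>T\<close> to the high ones. The inserted one gains more than
  \<open>c + T\<close> edges already into the first \<open>k - T\<close> low vertices, which are
  present for every \<open>N\<close> up to \<open>T\<close>.\<close>

lemma edge_count_exchange:
  assumes sym: "symp r" and as: "length as = T" and ws: "length ws = k" and T: "T \<le> k" and N: "N < T"
    and gain: "c + T < degree_in r (as ! N) (take (k - T) ws)"
    and loss: "degree_in r (ws ! (k - Suc N)) (take (k - Suc N) ws) \<le> c"
  shows "edge_count r (take N as @ take (k - N) ws) < edge_count r (take (Suc N) as @ take (k - Suc N) ws)"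
    and "c < edge_count r (take (Suc N) as @ take (k - Suc N) ws)"
proof -
  let ?a = "as ! N" and ?w = "ws ! (k - Suc N)" and ?as = "take N as" and ?ws = "take (k - Suc N) ws"
  have "take (k - N) ws = ?ws @ [?w]"
    using ws T N by (metis Suc_diff_Suc diff_less less_le_trans less_nat_zero_code not_gr_zero take_Suc_conv_app_nth zero_less_Suc)
  then have 1: "edge_count r (?as @ take (k - N) ws) = edge_count r (?as @ ?ws) + degree_in r ?w (?as @ ?ws)"
    using sym by (simp add: edge_count_append flip: append_assoc)
  have "take (Suc N) as = ?as @ [?a]"
    using as N by (simp add: take_Suc_conv_app_nth)
  then have 2: "edge_count r (take (Suc N) as @ ?ws) = edge_count r (?as @ ?ws) + degree_in r ?a (?as @ ?ws)"
    using sym by (simp add: edge_count_append_swap)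
  have "?ws = take (k - T) ws @ take (T - Suc N) (drop (k - T) ws)"
    using T N by (simp flip: take_add)
  then have "degree_in r ?a (take (k - T) ws) \<le> degree_in r ?a (?as @ ?ws)"
    by simp
  moreover have "degree_in r ?w ?as \<le> T"
    using degree_in_le_length[of r ?w ?as] as N by simp
  ultimately show "edge_count r (take N as @ take (k - N) ws) < edge_count r (take (Suc N) as @ take (k - Suc N) ws)"
    and "c < edge_count r (take (Suc N) as @ take (k - Suc N) ws)"
    using 1 2 gain loss by simp_all
qed

text \<open>All values \<open>N\<close> up to \<open>T\<close> are coupled through one tuple of
  \<open>T\<close> high and one of \<open>k\<close> low vertices. Outside the bad events the edge
  count increases strictly with \<open>N\<close>, so at most one \<open>N\<close> gives
  \<open>l\<close>. If it is 0, its weight is \<open>(1 - p) ^ k\<close> and the low tuple spans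
  \<open>l\<close> edges; otherwise its weight is at most \<open>exp (p - 1)\<close>, the low tuple
  does not span \<open>l\<close>, and \<open>c < l\<close>. The last three terms bound
  \<open>bad1\<close> by the lower tail, \<open>bad2\<close> by Markov, and \<open>N > T\<close> by
  Markov.\<close>

lemma split_bound:
  fixes c T k l :: nat and p \<sigma> g :: real
  assumes A: "finite A" "A = H \<union> L" "H \<inter> L = {}" "H \<noteq> {}" "L \<noteq> {}" and sym: "symp r"
    and p: "p = card H / card A" and T: "T \<le> k"
    and dens: "\<And>a. a \<in> H \<Longrightarrow> \<sigma> \<le> vertex_density r L a"
    and g: "g = tuple_mean L k (\<lambda>xs. of_bool (edge_count r xs = l))"
  shows "tuple_mean A k (\<lambda>xs. of_bool (edge_count r xs = l))
    \<le> (1 - p) ^ k * g + of_bool (c < l) * (exp (p - 1) * (1 - g))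
      + T * (2 powr (c + T) * exp (- (real (k - T) * \<sigma> / 2))) + T * (k * edge_density r L / (c + 1)) + k * p / (T + 1)"
proof -
  have fin: "finite H" "finite L" and ne: "A \<noteq> {}" using A by auto
  have p01: "0 \<le> p" "p \<le> 1" unfolding p using A(1,2) by (auto simp: divide_le_eq_1 card_mono)
  \<comment> \<open>Edge count of the coupled sample that uses the first \<open>N\<close> high and
    the first \<open>k - N\<close> low vertices.\<close>
  define e where "e N as ws = edge_count r (take N as @ take (k - N) ws)" for N as ws
  define bad1 where "bad1 i as ws = (real (degree_in r (as ! i) (take (k - T) ws)) \<le> real (c + T))" for i as ws
  define bad2 where "bad2 i ws = (real (c + 1) \<le> real (degree_in r (ws ! (k - Suc i)) (take (k - Suc i) ws)))" for i ws
  \<comment> \<open>The number of bad events, used as a union bound for their indicator.\<close>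
  define B :: "'a list \<Rightarrow> 'a list \<Rightarrow> real"
    where "B as ws = (\<Sum>i<T. of_bool (bad1 i as ws)) + (\<Sum>i<T. of_bool (bad2 i ws))" for as ws
  define G where "G N = tuple_mean H N (\<lambda>as. tuple_mean L (k - N) (\<lambda>ws. of_bool (edge_count r (as @ ws) = l)))" for N
  have G1: "G N \<le> 1" for N
    unfolding G_def using fin A by (intro tuple_mean_le_const) auto
  have "tuple_mean A k (\<lambda>xs. of_bool (edge_count r xs = l))
      = tuple_mean A k (\<lambda>xs. of_bool (edge_count r (filter (\<lambda>x. x \<in> H) xs @ filter (\<lambda>x. x \<notin> H) xs) = l))"
    by (rule tuple_mean_cong) (use sym in \<open>auto intro: arg_cong[where f = "\<lambda>x. of_bool (x = l)"] edge_count_mset_cong\<close>)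
  also have "\<dots> = (\<Sum>N\<le>k. Bernstein k N p * G N)"
    unfolding p G_def by (rule tuple_mean_filter_split[OF A(1) ne A(2,3), of k "\<lambda>as ws. of_bool (edge_count r (as @ ws) = l)"])
  also have "\<dots> = (\<Sum>N\<le>T. Bernstein k N p * G N) + (\<Sum>N\<in>{T<..k}. Bernstein k N p * G N)"
    using T by (subst sum.union_disjoint[symmetric]) (auto intro!: sum.cong)
  finally have main: "tuple_mean A k (\<lambda>xs. of_bool (edge_count r xs = l))
     = (\<Sum>N\<le>T. Bernstein k N p * G N) + (\<Sum>N\<in>{T<..k}. Bernstein k N p * G N)" .
  have tail: "(\<Sum>N\<in>{T<..k}. Bernstein k N p * G N) \<le> k * p / (T + 1)"
  proof -
    have "(\<Sum>N\<in>{T<..k}. Bernstein k N p * G N) \<le> (\<Sum>N\<in>{T<..k}. (1 / (T + 1)) * (real N * Bernstein k N p))"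
    proof (rule sum_mono)
      fix N assume "N \<in> {T<..k}"
      then have "1 \<le> (1 / (T + 1)) * real N" by (simp add: field_simps)
      then have "Bernstein k N p * G N \<le> Bernstein k N p * ((1 / (T + 1)) * real N)"
        using G1[of N] p01 by (intro mult_left_mono Bernstein_nonneg) linarith+
      then show "Bernstein k N p * G N \<le> (1 / (T + 1)) * (real N * Bernstein k N p)"
        by (simp add: algebra_simps)
    qed
    also have "\<dots> \<le> (\<Sum>N\<le>k. (1 / (T + 1)) * (real N * Bernstein k N p))"
      using p01 by (intro sum_mono2) (auto intro!: Bernstein_nonneg mult_nonneg_nonneg divide_nonneg_nonneg)
    also have "\<dots> = k * p / (T + 1)"
      unfolding sum_distrib_left[symmetric] by simp
    finally show ?thesis .
  qed
  have pointwise: "(\<Sum>N\<le>T. Bernstein k N p * of_bool (e N as ws = l))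
      \<le> (1 - p) ^ k * of_bool (edge_count r ws = l) + of_bool (c < l) * (exp (p - 1) * (1 - of_bool (edge_count r ws = l))) + B as ws"
    if as: "set as \<subseteq> H" "length as = T" and ws: "set ws \<subseteq> L" "length ws = k" for as ws
  proof (cases "\<exists>i<T. bad1 i as ws \<or> bad2 i ws")
    case True
    then obtain i where i: "i < T" "bad1 i as ws \<or> bad2 i ws" by blast
    have "1 \<le> (of_bool (bad1 i as ws) + of_bool (bad2 i ws) :: real)" using i by auto
    also have "\<dots> \<le> B as ws"
      unfolding B_def using i by (intro add_mono member_le_sum) auto
    finally have "1 \<le> B as ws" .
    moreover have "(\<Sum>N\<le>T. Bernstein k N p * of_bool (e N as ws = l)) \<le> (\<Sum>N\<le>k. Bernstein k N p)"
      using T p01 by (intro order.trans[OF sum_mono sum_mono2]) (auto intro!: Bernstein_nonneg)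
    moreover have "0 \<le> (1 - p) ^ k * of_bool (edge_count r ws = l) + of_bool (c < l) * (exp (p - 1) * (1 - of_bool (edge_count r ws = l)))"
      using p01 by auto
    ultimately show ?thesis by simp
  next
    case False
    have step: "e N as ws < e (Suc N) as ws \<and> c < e (Suc N) as ws" if "N < T" for N
      unfolding e_def using False that
      by (intro conjI edge_count_exchange[OF sym as(2) ws(2) T that]) (auto simp: bad1_def bad2_def not_le simp flip: of_nat_add)
    then have mono: "e N as ws < e M as ws" if "N < M" "M \<le> T" for N M
      using that
    proof (induction M)
      case (Suc M)
      then show ?case by (cases "N = M") (auto dest: Suc_le_lessD intro: less_trans)
    qed simp
    have inj: "N = M" if "e N as ws = l" "e M as ws = l" "N \<le> T" "M \<le> T" for N M
      using mono[of N M] mono[of M N] that by (metis less_irrefl linorder_neqE_nat)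
    have e0: "e 0 as ws = edge_count r ws" using ws by (simp add: e_def)
    have B0: "B as ws = 0" using False by (auto simp: B_def)
    show ?thesis
    proof (cases "\<exists>N\<le>T. e N as ws = l")
      case True
      then obtain N where N: "N \<le> T" "e N as ws = l" by blast
      have "(\<Sum>M\<le>T. Bernstein k M p * of_bool (e M as ws = l)) = (\<Sum>M\<in>{N}. Bernstein k M p * of_bool (e M as ws = l))"
        using N inj by (intro sum.mono_neutral_right) auto
      also have "\<dots> = Bernstein k N p" using N by simp
      finally have s: "(\<Sum>M\<le>T. Bernstein k M p * of_bool (e M as ws = l)) = Bernstein k N p" .
      show ?thesis
      proof (cases "N = 0")
        case True
        then show ?thesis using N e0 s B0 by (simp add: Bernstein_def)
      next
        case False
        then have "edge_count r ws \<noteq> l" using inj[of N 0] N e0 by auto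
        moreover have "Bernstein k N p \<le> exp (p - 1)"
          using False p01 by (intro Bernstein_le) auto
        moreover have "c < l" using step[of "N - 1"] N False by simp
        ultimately show ?thesis using s B0 by simp
      qed
    next
      case False
      then have "(\<Sum>M\<le>T. Bernstein k M p * of_bool (e M as ws = l)) = 0" by (intro sum.neutral) auto
      moreover have "0 \<le> (1 - p) ^ k * of_bool (edge_count r ws = l) + of_bool (c < l) * (exp (p - 1) * (1 - of_bool (edge_count r ws = l)))"
        using p01 by auto
      ultimately show ?thesis using B0 by simp
    qed
  qed
  \<comment> \<open>Each \<open>G N\<close> depends only on prefixes, so it may be computed over the
    common longer tuples; only then can the sum over \<open>N\<close> be bounded pointwise.\<close>
  have "(\<Sum>N\<le>T. Bernstein k N p * G N)
      = (\<Sum>N\<le>T. Bernstein k N p * tuple_mean H T (\<lambda>as. tuple_mean L k (\<lambda>ws. of_bool (e N as ws = l))))"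
  proof (intro sum.cong refl arg_cong2[where f = "(*)"])
    fix N assume "N \<in> {..T}"
    then have N: "N \<le> T" by simp
    show "G N = tuple_mean H T (\<lambda>as. tuple_mean L k (\<lambda>ws. of_bool (e N as ws = l)))"
      unfolding G_def e_def
      using tuple_mean_take[OF fin(1) A(4) N, of "\<lambda>as. tuple_mean L k (\<lambda>ws. of_bool (edge_count r (as @ take (k - N) ws) = l))"]
        tuple_mean_take[OF fin(2) A(5), of "k - N" k "\<lambda>ws. of_bool (edge_count r (as @ ws) = l)" for as]
      by simp
  qed
  also have "\<dots> = tuple_mean H T (\<lambda>as. tuple_mean L k (\<lambda>ws. \<Sum>N\<le>T. Bernstein k N p * of_bool (e N as ws = l)))"
    by (simp only: tuple_mean_sum tuple_mean_cmult)
  also have "\<dots> \<le> tuple_mean H T (\<lambda>as. tuple_mean L k (\<lambda>ws.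
      (1 - p) ^ k * of_bool (edge_count r ws = l) + of_bool (c < l) * (exp (p - 1) * (1 - of_bool (edge_count r ws = l))) + B as ws))"
    by (intro tuple_mean_mono pointwise)
  also have "\<dots> = (1 - p) ^ k * g + of_bool (c < l) * (exp (p - 1) * (1 - g)) + tuple_mean H T (\<lambda>as. tuple_mean L k (B as))"
    using fin A by (simp add: tuple_mean_add tuple_mean_diff tuple_mean_cmult tuple_mean_const g)
  also have "tuple_mean H T (\<lambda>as. tuple_mean L k (B as))
     = (\<Sum>i<T. tuple_mean H T (\<lambda>as. tuple_mean L k (\<lambda>ws. of_bool (bad1 i as ws))))
     + (\<Sum>i<T. tuple_mean L k (\<lambda>ws. of_bool (bad2 i ws)))"
    by (simp only: B_def[abs_def] tuple_mean_add tuple_mean_sum tuple_mean_const[OF fin(1) A(4)])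
  also have "(\<Sum>i<T. tuple_mean H T (\<lambda>as. tuple_mean L k (\<lambda>ws. of_bool (bad1 i as ws))))
     \<le> (\<Sum>i<T. 2 powr (c + T) * exp (- (real (k - T) * \<sigma> / 2)))"
  proof (rule sum_mono)
    fix i assume "i \<in> {..<T}"
    then have i: "i < T" by simp
    have "tuple_mean H T (\<lambda>as. tuple_mean L k (\<lambda>ws. of_bool (bad1 i as ws)))
       = mean H (\<lambda>a. tuple_mean L k (\<lambda>ws. of_bool (real (degree_in r a (take (k - T) ws)) \<le> real (c + T))))"
      unfolding bad1_def
      by (rule tuple_mean_nth[OF fin(1) A(4) i, of "\<lambda>a. tuple_mean L k (\<lambda>ws. of_bool (real (degree_in r a (take (k - T) ws)) \<le> real (c + T)))"])
    also have "\<dots> = mean H (\<lambda>a. tuple_mean L (k - T) (\<lambda>ws. of_bool (real (degree_in r a ws) \<le> real (c + T))))"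
      using tuple_mean_take[OF fin(2) A(5), of "k - T" k "\<lambda>ws. of_bool (real (degree_in r a ws) \<le> real (c + T))" for a]
      by simp
    also have "\<dots> \<le> 2 powr (c + T) * exp (- (real (k - T) * \<sigma> / 2))"
    proof (rule mean_le_const[OF fin(1) A(4)])
      fix a assume "a \<in> H"
      have "tuple_mean L (k - T) (\<lambda>ws. of_bool (real (degree_in r a ws) \<le> real (c + T)))
         \<le> 2 powr real (c + T) * exp (- (real (k - T) * mean L (\<lambda>y. of_bool (r a y)) / 2))"
        unfolding real_degree_in using fin A by (intro tuple_mean_lower_tail) auto
      also have "\<dots> \<le> 2 powr real (c + T) * exp (- (real (k - T) * \<sigma> / 2))"
        using dens[OF \<open>a \<in> H\<close>] unfolding vertex_density_def by (intro mult_left_mono) (auto intro!: mult_left_mono)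
      finally show "tuple_mean L (k - T) (\<lambda>ws. of_bool (real (degree_in r a ws) \<le> real (c + T)))
         \<le> 2 powr (c + T) * exp (- (real (k - T) * \<sigma> / 2))" by simp
    qed
    finally show "tuple_mean H T (\<lambda>as. tuple_mean L k (\<lambda>ws. of_bool (bad1 i as ws)))
        \<le> 2 powr (c + T) * exp (- (real (k - T) * \<sigma> / 2))" .
  qed
  also have "(\<Sum>i<T. tuple_mean L k (\<lambda>ws. of_bool (bad2 i ws))) \<le> (\<Sum>i<T. k * edge_density r L / (c + 1))"
  proof (rule sum_mono)
    fix i assume "i \<in> {..<T}"
    then have i: "k - Suc i < k" using T by auto
    have "tuple_mean L k (\<lambda>ws. of_bool (bad2 i ws))
        \<le> tuple_mean L k (\<lambda>ws. real (degree_in r (ws ! (k - Suc i)) (take (k - Suc i) ws))) / real (c + 1)"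
      unfolding bad2_def by (rule tuple_mean_markov) auto
    also have "tuple_mean L k (\<lambda>ws. real (degree_in r (ws ! (k - Suc i)) (take (k - Suc i) ws)))
        = tuple_mean L (k - Suc i) (\<lambda>ws. mean L (\<lambda>x. real (degree_in r x ws)))"
      by (rule tuple_mean_nth_take[OF fin(2) A(5) i, of "\<lambda>x ws. real (degree_in r x ws)"])
    also have "\<dots> = real (k - Suc i) * edge_density r L"
      using fin A by (simp add: mean_degree_in[OF sym] tuple_mean_sum_list edge_density_def)
    also have "\<dots> / real (c + 1) \<le> k * edge_density r L / (c + 1)"
      by (intro divide_right_mono mult_right_mono edge_density_nonneg) auto
    finally show "tuple_mean L k (\<lambda>ws. of_bool (bad2 i ws)) \<le> k * edge_density r L / (c + 1)" by simp
  qed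
  finally have "(\<Sum>N\<le>T. Bernstein k N p * G N) \<le> (1 - p) ^ k * g + of_bool (c < l) * (exp (p - 1) * (1 - g))
      + (T * (2 powr (c + T) * exp (- (real (k - T) * \<sigma> / 2))) + T * (k * edge_density r L / (c + 1)))"
    by simp
  with main tail show ?thesis by linarith
qed

subsection \<open>Variance and anti-concentration\<close>

lemma tuple_mean_deviation:
  assumes "finite A" "A \<noteq> {}"
  shows "tuple_mean A m (\<lambda>xs. (f xs - a)\<^sup>2)
    = tuple_mean A m (\<lambda>xs. (f xs - tuple_mean A m f)\<^sup>2) + (tuple_mean A m f - a)\<^sup>2"
proof -
  let ?M = "tuple_mean A m f"
  have "tuple_mean A m (\<lambda>xs. (f xs - a)\<^sup>2)
      = tuple_mean A m (\<lambda>xs. ((f xs - ?M)\<^sup>2 + (2 * (?M - a)) * f xs) + ((?M - a)\<^sup>2 - 2 * (?M - a) * ?M))"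
    by (rule tuple_mean_cong) (simp add: power2_eq_square algebra_simps)
  also have "\<dots> = (tuple_mean A m (\<lambda>xs. (f xs - ?M)\<^sup>2) + 2 * (?M - a) * ?M) + ((?M - a)\<^sup>2 - 2 * (?M - a) * ?M)"
    unfolding tuple_mean_add tuple_mean_cmult tuple_mean_const[OF assms] ..
  finally show ?thesis by simp
qed

text \<open>For two independent copies the mean of the squared difference is twice the variance, and
  the square of a sum is at most twice the sum of the squares.\<close>

lemma mean_variance_le:
  assumes A: "finite A" "A \<noteq> {}" and F: "\<And>x y. x \<in> A \<Longrightarrow> y \<in> A \<Longrightarrow> \<bar>F x - F y\<bar> \<le> c x + c y"
  shows "mean A (\<lambda>x. (F x - mean A F)\<^sup>2) \<le> 2 * mean A (\<lambda>x. (c x)\<^sup>2)"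
proof -
  have *: "mean A (\<lambda>x. mean A (\<lambda>y. (F x - F y)\<^sup>2)) = 2 * mean A (\<lambda>x. (F x - mean A F)\<^sup>2)"
  proof -
    have "mean A (\<lambda>y. (F x - F y)\<^sup>2) = ((F x)\<^sup>2 - 2 * F x * mean A F) + mean A (\<lambda>y. (F y)\<^sup>2)" for x
    proof -
      have "mean A (\<lambda>y. (F x - F y)\<^sup>2) = mean A (\<lambda>y. ((F x)\<^sup>2 - (2 * F x) * F y) + (F y)\<^sup>2)"
        by (rule mean_cong) (simp add: power2_diff)
      then show ?thesis using A by (simp add: mean_add mean_diff mean_cmult mean_const)
    qed
    then have "mean A (\<lambda>x. mean A (\<lambda>y. (F x - F y)\<^sup>2))
        = mean A (\<lambda>x. ((F x)\<^sup>2 - (2 * mean A F) * F x) + mean A (\<lambda>y. (F y)\<^sup>2))"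
      by (simp add: mult.commute mult.left_commute)
    also have "\<dots> = 2 * (mean A (\<lambda>x. (F x)\<^sup>2) - (mean A F)\<^sup>2)"
      unfolding mean_add mean_diff mean_cmult using A by (simp add: mean_const power2_eq_square)
    finally show ?thesis by (simp add: mean_power2_deviation[OF A])
  qed
  have "mean A (\<lambda>x. mean A (\<lambda>y. (F x - F y)\<^sup>2)) \<le> mean A (\<lambda>x. mean A (\<lambda>y. 2 * (c x)\<^sup>2 + 2 * (c y)\<^sup>2))"
  proof (intro mean_mono)
    fix x y assume "x \<in> A" "y \<in> A"
    then have "(F x - F y)\<^sup>2 \<le> (c x + c y)\<^sup>2"
      using F[of x y] by (metis abs_ge_zero power2_abs power_mono)
    also have "\<dots> \<le> 2 * (c x)\<^sup>2 + 2 * (c y)\<^sup>2"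
      using zero_le_power2[of "c x - c y"] unfolding power2_sum power2_diff by linarith
    finally show "(F x - F y)\<^sup>2 \<le> 2 * (c x)\<^sup>2 + 2 * (c y)\<^sup>2" .
  qed
  also have "\<dots> = 4 * mean A (\<lambda>x. (c x)\<^sup>2)"
    using A by (simp add: mean_add mean_cmult mean_const)
  finally show ?thesis using * by simp
qed

text \<open>Law of total variance, exposing the first entry: the conditional variances are bounded
  by induction, and the conditional mean \<open>F\<close> inherits the difference bound. The bound
  has the form \<open>c x + c y\<close> because a replacement will only affect neighbours of the old
  and the new vertex.\<close>

lemma efron_stein_inequality:
  assumes A: "finite A" "A \<noteq> {}"
    and "\<And>xs ys x y. x \<in> A \<Longrightarrow> y \<in> A \<Longrightarrow> \<bar>f (xs @ x # ys) - f (xs @ y # ys)\<bar> \<le> c x + c y"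
  shows "tuple_mean A m (\<lambda>xs. (f xs - tuple_mean A m f)\<^sup>2) \<le> real m * (2 * mean A (\<lambda>x. (c x)\<^sup>2))"
  using assms(3)
proof (induction m arbitrary: f)
  case 0
  then show ?case by simp
next
  case (Suc m)
  define F where "F x = tuple_mean A m (\<lambda>xs. f (x # xs))" for x
  have "tuple_mean A (Suc m) (\<lambda>xs. (f xs - tuple_mean A (Suc m) f)\<^sup>2)
      = mean A (\<lambda>x. tuple_mean A m (\<lambda>xs. (f (x # xs) - mean A F)\<^sup>2))"
    by (simp add: F_def[abs_def])
  also have "\<dots> = mean A (\<lambda>x. tuple_mean A m (\<lambda>xs. (f (x # xs) - F x)\<^sup>2) + (F x - mean A F)\<^sup>2)"
    unfolding F_def by (subst tuple_mean_deviation[OF A]) simp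
  also have "\<dots> \<le> mean A (\<lambda>x. real m * (2 * mean A (\<lambda>x. (c x)\<^sup>2)) + (F x - mean A F)\<^sup>2)"
    unfolding F_def
  proof (intro mean_mono add_mono order_refl Suc.IH)
    fix x y z xs ys assume "y \<in> A" "z \<in> A"
    then show "\<bar>f (x # xs @ y # ys) - f (x # xs @ z # ys)\<bar> \<le> c y + c z"
      using Suc.prems[of y z "x # xs" ys] by simp
  qed
  also have "\<dots> \<le> real m * (2 * mean A (\<lambda>x. (c x)\<^sup>2)) + 2 * mean A (\<lambda>x. (c x)\<^sup>2)"
    unfolding mean_add mean_const[OF A]
  proof (intro add_mono order_refl mean_variance_le[OF A])
    fix x y assume xy: "x \<in> A" "y \<in> A"
    have "\<bar>f (x # xs) - f (y # xs)\<bar> \<le> c x + c y" for xs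
      using Suc.prems[of x y "[]" xs] xy by simp
    then have "f (x # xs) \<le> f (y # xs) + (c x + c y)" "f (y # xs) \<le> f (x # xs) + (c x + c y)" for xs
      by (simp_all add: abs_le_iff algebra_simps)
    then have "F x \<le> tuple_mean A m (\<lambda>xs. f (y # xs) + (c x + c y))" "F y \<le> tuple_mean A m (\<lambda>xs. f (x # xs) + (c x + c y))"
      unfolding F_def by (intro tuple_mean_mono; simp)+
    then show "\<bar>F x - F y\<bar> \<le> c x + c y"
      unfolding tuple_mean_add tuple_mean_const[OF A] F_def[symmetric] by linarith
  qed
  finally show ?case by (simp add: algebra_simps)
qed

lemma tuple_mean_chebyshev:
  assumes "d > 0"
  shows "tuple_mean A m (\<lambda>xs. of_bool (d \<le> \<bar>f xs - a\<bar>)) \<le> tuple_mean A m (\<lambda>xs. (f xs - a)\<^sup>2) / d\<^sup>2"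
proof -
  have "(d \<le> \<bar>f xs - a\<bar>) = (d\<^sup>2 \<le> (f xs - a)\<^sup>2)" for xs
    using assms abs_le_square_iff[of d "f xs - a"] by simp
  then show ?thesis
    using tuple_mean_markov[of A m "\<lambda>xs. (f xs - a)\<^sup>2" "d\<^sup>2"] assms by simp
qed

section \<open>Littlewood--Offord bound for i.i.d. integers\<close>

text \<open>Probability that independent fair coins, each selecting one component of its pair,
  produce the total \<open>s\<close>.\<close>

primrec coin_prob :: "(int \<times> int) list \<Rightarrow> int \<Rightarrow> real" where
  "coin_prob [] s = of_bool (s = 0)"
| "coin_prob (ab # ps) s = (coin_prob ps (s - fst ab) + coin_prob ps (s - snd ab)) / 2"

text \<open>Consecutive central binomial coefficients have ratio
  \<open>2 * (2 * n + 1) / (n + 1)\<close>, and the induction step reduces to comparing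
  \<open>(2 * n + 1) * (2 * n + 3)\<close> with \<open>4 * (n + 1)\<close> squared over 4 factors,
  that is, with the square of \<open>2 * n + 2\<close>.\<close>

lemma central_binomial_upper_bound: "real ((2 * n) choose n) ^ 2 * (2 * real n + 1) \<le> 16 ^ n"
proof (induction n)
  case (Suc n)
  have "Suc n * (Suc n * (2 * Suc n choose Suc n)) = Suc n * (Suc (2 * n + 1) * (2 * n + 1 choose n))"
    using Suc_times_binomial_eq[of "2 * n + 1" n] by (simp add: mult.commute)
  also have "\<dots> = Suc (2 * n + 1) * (Suc n * (Suc (2 * n) choose Suc n))"
    using binomial_symmetric[of n "Suc (2 * n)"] by (simp add: Suc_diff_le del: binomial_Suc_Suc)
  also have "Suc n * (Suc (2 * n) choose Suc n) = Suc (2 * n) * (2 * n choose n)"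
    using Suc_times_binomial_eq[of "2 * n" n] by (simp add: mult.commute del: binomial_Suc_Suc)
  finally have "Suc n * (Suc n * (2 * Suc n choose Suc n)) = 2 * Suc n * (Suc (2 * n) * (2 * n choose n))"
    by (simp del: binomial_Suc_Suc)
  then have "Suc n * (2 * Suc n choose Suc n) = 2 * (Suc (2 * n) * (2 * n choose n))"
    by (metis (no_types, lifting) mult.assoc mult.left_commute mult_cancel1 nat.distinct(1))
  then have "real (Suc n) * real (2 * Suc n choose Suc n) = 2 * ((2 * real n + 1) * real (2 * n choose n))"
    by (metis (no_types, lifting) Suc_eq_plus1 of_nat_1 of_nat_add of_nat_mult of_nat_numeral)
  then have "(real n + 1)\<^sup>2 * (real (2 * Suc n choose Suc n) ^ 2 * (2 * real (Suc n) + 1))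
      = 4 * (2 * real n + 1) * (2 * real n + 3) * (real (2 * n choose n) ^ 2 * (2 * real n + 1))"
    unfolding power_mult_distrib[symmetric] mult.assoc[symmetric]
    by (simp add: power2_eq_square algebra_simps del: binomial_Suc_Suc)
  also have "\<dots> \<le> 4 * (2 * real n + 1) * (2 * real n + 3) * 16 ^ n"
    by (intro mult_left_mono Suc.IH) auto
  also have "\<dots> \<le> (16 * (real n + 1)\<^sup>2) * 16 ^ n"
    by (intro mult_right_mono) (auto simp: power2_eq_square algebra_simps)
  finally have "(real n + 1)\<^sup>2 * (real (2 * Suc n choose Suc n) ^ 2 * (2 * real (Suc n) + 1))
      \<le> (real n + 1)\<^sup>2 * 16 ^ Suc n" by (simp add: algebra_simps)
  then show ?case by (rule mult_left_le_imp_le) simp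
qed simp

text \<open>At one large even level this is the central coefficient bound; Pascal's rule carries the
  bound to all higher levels.\<close>

lemma binomial_small:
  assumes "0 < (\<epsilon>::real)"
  obtains w where "\<And>m j. w \<le> m \<Longrightarrow> real (m choose j) \<le> \<epsilon> * 2 ^ m"
proof -
  obtain n :: nat where n: "1 / \<epsilon>\<^sup>2 < real n" using reals_Archimedean2 by blast
  have "real (m choose j) \<le> \<epsilon> * 2 ^ m" if "2 * n \<le> m" for m j
    using that
  proof (induction m arbitrary: j rule: nat_induct_at_least)
    case base
    have "real (2 * n choose j) \<le> real (2 * n choose n)"
      using binomial_maximum[of "2 * n" j] by simp
    also have "\<dots> \<le> \<epsilon> * 2 ^ (2 * n)"
    proof (rule power2_le_imp_le)
      have "1 < real n * \<epsilon>\<^sup>2" using n assms by (simp add: field_simps)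
      then have "1 < (2 * real n + 1) * \<epsilon>\<^sup>2"
        using zero_le_power2[of \<epsilon>] unfolding distrib_right mult.assoc by linarith
      then have "real (2 * n choose n) ^ 2 * 1 \<le> real (2 * n choose n) ^ 2 * ((2 * real n + 1) * \<epsilon>\<^sup>2)"
        by (intro mult_left_mono) auto
      also have "\<dots> \<le> \<epsilon>\<^sup>2 * 16 ^ n"
        using mult_left_mono[OF central_binomial_upper_bound[of n], of "\<epsilon>\<^sup>2"] by (simp add: algebra_simps)
      also have "\<dots> = (\<epsilon> * 2 ^ (2 * n))\<^sup>2"
      proof -
        have "(16::real) ^ n = (2 ^ 4) ^ n" by simp
        then show ?thesis by (simp only: power_mult_distrib flip: power_mult) (simp add: mult.commute)
      qed
      finally show "real (2 * n choose n) ^ 2 \<le> (\<epsilon> * 2 ^ (2 * n))\<^sup>2" by simp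
    qed (use assms in auto)
    finally show ?case .
  next
    case (Suc m)
    show ?case
    proof (cases j)
      case 0
      then show ?thesis using Suc.IH[of 0] by simp
    next
      case (Suc i)
      then show ?thesis
        using \<open>\<And>j. real (m choose j) \<le> \<epsilon> * 2 ^ m\<close>[of i] \<open>\<And>j. real (m choose j) \<le> \<epsilon> * 2 ^ m\<close>[of j] by simp
    qed
  qed
  then show ?thesis using that by blast
qed

text \<open>Sperner's theorem in probabilistic form: for fair coins all subsets have weight
  \<open>1 / 2 ^ card D\<close>, which is at most \<open>\<epsilon>\<close> times the LYM
  weight.\<close>

lemma bernoulli_half_antichain_le:
  assumes w: "\<And>m j. w \<le> m \<Longrightarrow> real (m choose j) \<le> \<epsilon> * 2 ^ m" and D: "finite D" "w \<le> card D"
    and anti: "\<And>A B. P A \<Longrightarrow> P B \<Longrightarrow> A \<subset> B \<Longrightarrow> B \<subseteq> D \<Longrightarrow> False"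
  shows "bernoulli_mean (1/2) D (\<lambda>B. of_bool (P B)) \<le> \<epsilon>"
proof -
  define F where "F = {B \<in> Pow D. P B}"
  have "bernoulli_mean (1/2) D (\<lambda>B. of_bool (P B)) = (\<Sum>B\<in>F. (1/2) ^ card B * (1/2) ^ (card D - card B))"
    unfolding bernoulli_mean_def F_def using D by (intro sum.mono_neutral_cong_right) auto
  also have "\<dots> \<le> (\<Sum>B\<in>F. \<epsilon> * (1 / real (card D choose card B)))"
  proof (rule sum_mono)
    fix B assume "B \<in> F"
    then have le: "card B \<le> card D"
      using D by (auto simp: F_def card_mono)
    then have "(1/2 :: real) ^ card B * (1/2) ^ (card D - card B) = 1 / 2 ^ card D"
      by (simp add: power_one_over flip: power_add)
    moreover have "real (card D choose card B) \<le> \<epsilon> * 2 ^ card D" "real (card D choose card B) > 0"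
      using le w[OF D(2)] by auto
    ultimately show "(1/2 :: real) ^ card B * (1/2) ^ (card D - card B) \<le> \<epsilon> * (1 / real (card D choose card B))"
      by (simp add: field_simps)
  qed
  also have "\<dots> = \<epsilon> * (\<Sum>B\<in>F. 1 / real (card D choose card B))"
    by (simp add: sum_distrib_left)
  also have "\<dots> \<le> \<epsilon> * 1"
  proof (intro mult_left_mono lym_inequality)
    show "F \<subseteq> Pow D" by (auto simp: F_def)
    show "A = B" if "A \<in> F" "B \<in> F" "A \<subseteq> B" for A B
      using anti[of A B] that by (auto simp: F_def)
    have "1 \<le> \<epsilon> * 2 ^ card D" using w[OF D(2), of 0] by simp
    then show "0 \<le> \<epsilon>" by (smt (verit) mult_nonpos_nonneg zero_le_power)
  qed (use D in auto)
  finally show ?thesis by simp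
qed

text \<open>Each pair with distinct components is turned into a new index in \<open>D\<close> with a
  positive increment; pairs with equal components only shift \<open>s\<close>. When no pair is left,
  the subsets of \<open>D\<close> with the required sum form an antichain, since all increments are
  positive.\<close>

lemma bernoulli_mean_coin_prob_le:
  assumes w: "\<And>m j. w \<le> m \<Longrightarrow> real (m choose j) \<le> \<epsilon> * 2 ^ m"
    and "finite D" "\<And>i. i \<in> D \<Longrightarrow> 0 < \<delta> i" "w \<le> card D + length (filter (\<lambda>(a, b). a \<noteq> b) ps)"
  shows "bernoulli_mean (1/2) (D::nat set) (\<lambda>B. coin_prob ps (s - (\<Sum>i\<in>B. \<delta> i))) \<le> \<epsilon>"
  using assms(2-)
proof (induction ps arbitrary: D \<delta> s)
  case Nil
  have "bernoulli_mean (1/2) D (\<lambda>B. of_bool (s - (\<Sum>i\<in>B. \<delta> i) = 0)) \<le> \<epsilon>"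
  proof (rule bernoulli_half_antichain_le[OF w])
    fix A B assume AB: "s - (\<Sum>i\<in>A. \<delta> i) = 0" "s - (\<Sum>i\<in>B. \<delta> i) = 0" "A \<subset> B" "B \<subseteq> D"
    then have fB: "finite B" using Nil.prems finite_subset by blast
    obtain i where i: "i \<in> B" "i \<notin> A" using AB by blast
    have "(\<Sum>i\<in>A. \<delta> i) < (\<Sum>i\<in>B. \<delta> i)"
      using fB AB i Nil.prems(2) by (intro sum_strict_mono2[where b = i]) (auto intro: less_imp_le)
    then show False using AB by simp
  qed (use Nil in auto)
  then show ?case by simp
next
  case (Cons ab ps)
  obtain a b where ab: "ab = (a, b)" by fastforce
  show ?case
  proof (cases "a = b")
    case True
    have "bernoulli_mean (1/2) D (\<lambda>B. coin_prob ps ((s - a) - (\<Sum>i\<in>B. \<delta> i))) \<le> \<epsilon>"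
      using Cons.prems ab True by (intro Cons.IH) auto
    moreover have "s - a - (\<Sum>i\<in>B. \<delta> i) = s - (\<Sum>i\<in>B. \<delta> i) - a" for B by simp
    ultimately show ?thesis using ab True by (simp only: coin_prob.simps fst_conv snd_conv) simp
  next
    case False
    obtain i where i: "i \<notin> D" using Cons.prems(1) ex_new_if_finite infinite_UNIV_nat by blast
    \<comment> \<open>A coin yields the smaller component plus, with probability one half, the
      positive gap; the smaller component is absorbed into \<open>s\<close>.\<close>
    define \<delta>' where "\<delta>' = \<delta>(i := max a b - min a b)"
    have sumD: "(\<Sum>j\<in>B. \<delta>' j) = (\<Sum>j\<in>B. \<delta> j)" if "B \<subseteq> D" for B
      using that i by (intro sum.cong) (auto simp: \<delta>'_def)
    have sumI: "(\<Sum>j\<in>insert i B. \<delta>' j) = (max a b - min a b) + (\<Sum>j\<in>B. \<delta> j)" if "B \<subseteq> D" for B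
    proof -
      have "finite B" "i \<notin> B" using that i Cons.prems(1) finite_subset by auto
      then show ?thesis using sumD[OF that] by (simp add: \<delta>'_def)
    qed
    let ?f = "\<lambda>B. coin_prob ps ((s - min a b) - (\<Sum>j\<in>B. \<delta>' j))"
    have "bernoulli_mean (1/2) (insert i D) ?f \<le> \<epsilon>"
      using Cons.prems ab False i by (intro Cons.IH) (auto simp: \<delta>'_def)
    also have "bernoulli_mean (1/2) (insert i D) ?f
        = 1/2 * bernoulli_mean (1/2) D (\<lambda>B. ?f (insert i B)) + (1 - 1/2) * bernoulli_mean (1/2) D ?f"
      by (rule bernoulli_mean_insert) (use i Cons.prems in auto)
    also have "\<dots> = bernoulli_mean (1/2) D (\<lambda>B. coin_prob (ab # ps) (s - (\<Sum>i\<in>B. \<delta> i)))"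
      unfolding bernoulli_mean_def sum_distrib_left sum.distrib[symmetric]
    proof (rule sum.cong[OF refl])
      fix B assume "B \<in> Pow D"
      then have B: "B \<subseteq> D" by simp
      have 1: "?f (insert i B) = coin_prob ps (s - (\<Sum>i\<in>B. \<delta> i) - max a b)"
        unfolding sumI[OF B] by (rule arg_cong[where f = "coin_prob ps"]) simp
      have 2: "?f B = coin_prob ps (s - (\<Sum>i\<in>B. \<delta> i) - min a b)"
        unfolding sumD[OF B] by (rule arg_cong[where f = "coin_prob ps"]) simp
      have 3: "coin_prob (ab # ps) (s - (\<Sum>i\<in>B. \<delta> i)) = (?f (insert i B) + ?f B) / 2"
        unfolding 1 2 ab by (cases "a \<le> b") (simp_all add: max_def min_def)
      show "1/2 * ((1/2) ^ card B * (1 - 1/2) ^ (card D - card B) * ?f (insert i B))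
          + (1 - 1/2) * ((1/2) ^ card B * (1 - 1/2) ^ (card D - card B) * ?f B)
          = (1/2) ^ card B * (1 - 1/2) ^ (card D - card B) * coin_prob (ab # ps) (s - (\<Sum>i\<in>B. \<delta> i))"
        unfolding 3 by (simp add: algebra_simps add_divide_distrib)
    qed
    finally show ?thesis .
  qed
qed

lemma coin_prob_le:
  assumes w: "\<And>m j. w \<le> m \<Longrightarrow> real (m choose j) \<le> \<epsilon> * 2 ^ m"
    and "w \<le> length (filter (\<lambda>(a, b). a \<noteq> b) ps)"
  shows "coin_prob ps s \<le> \<epsilon>"
  using bernoulli_mean_coin_prob_le[where D = "{}" and \<delta> = "\<lambda>_. 1" and ps = ps and s = s, OF w] assms(2) by (simp add: bernoulli_mean_def)

lemma coin_prob_le_1: "coin_prob ps s \<le> 1"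
proof (induction ps arbitrary: s)
  case (Cons ab ps)
  then show ?case using add_mono[OF Cons.IH Cons.IH] by simp
qed simp

lemma mean_Times:
  "mean (A \<times> B) (\<lambda>(x, y). f x y) = mean A (\<lambda>x. mean B (\<lambda>y. f x y))"
  unfolding mean_def
  by (simp add: card_cartesian_product mult.commute flip: sum.cartesian_product sum_divide_distrib)

text \<open>Symmetrization: a uniform draw has the same distribution as a fair choice between two
  independent uniform draws.\<close>

lemma tuple_mean_coin_prob:
  fixes g :: "'a \<Rightarrow> int"
  assumes A: "finite A" "A \<noteq> {}"
  shows "tuple_mean A m (\<lambda>xs. of_bool (sum_list (map g xs) = s))
    = tuple_mean (A \<times> A) m (\<lambda>ps. coin_prob (map (\<lambda>(x, y). (g x, g y)) ps) s)"
proof (induction m arbitrary: s)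
  case (Suc m)
  define Q where "Q s = tuple_mean A m (\<lambda>xs. of_bool (sum_list (map g xs) = s))" for s
  have "tuple_mean A (Suc m) (\<lambda>xs. of_bool (sum_list (map g xs) = s)) = mean A (\<lambda>x. Q (s - g x))"
    by (simp add: Q_def algebra_simps eq_diff_eq)
  also have "\<dots> = mean A (\<lambda>x. mean A (\<lambda>y. (1/2) * Q (s - g x) + (1/2) * Q (s - g y)))"
    unfolding mean_add mean_cmult mean_const[OF A] by simp
  also have "\<dots> = mean (A \<times> A) (\<lambda>(x, y). (1/2) * Q (s - g x) + (1/2) * Q (s - g y))"
    by (rule mean_Times[symmetric])
  also have "\<dots> = tuple_mean (A \<times> A) (Suc m) (\<lambda>ps. coin_prob (map (\<lambda>(x, y). (g x, g y)) ps) s)"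
  proof -
    have c: "coin_prob (map (\<lambda>(x, y). (g x, g y)) ((x, y) # ps)) s
        = (1/2) * coin_prob (map (\<lambda>(x, y). (g x, g y)) ps) (s - g x)
        + (1/2) * coin_prob (map (\<lambda>(x, y). (g x, g y)) ps) (s - g y)" for x y ps
      by simp
    have "tuple_mean (A \<times> A) m (\<lambda>ps. coin_prob (map (\<lambda>(x, y). (g x, g y)) ((x, y) # ps)) s)
        = (1/2) * Q (s - g x) + (1/2) * Q (s - g y)" for x y
      unfolding c tuple_mean_add tuple_mean_cmult Q_def Suc.IH ..
    then show ?thesis
      unfolding tuple_mean.simps by (intro mean_cong) (auto simp del: list.map coin_prob.simps)
  qed
  finally show ?case .
qed simp

text \<open>After conditioning on the symmetrized pairs, at least \<open>w\<close> pairs with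
  different values suffice for the bound \<open>\<epsilon>\<close>; having only few such pairs is
  unlikely by the lower tail bound.\<close>

lemma littlewood_offord_iid:
  fixes g :: "'a \<Rightarrow> int"
  assumes w: "\<And>m j. w \<le> m \<Longrightarrow> real (m choose j) \<le> \<epsilon> * 2 ^ m" and A: "finite A" "A \<noteq> {}"
  shows "tuple_mean A m (\<lambda>xs. of_bool (sum_list (map g xs) = s))
    \<le> \<epsilon> + 2 ^ w * exp (- (real m * mean A (\<lambda>x. mean A (\<lambda>y. of_bool (g x \<noteq> g y))) / 2))"
proof -
  let ?d = "\<lambda>(x, y). of_bool (g x \<noteq> g y) :: real"
  have AA: "finite (A \<times> A)" "A \<times> A \<noteq> {}" using A by auto
  have "tuple_mean A m (\<lambda>xs. of_bool (sum_list (map g xs) = s))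
      \<le> tuple_mean (A \<times> A) m (\<lambda>ps. \<epsilon> + of_bool (sum_list (map ?d ps) \<le> real w))"
    unfolding tuple_mean_coin_prob[OF A]
  proof (rule tuple_mean_mono)
    fix ps :: "('a \<times> 'a) list"
    let ?q = "map (\<lambda>(x, y). (g x, g y)) ps"
    have *: "sum_list (map ?d ps) = real (length (filter (\<lambda>(a, b). a \<noteq> b) ?q))"
      by (induction ps) auto
    show "coin_prob ?q s \<le> \<epsilon> + of_bool (sum_list (map ?d ps) \<le> real w)"
    proof (cases "w \<le> length (filter (\<lambda>(a, b). a \<noteq> b) ?q)")
      case True
      then show ?thesis using coin_prob_le[OF w True, of s] by simp
    next
      case False
      then have "sum_list (map ?d ps) \<le> real w" unfolding * by linarith
      moreover have "0 \<le> \<epsilon>"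
        using w[of w 0] by (smt (verit) binomial_n_0 mult_nonpos_nonneg of_nat_1 order_refl zero_le_power)
      ultimately show ?thesis using coin_prob_le_1[of ?q s] by simp
    qed
  qed
  also have "\<dots> \<le> \<epsilon> + 2 powr real w * exp (- (real m * mean (A \<times> A) ?d / 2))"
    unfolding tuple_mean_add tuple_mean_const[OF AA]
    by (intro add_mono order_refl tuple_mean_lower_tail[OF AA]) auto
  finally show ?thesis by (simp add: mean_Times powr_realpow)
qed

subsection \<open>Bounded vertex_density and many edges\<close>

text \<open>The bias of the parity of a random vertex's degree into \<open>xs\<close>. It detects
  unequal degrees while its expectation is an explicit power mean.\<close>

definition parity_mean :: "('a \<Rightarrow> 'a \<Rightarrow> bool) \<Rightarrow> 'a set \<Rightarrow> 'a list \<Rightarrow> real"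
  where "parity_mean r A xs = mean A (\<lambda>v. (- 1) ^ degree_in r v xs)"

text \<open>The sign is a product of independent factors \<open>1 - 2 * of_bool (r v y)\<close>, so
  its expectation for fixed \<open>v\<close> is a power.\<close>

lemma tuple_mean_parity_mean:
  assumes A: "finite A" "A \<noteq> {}"
  shows "tuple_mean A m (parity_mean r A) = mean A (\<lambda>v. (1 - 2 * vertex_density r A v) ^ m)"
proof -
  have p: "(- 1) ^ degree_in r v xs = prod_list (map (\<lambda>y. 1 - 2 * of_bool (r v y) :: real) xs)" for v xs
    by (induction xs) auto
  have "tuple_mean A m (parity_mean r A) = mean A (\<lambda>v. tuple_mean A m (\<lambda>xs. (- 1) ^ degree_in r v xs))"
    unfolding parity_mean_def[abs_def] by (rule mean_tuple_mean_swap[symmetric])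
  also have "\<dots> = mean A (\<lambda>v. (1 - 2 * vertex_density r A v) ^ m)"
    unfolding p tuple_mean_prod_list mean_diff mean_cmult mean_const[OF A] vertex_density_def ..
  finally show ?thesis .
qed

text \<open>Replacing \<open>x\<close> by \<open>y\<close> changes signs, by at most 2, only at
  neighbours of \<open>x\<close> or \<open>y\<close>; hence Efron--Stein applies with
  \<open>c\<close> equal to twice the vertex density.\<close>

lemma parity_mean_variance_le:
  assumes A: "finite A" "A \<noteq> {}" and sym: "symp r"
  shows "tuple_mean A m (\<lambda>xs. (parity_mean r A xs - tuple_mean A m (parity_mean r A))\<^sup>2)
    \<le> real m * (8 * mean A (\<lambda>x. (vertex_density r A x)\<^sup>2))"
proof -
  have "tuple_mean A m (\<lambda>xs. (parity_mean r A xs - tuple_mean A m (parity_mean r A))\<^sup>2)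
    \<le> real m * (2 * mean A (\<lambda>x. (2 * vertex_density r A x)\<^sup>2))"
  proof (rule efron_stein_inequality[OF A])
    fix xs ys x y
    have "\<bar>parity_mean r A (xs @ x # ys) - parity_mean r A (xs @ y # ys)\<bar>
        \<le> mean A (\<lambda>v. \<bar>(- 1) ^ degree_in r v (xs @ x # ys) - (- 1) ^ degree_in r v (xs @ y # ys)\<bar>)"
      unfolding parity_mean_def mean_diff[symmetric] by (rule abs_mean_le)
    also have "\<dots> \<le> mean A (\<lambda>v. 2 * of_bool (r x v) + 2 * of_bool (r y v))"
    proof (rule mean_mono)
      fix v
      have "(- 1) ^ degree_in r v (xs @ x # ys) - (- 1 :: real) ^ degree_in r v (xs @ y # ys)
          = (- 1) ^ degree_in r v (xs @ ys) * ((- 1) ^ of_bool (r v x) - (- 1) ^ of_bool (r v y))"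
        by (simp add: power_add algebra_simps)
      then have "\<bar>(- 1) ^ degree_in r v (xs @ x # ys) - (- 1 :: real) ^ degree_in r v (xs @ y # ys)\<bar>
          = \<bar>(- 1) ^ of_bool (r v x) - (- 1 :: real) ^ of_bool (r v y)\<bar>"
        by (simp only: abs_mult power_abs) simp
      also have "\<dots> \<le> 2 * of_bool (r x v) + 2 * of_bool (r y v)"
        using sym by (auto dest: sympD)
      finally show "\<bar>(- 1) ^ degree_in r v (xs @ x # ys) - (- 1 :: real) ^ degree_in r v (xs @ y # ys)\<bar>
          \<le> 2 * of_bool (r x v) + 2 * of_bool (r y v)" .
    qed
    also have "\<dots> = 2 * vertex_density r A x + 2 * vertex_density r A y"
      by (simp only: mean_add mean_cmult vertex_density_def)
    finally show "\<bar>parity_mean r A (xs @ x # ys) - parity_mean r A (xs @ y # ys)\<bar>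
        \<le> 2 * vertex_density r A x + 2 * vertex_density r A y" .
  qed
  then show ?thesis by (simp add: power_mult_distrib mean_cmult)
qed

text \<open>For two signs, \<open>1/2 - (1/2) * ?c x * ?c y\<close> is the indicator of different
  parities, which force different degrees.\<close>

lemma mean_degree_in_neq_ge:
  assumes A: "finite A" "A \<noteq> {}"
  shows "(1 - (parity_mean r A xs)\<^sup>2) / 2
    \<le> mean A (\<lambda>x. mean A (\<lambda>y. of_bool (int (degree_in r x xs) \<noteq> int (degree_in r y xs))))"
proof -
  let ?c = "\<lambda>v. (- 1 :: real) ^ degree_in r v xs"
  have "mean A (\<lambda>x. mean A (\<lambda>y. 1/2 - (1/2) * ?c x * ?c y))
      = 1/2 - (1/2) * (parity_mean r A xs)\<^sup>2"
    unfolding mean_diff mean_const[OF A] mean_cmult mean_multc mult.assoc parity_mean_def power2_eq_square ..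
  moreover have "mean A (\<lambda>x. mean A (\<lambda>y. 1/2 - (1/2) * ?c x * ?c y))
     \<le> mean A (\<lambda>x. mean A (\<lambda>y. of_bool (int (degree_in r x xs) \<noteq> int (degree_in r y xs))))"
    by (intro mean_mono) (auto simp: minus_one_power_iff)
  ultimately show ?thesis by (simp add: diff_divide_distrib)
qed

text \<open>
  With high probability the last \<open>s\<close> vertices span no edge, so that the number of edges is a constant plus a
  sum of the i.i.d. degrees of these vertices into the first \<open>m\<close> vertices \<open>xs\<close>. The parities of these
  degrees are far from constant as soon as \<open>parity_mean r A xs\<close> is close to its expectation.
\<close>

lemma many_edges_bound:
  assumes w: "\<And>m j. w \<le> m \<Longrightarrow> real (m choose j) \<le> \<epsilon> * 2 ^ m" and A: "finite A" "A \<noteq> {}" and sym: "symp r"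
    and D: "D = 1 - mean A (\<lambda>v. (1 - 2 * vertex_density r A v) ^ m)" "0 < D" "D \<le> 1"
  shows "tuple_mean A (m + s) (\<lambda>xs. of_bool (edge_count r xs = l))
    \<le> real (s choose 2) * edge_density r A + 32 * real m * mean A (\<lambda>x. (vertex_density r A x)\<^sup>2) / D\<^sup>2
      + \<epsilon> + 2 ^ w * exp (- (real s * D / 8))"
proof -
  define \<mu> where "\<mu> = tuple_mean A m (parity_mean r A)"
  have \<mu>: "\<mu> = 1 - D" unfolding \<mu>_def tuple_mean_parity_mean[OF A] D by simp
  have "tuple_mean A (m + s) (\<lambda>xs. of_bool (edge_count r xs = l))
     \<le> tuple_mean A m (\<lambda>xs. (real (s choose 2) * edge_density r A + of_bool (D / 2 \<le> \<bar>parity_mean r A xs - \<mu>\<bar>))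
        + (\<epsilon> + 2 ^ w * exp (- (real s * D / 8))))"
    unfolding tuple_mean_append
  proof (rule tuple_mean_mono)
    fix xs :: "'a list" assume xs: "set xs \<subseteq> A" "length xs = m"
    let ?g = "\<lambda>y. int (degree_in r y xs)"
    let ?Z = "mean A (\<lambda>x. mean A (\<lambda>y. of_bool (?g x \<noteq> ?g y)))"
    define L where "L = tuple_mean A s (\<lambda>ys. of_bool (edge_count r (xs @ ys) = l))"
    have L1: "L \<le> 1" unfolding L_def by (intro tuple_mean_le_const[OF A]) auto
    \<comment> \<open>Either the last \<open>s\<close> vertices span an edge, which the edge count
      dominates, or the total is a constant plus the sum of degrees into \<open>xs\<close>.\<close>
    have "L \<le> tuple_mean A s (\<lambda>ys. real (edge_count r ys)
          + of_bool (sum_list (map ?g ys) = int l - int (edge_count r xs)))"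
      unfolding L_def
    proof (rule tuple_mean_mono)
      fix ys :: "'a list"
      have "int (edge_count r (xs @ ys)) = int (edge_count r xs) + int (edge_count r ys) + sum_list (map ?g ys)"
        unfolding edge_count_append[OF sym] by (simp add: comp_def flip: sum_list_of_nat)
      then show "of_bool (edge_count r (xs @ ys) = l)
         \<le> real (edge_count r ys) + of_bool (sum_list (map ?g ys) = int l - int (edge_count r xs))"
        by (cases "edge_count r ys = 0") auto
    qed
    also have "\<dots> \<le> real (s choose 2) * edge_density r A + (\<epsilon> + 2 ^ w * exp (- (real s * ?Z / 2)))"
      unfolding tuple_mean_add tuple_mean_edge_count[OF A]
      by (intro add_mono order_refl littlewood_offord_iid[OF w A])
    finally have *: "L \<le> real (s choose 2) * edge_density r A + (\<epsilon> + 2 ^ w * exp (- (real s * ?Z / 2)))" .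
    show "L \<le> (real (s choose 2) * edge_density r A + of_bool (D / 2 \<le> \<bar>parity_mean r A xs - \<mu>\<bar>))
        + (\<epsilon> + 2 ^ w * exp (- (real s * D / 8)))"
    proof (cases "D / 2 \<le> \<bar>parity_mean r A xs - \<mu>\<bar>")
      case True
      have "0 \<le> real (s choose 2) * edge_density r A" by (intro mult_nonneg_nonneg edge_density_nonneg) auto
      moreover have "0 \<le> 2 ^ w * exp (- (real s * D / 8))" by simp
      moreover have "0 \<le> \<epsilon>"
        using w[of w 0] by (smt (verit) binomial_n_0 mult_nonpos_nonneg of_nat_1 order_refl zero_le_power)
      ultimately have "L \<le> real (s choose 2) * edge_density r A + 1 + (\<epsilon> + 2 ^ w * exp (- (real s * D / 8)))"
        using L1 by linarith
      then show ?thesis using True by simp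
    next
      case False
      define x where "x = parity_mean r A xs"
      \<comment> \<open>The deviation from \<open>1 - D\<close> is below \<open>D / 2\<close>; the
        lower estimate also uses that \<open>D\<close> is at most 1.\<close>
      have x: "x \<le> 1 - D / 2" "- (1 - D / 2) \<le> x"
        using False \<mu> D(2,3) unfolding x_def by linarith+
      then have "\<bar>x\<bar> \<le> 1 - D / 2" by linarith
      then have "x\<^sup>2 \<le> (1 - D / 2)\<^sup>2"
        using D(2,3) by (metis abs_ge_zero power2_abs power_mono)
      also have "\<dots> \<le> 1 - D / 2"
        using D(2,3) mult_left_mono[of "1 - D / 2" 1 "1 - D / 2"] by (simp add: power2_eq_square)
      finally have "D / 4 \<le> (1 - x\<^sup>2) / 2" by simp
      also have "\<dots> \<le> ?Z" unfolding x_def by (rule mean_degree_in_neq_ge[OF A])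
      finally have "real s * D / 8 \<le> real s * ?Z / 2"
        using mult_left_mono[of "D / 4" ?Z "real s"] by (simp add: mult.commute)
      then have "2 ^ w * exp (- (real s * ?Z / 2)) \<le> 2 ^ w * exp (- (real s * D / 8))" by simp
      then have "L \<le> real (s choose 2) * edge_density r A + (\<epsilon> + 2 ^ w * exp (- (real s * D / 8)))"
        using * by linarith
      then show ?thesis using False by simp
    qed
  qed
  also have "\<dots> = real (s choose 2) * edge_density r A
      + tuple_mean A m (\<lambda>xs. of_bool (D / 2 \<le> \<bar>parity_mean r A xs - \<mu>\<bar>)) + (\<epsilon> + 2 ^ w * exp (- (real s * D / 8)))"
    unfolding tuple_mean_add tuple_mean_const[OF A] ..
  also have "tuple_mean A m (\<lambda>xs. of_bool (D / 2 \<le> \<bar>parity_mean r A xs - \<mu>\<bar>))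
      \<le> tuple_mean A m (\<lambda>xs. (parity_mean r A xs - \<mu>)\<^sup>2) / (D / 2)\<^sup>2"
    by (rule tuple_mean_chebyshev) (use D in simp)
  also have "\<dots> \<le> real m * (8 * mean A (\<lambda>x. (vertex_density r A x)\<^sup>2)) / (D / 2)\<^sup>2"
    unfolding \<mu>_def by (intro divide_right_mono parity_mean_variance_le[OF A sym]) auto
  finally show ?thesis by (simp add: power_divide algebra_simps)
qed

text \<open>With \<open>z = real m * y\<close> the power is at most \<open>exp (- z)\<close>, hence
  at most \<open>1 / (1 + z)\<close>. The loss against the linear term is thus only the constant
  factor \<open>1 + b\<close>.\<close>

lemma one_minus_power_ge:
  fixes y b :: real
  assumes "0 \<le> y" "y \<le> 1" "real m * y \<le> b"
  shows "real m * y / (1 + b) \<le> 1 - (1 - y) ^ m"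
proof -
  define z where "z = real m * y"
  have z: "0 \<le> z" "z \<le> b" using assms by (auto simp: z_def)
  have "(1 - y) ^ m \<le> exp (- z)"
    using one_minus_power_le_exp[OF assms(1,2), of m] by (simp add: z_def)
  also have "\<dots> \<le> 1 / (1 + z)"
    using exp_ge_add_one_self[of z] z by (simp add: exp_minus inverse_eq_divide frac_le)
  finally have "1 - (1 - y) ^ m \<ge> 1 - 1 / (1 + z)" by simp
  moreover have "1 - 1 / (1 + z) = z / (1 + z)" using z by (simp add: field_simps)
  moreover have "z / (1 + b) \<le> z / (1 + z)" using z by (intro divide_left_mono) (auto intro!: mult_pos_pos)
  ultimately show ?thesis unfolding z_def by linarith
qed

text \<open>The sample is cut into \<open>m + s\<close> draws. Densities at most
  \<open>M / k\<close> make \<open>D\<close> of order at least \<open>k * d\<close>, so the variance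
  term is of order \<open>1 / (k\<^sup>2 * d)\<close> for fixed \<open>M\<close> and the exponent
  \<open>s * D\<close> of order at least the square root of
  \<open>\<epsilon> * k\<^sup>2 * d\<close>. All errors are small once \<open>k\<^sup>2 * d\<close>
  exceeds \<open>B\<close>.\<close>

lemma bounded_density_many_edges:
  fixes M \<epsilon> B :: real
  assumes w: "\<And>m j. w \<le> m \<Longrightarrow> real (m choose j) \<le> \<epsilon> * 2 ^ m" and A: "finite A" "A \<noteq> {}" and sym: "symp r"
    and M: "1 \<le> M" and \<epsilon>: "0 < \<epsilon>" "\<epsilon> \<le> 1"
    and dens: "\<And>x. x \<in> A \<Longrightarrow> vertex_density r A x \<le> M / k"
    and k: "2 * M / \<epsilon> \<le> k"
    and B: "8 \<le> B" "32 * M * (1 + 2 * M)\<^sup>2 / \<epsilon> \<le> B" "B \<le> (real k)\<^sup>2 * edge_density r A"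
      "2 ^ w * exp (- (sqrt (2 * \<epsilon> * B) / (16 * (1 + 2 * M)))) \<le> \<epsilon>"
  shows "tuple_mean A k (\<lambda>xs. of_bool (edge_count r xs = l)) \<le> 4 * \<epsilon>"
proof -
  define d where "d = edge_density r A"
  \<comment> \<open>Chosen so that \<open>t\<^sup>2 * d / 2\<close> equals
    \<open>\<epsilon>\<close>, which bounds the expected number of edges among the last
    \<open>s\<close> draws.\<close>
  define t where "t = sqrt (2 * \<epsilon> / d)"
  define s where "s = nat \<lfloor>t\<rfloor>"
  define m where "m = k - s"
  define D where "D = 1 - mean A (\<lambda>v. (1 - 2 * vertex_density r A v) ^ m)"
  have "2 \<le> 2 * M / \<epsilon>" using M \<epsilon> by (simp add: field_simps)
  then have k2: "2 \<le> real k" using k by linarith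
  have "M \<le> M / \<epsilon>" using M \<epsilon> by (simp add: le_divide_eq mult_left_le)
  then have kM: "2 * M \<le> real k" using k by simp
  have d0: "0 < d"
    using B k2 unfolding d_def by (smt (verit) zero_less_mult_iff zero_le_power2)
  have dM: "d \<le> M / k"
    unfolding d_def edge_density_def using A dens by (intro mean_le_const)
  have kd: "B \<le> (real k)\<^sup>2 * d" using B by (simp add: d_def)
  have tpos: "0 \<le> t" using d0 \<epsilon> by (simp add: t_def)
  have "4 \<le> 2 * \<epsilon> / d"
  proof -
    have "4 * d \<le> 4 * (M / k)" using dM by simp
    also have "\<dots> \<le> 2 * \<epsilon>" using k \<epsilon> k2 by (simp add: field_simps)
    finally show ?thesis using d0 by (simp add: field_simps)
  qed
  then have t2: "2 \<le> t" unfolding t_def by (intro real_le_rsqrt) simp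
  have tk: "t \<le> k / 2"
  proof -
    have "2 * \<epsilon> / d \<le> (k / 2)\<^sup>2"
      using kd B(1) \<epsilon> d0 by (simp add: field_simps power2_eq_square)
    then show ?thesis unfolding t_def by (intro real_le_lsqrt) auto
  qed
  \<comment> \<open>Rounding down loses at most a factor 2 because \<open>t\<close> is at least
    2.\<close>
  have s: "real s \<le> t" "t / 2 \<le> real s"
    using t2 by (auto simp: s_def) linarith+
  have sk: "s \<le> k" and m: "real k / 2 \<le> real m" "m \<le> k"
    using s tk by (auto simp: m_def of_nat_diff)
  have rho: "0 \<le> vertex_density r A x" for x by (rule vertex_density_bounds[OF A])
  \<comment> \<open>\<open>one_minus_power_ge\<close> is applied with \<open>y\<close> twice the
    vertex density and \<open>b = 2 * M\<close>; the factor 2 compensates for \<open>m\<close> being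
    possibly as small as \<open>k / 2\<close>.\<close>
  have D_ge: "real k * d / (1 + 2 * M) \<le> D"
  proof -
    have "real k * d / (1 + 2 * M) \<le> mean A (\<lambda>v. (2 * real m / (1 + 2 * M)) * vertex_density r A v)"
      unfolding mean_cmult edge_density_def[symmetric] d_def[symmetric]
      using m M d0 by (simp add: divide_right_mono mult_right_mono)
    also have "\<dots> \<le> mean A (\<lambda>v. 1 - (1 - 2 * vertex_density r A v) ^ m)"
    proof (rule mean_mono)
      fix v assume v: "v \<in> A"
      have "2 * vertex_density r A v \<le> 2 * (M / k)" using dens[OF v] by simp
      also have "\<dots> \<le> 1" using kM k2 by (simp add: field_simps)
      finally have 1: "2 * vertex_density r A v \<le> 1" .
      have "real m * (2 * vertex_density r A v) \<le> real k * (2 * (M / k))"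
        using dens[OF v] m rho[of v] by (intro mult_mono) auto
      then have "real m * (2 * vertex_density r A v) \<le> 2 * M" using k2 by simp
      then have "real m * (2 * vertex_density r A v) / (1 + 2 * M) \<le> 1 - (1 - 2 * vertex_density r A v) ^ m"
        using 1 rho[of v] by (intro one_minus_power_ge) auto
      then show "(2 * real m / (1 + 2 * M)) * vertex_density r A v \<le> 1 - (1 - 2 * vertex_density r A v) ^ m"
        by (simp add: algebra_simps)
    qed
    also have "\<dots> = D" unfolding D_def mean_diff mean_const[OF A] ..
    finally show ?thesis .
  qed
  have D0: "0 < D" using D_ge d0 k2 M by (smt (verit) divide_pos_pos mult_pos_pos)
  have D1: "D \<le> 1"
  proof -
    have "0 \<le> (1 - 2 * vertex_density r A v) ^ m" if v: "v \<in> A" for v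
    proof -
      have "2 * vertex_density r A v \<le> 2 * (M / k)" using dens[OF v] by simp
      also have "\<dots> \<le> 1" using kM k2 by (simp add: field_simps)
      finally show ?thesis by simp
    qed
    then show ?thesis unfolding D_def using mean_nonneg[of A "\<lambda>v. (1 - 2 * vertex_density r A v) ^ m"] by simp
  qed
  have 1: "real (s choose 2) * d \<le> \<epsilon>"
  proof -
    have "real (s choose 2) \<le> (real s)\<^sup>2 / 2"
    proof -
      have "2 * (s choose 2) \<le> s * (s - 1)" by (simp add: choose_two)
      also have "\<dots> \<le> s * s" by (rule mult_le_mono2) simp
      finally have "2 * (s choose 2) \<le> s * s" .
      then have "real (2 * (s choose 2)) \<le> real (s * s)" by (rule of_nat_mono)
      then show ?thesis by (simp add: power2_eq_square)
    qed
    also have "\<dots> \<le> t\<^sup>2 / 2" using s by (simp add: power_mono)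
    also have "t\<^sup>2 = 2 * \<epsilon> / d" unfolding t_def using \<epsilon> d0 by simp
    finally show ?thesis using d0 by (simp add: field_simps)
  qed
  have 2: "32 * real m * mean A (\<lambda>x. (vertex_density r A x)\<^sup>2) / D\<^sup>2 \<le> \<epsilon>"
  proof -
    have "mean A (\<lambda>x. (vertex_density r A x)\<^sup>2) \<le> mean A (\<lambda>x. (M / k) * vertex_density r A x)"
      unfolding power2_eq_square by (intro mean_mono mult_right_mono dens rho)
    also have "\<dots> = (M / k) * d" unfolding mean_cmult d_def edge_density_def ..
    finally have "32 * real m * mean A (\<lambda>x. (vertex_density r A x)\<^sup>2) \<le> 32 * real k * ((M / k) * d)"
      using m by (intro mult_mono) (auto intro!: mean_nonneg)
    also have "\<dots> = 32 * M * d" using k2 by simp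
    finally have "32 * real m * mean A (\<lambda>x. (vertex_density r A x)\<^sup>2) / D\<^sup>2 \<le> 32 * M * d / D\<^sup>2"
      by (intro divide_right_mono) auto
    also have "\<dots> \<le> 32 * M * d / (real k * d / (1 + 2 * M))\<^sup>2"
      using D_ge D0 d0 k2 M by (intro divide_left_mono power_mono mult_pos_pos) auto
    also have "\<dots> = (32 * M * (1 + 2 * M)\<^sup>2) / ((real k)\<^sup>2 * d)"
      using d0 k2 M by (simp add: power_divide power_mult_distrib power2_eq_square[of d] field_simps)
    also have "\<dots> \<le> \<epsilon>"
    proof -
      have "32 * M * (1 + 2 * M)\<^sup>2 \<le> \<epsilon> * B" using B(2) \<epsilon> by (simp add: field_simps)
      also have "\<dots> \<le> \<epsilon> * ((real k)\<^sup>2 * d)" using kd \<epsilon> by simp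
      finally show ?thesis using d0 k2 by (simp add: divide_le_eq)
    qed
    finally show ?thesis .
  qed
  have 3: "2 ^ w * exp (- (real s * D / 8)) \<le> \<epsilon>"
  proof -
    have "sqrt (2 * \<epsilon> * B) \<le> sqrt (2 * \<epsilon> * ((real k)\<^sup>2 * d))"
      using kd \<epsilon> by simp
    also have "\<dots> = sqrt (2 * \<epsilon> / d * (real k * d)\<^sup>2)"
      using d0 by (simp add: power2_eq_square field_simps)
    also have "\<dots> = t * (real k * d)" unfolding t_def real_sqrt_mult using d0 by simp
    finally have "sqrt (2 * \<epsilon> * B) / (16 * (1 + 2 * M)) \<le> t * (real k * d) / (16 * (1 + 2 * M))"
      using M by (intro divide_right_mono) auto
    also have "\<dots> = (t / 2) * (real k * d / (1 + 2 * M)) / 8" by simp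
    also have "\<dots> \<le> real s * D / 8"
      using s D_ge d0 M tpos by (intro divide_right_mono mult_mono) auto
    finally have "2 ^ w * exp (- (real s * D / 8)) \<le> 2 ^ w * exp (- (sqrt (2 * \<epsilon> * B) / (16 * (1 + 2 * M))))" by simp
    then show ?thesis using B(4) by linarith
  qed
  have "tuple_mean A (m + s) (\<lambda>xs. of_bool (edge_count r xs = l))
    \<le> real (s choose 2) * edge_density r A + 32 * real m * mean A (\<lambda>x. (vertex_density r A x)\<^sup>2) / D\<^sup>2
      + \<epsilon> + 2 ^ w * exp (- (real s * D / 8))"
    by (rule many_edges_bound[OF w A sym D_def D0 D1])
  then show ?thesis using 1 2 3 sk by (simp add: m_def d_def)
qed

subsection \<open>Bounded expected number of edges\<close>

lemma finite_tuples: "finite A \<Longrightarrow> finite {xs. set xs \<subseteq> A \<and> length xs = m}"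
  by (rule finite_lists_length_eq)

lemma tuple_mean_eq_sum:
  assumes "finite A"
  shows "tuple_mean A m f = (\<Sum>xs | set xs \<subseteq> A \<and> length xs = m. f xs) / real (card A) ^ m"
proof (induction m arbitrary: f)
  case 0
  have "{xs. set xs \<subseteq> A \<and> length xs = 0} = {[]}" by auto
  then show ?case by simp
next
  case (Suc m)
  let ?T = "{xs. set xs \<subseteq> A \<and> length xs = m}"
  have "(\<Sum>xs | set xs \<subseteq> A \<and> length xs = Suc m. f xs) = (\<Sum>(xs, x)\<in>?T \<times> A. f (x # xs))"
    unfolding lists_length_Suc_eq by (subst sum.reindex) (auto simp: inj_on_def case_prod_beta)
  also have "\<dots> = (\<Sum>x\<in>A. \<Sum>xs\<in>?T. f (x # xs))"
    unfolding sum.cartesian_product[symmetric] by (rule sum.swap)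
  finally show ?case
    by (simp add: Suc.IH mean_def mult.commute flip: sum_divide_distrib)
qed

text \<open>Every \<open>k\<close>-subset has \<open>fact k\<close> orderings, and \<open>Q\<close>
  depends only on the underlying set.\<close>

lemma card_distinct_tuples:
  assumes "finite A"
  shows "card {xs. (set xs \<subseteq> A \<and> length xs = k) \<and> distinct xs \<and> Q (set xs)}
    = fact k * card {S \<in> [A]\<^bsup>k\<^esup>. Q S}"
proof -
  have "card {xs. (set xs \<subseteq> A \<and> length xs = k) \<and> distinct xs \<and> Q (set xs)}
      = card (\<Union>S\<in>{S \<in> [A]\<^bsup>k\<^esup>. Q S}. {xs. length xs = k \<and> distinct xs \<and> set xs = S})"
    by (rule arg_cong[where f = card]) (auto simp: nsets_def distinct_card)
  also have "\<dots> = (\<Sum>S\<in>{S \<in> [A]\<^bsup>k\<^esup>. Q S}. card {xs. length xs = k \<and> distinct xs \<and> set xs = S})"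
  proof (rule card_UN_disjoint)
    show "finite {S \<in> [A]\<^bsup>k\<^esup>. Q S}" using assms by (simp add: finite_imp_finite_nsets)
    show "\<forall>S\<in>{S \<in> [A]\<^bsup>k\<^esup>. Q S}. finite {xs. length xs = k \<and> distinct xs \<and> set xs = S}"
    proof
      fix S assume "S \<in> {S \<in> [A]\<^bsup>k\<^esup>. Q S}"
      then have "finite S" by (auto simp: nsets_def)
      then show "finite {xs. length xs = k \<and> distinct xs \<and> set xs = S}"
        by (intro finite_subset[OF _ finite_tuples[of S k]]) auto
    qed
  qed auto
  also have "\<dots> = (\<Sum>S\<in>{S \<in> [A]\<^bsup>k\<^esup>. Q S}. fact k)"
  proof (rule sum.cong[OF refl])
    fix S assume "S \<in> {S \<in> [A]\<^bsup>k\<^esup>. Q S}"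
    then have S: "finite S" "card S = k" by (auto simp: nsets_def)
    have "{xs. length xs = k \<and> distinct xs \<and> set xs = S} = {xs. length xs = k \<and> distinct xs \<and> set xs \<subseteq> S}"
      using S by (metis (no_types, lifting) card_subset_eq distinct_card order_refl)
    then show "card {xs. length xs = k \<and> distinct xs \<and> set xs = S} = fact k"
      using S card_lists_distinct_length_eq[of S k] by (simp add: fact_prod)
  qed
  finally show ?thesis by simp
qed

lemma edges_in_insert:
  assumes "x \<notin> S" "E \<subseteq> [V]\<^bsup>2\<^esup>"
  shows "edges_in E (insert x S) = edges_in E S \<union> (\<lambda>y. {x, y}) ` {y \<in> S. {x, y} \<in> E}"
proof
  show "edges_in E (insert x S) \<subseteq> edges_in E S \<union> (\<lambda>y. {x, y}) ` {y \<in> S. {x, y} \<in> E}"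
  proof
    fix e assume e: "e \<in> edges_in E (insert x S)"
    then have "card e = 2" using assms(2) by (auto simp: edges_in_def nsets_def)
    then obtain a b where ab: "e = {a, b}" "a \<noteq> b" by (auto simp: card_2_iff)
    show "e \<in> edges_in E S \<union> (\<lambda>y. {x, y}) ` {y \<in> S. {x, y} \<in> E}"
    proof (cases "x \<in> e")
      case True
      then obtain y where "e = {x, y}" "y \<noteq> x" using ab by auto
      then show ?thesis using e by (auto simp: edges_in_def)
    next
      case False
      then show ?thesis using e by (auto simp: edges_in_def)
    qed
  qed
qed (auto simp: edges_in_def)

lemma edge_count_distinct:
  assumes E: "E \<subseteq> [V]\<^bsup>2\<^esup>" and "distinct xs"
  shows "edge_count (\<lambda>x y. {x, y} \<in> E) xs = card (edges_in E (set xs))"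
  using assms(2)
proof (induction xs)
  case Nil
  have "edges_in E {} = {}" using E by (auto simp: edges_in_def nsets_def)
  then show ?case by simp
next
  case (Cons x xs)
  let ?N = "{y \<in> set xs. {x, y} \<in> E}"
  have "finite (edges_in E (set xs))"
    by (rule finite_subset[of _ "Pow (set xs)"]) (auto simp: edges_in_def)
  then have "card (edges_in E (set (x # xs))) = card (edges_in E (set xs)) + card ((\<lambda>y. {x, y}) ` ?N)"
    unfolding list.set edges_in_insert[OF _ E, of x "set xs"] using Cons.prems
    by (subst edges_in_insert[OF _ E]) (auto intro!: card_Un_disjoint simp: edges_in_def)
  also have "card ((\<lambda>y. {x, y}) ` ?N) = card ?N"
    using Cons.prems by (intro card_image) (auto simp: inj_on_def doubleton_eq_iff)
  also have "\<dots> = degree_in (\<lambda>x y. {x, y} \<in> E) x xs"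
    using Cons.prems distinct_card[of "filter (\<lambda>y. {x, y} \<in> E) xs"] by (simp add: degree_in_def)
  finally show ?case using Cons by simp
qed

lemma two_mult_choose_two: "2 * real (m choose 2) = real m * (real m - 1)"
  by (induction m) (auto simp: numeral_2_eq_2 algebra_simps)

text \<open>Birthday bound: coincidences are edges of the relation \<open>(=)\<close>, whose edge
  density is \<open>1 / card A\<close>.\<close>

lemma tuple_mean_not_distinct_le:
  assumes A: "finite A" "A \<noteq> {}"
  shows "tuple_mean A k (\<lambda>xs. of_bool (\<not> distinct xs)) \<le> (real k)\<^sup>2 / card A"
proof -
  have "tuple_mean A k (\<lambda>xs. of_bool (\<not> distinct xs)) \<le> tuple_mean A k (\<lambda>xs. real (edge_count (=) xs))"
  proof (rule tuple_mean_mono)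
    fix xs :: "'a list"
    show "of_bool (\<not> distinct xs) \<le> real (edge_count (=) xs)"
    proof (induction xs)
      case (Cons x xs)
      have "x \<in> set xs \<Longrightarrow> 1 \<le> degree_in (=) x xs"
        by (induction xs) auto
      then show ?case using Cons by (auto split: if_splits)
    qed simp
  qed
  also have "\<dots> = real (k choose 2) * edge_density (=) A"
    by (rule tuple_mean_edge_count[OF A])
  also have "edge_density (=) A = mean A (\<lambda>_. 1 / card A)"
    unfolding edge_density_def vertex_density_def mean_def[of A "\<lambda>y. of_bool (_ = y)"]
    by (rule mean_cong) (use A in \<open>simp add: of_bool_def\<close>)
  also have "\<dots> = 1 / card A" by (rule mean_const[OF A])
  also have "real (k choose 2) * (1 / card A) \<le> (real k)\<^sup>2 * (1 / card A)"
  proof (rule mult_right_mono)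
    have "2 * real (k choose 2) \<le> (real k)\<^sup>2"
      unfolding two_mult_choose_two by (simp add: power2_eq_square algebra_simps)
    then show "real (k choose 2) \<le> (real k)\<^sup>2" by linarith
  qed simp
  finally show ?thesis by simp
qed

text \<open>Conditioned on being distinct, the tuple is an ordering of a uniform
  \<open>k\<close>-subset, so the two probabilities differ by at most the probability of a
  repetition.\<close>

lemma tuple_mean_span_prob:
  assumes V: "finite V" "V \<noteq> {}" and E: "E \<subseteq> [W]\<^bsup>2\<^esup>"
  shows "\<bar>tuple_mean V k (\<lambda>xs. of_bool (edge_count (\<lambda>x y. {x, y} \<in> E) xs = l)) - span_prob V E k l\<bar>
    \<le> (real k)\<^sup>2 / card V"
proof -
  let ?r = "\<lambda>x y. {x, y} \<in> E" and ?n = "real (card V) ^ k"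
  define P where "P = tuple_mean V k (\<lambda>xs. of_bool (edge_count ?r xs = l))"
  define Pd where "Pd = tuple_mean V k (\<lambda>xs. of_bool (distinct xs \<and> edge_count ?r xs = l))"
  define d where "d = tuple_mean V k (\<lambda>xs. of_bool (distinct xs))"
  define nd where "nd = tuple_mean V k (\<lambda>xs. of_bool (\<not> distinct xs))"
  have count: "tuple_mean V k (\<lambda>xs. of_bool (distinct xs \<and> Q (set xs))) = fact k * real (card {S \<in> [V]\<^bsup>k\<^esup>. Q S}) / ?n" for Q
  proof -
    have "(\<Sum>xs | set xs \<subseteq> V \<and> length xs = k. of_bool (distinct xs \<and> Q (set xs)) :: real)
       = real (card {xs. (set xs \<subseteq> V \<and> length xs = k) \<and> distinct xs \<and> Q (set xs)})"
      using finite_tuples[OF V(1), of k] by (simp add: Int_def)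
    then show ?thesis
      unfolding tuple_mean_eq_sum[OF V(1)] card_distinct_tuples[OF V(1)] by simp
  qed
  have "Pd = tuple_mean V k (\<lambda>xs. of_bool (distinct xs \<and> card (edges_in E (set xs)) = l))"
    unfolding Pd_def by (rule tuple_mean_cong) (use edge_count_distinct[OF E] in \<open>auto simp: of_bool_def\<close>)
  then have Pd: "Pd = fact k * real (card {S \<in> [V]\<^bsup>k\<^esup>. card (edges_in E S) = l}) / ?n"
    using count[of "\<lambda>S. card (edges_in E S) = l"] by simp
  have d: "d = fact k * real (card ([V]\<^bsup>k\<^esup>)) / ?n"
    using count[of "\<lambda>_. True"] by (simp add: d_def)
  have fin: "finite ([V]\<^bsup>k\<^esup>)" using V by (simp add: finite_imp_finite_nsets)
  have sub: "card {S \<in> [V]\<^bsup>k\<^esup>. card (edges_in E S) = l} \<le> card ([V]\<^bsup>k\<^esup>)"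
    using fin by (intro card_mono) auto
  \<comment> \<open>If there are no \<open>k\<close>-subsets, both sides are 0, the span probability
    by division by zero.\<close>
  have sp: "Pd = span_prob V E k l * d"
    using sub unfolding Pd d span_prob_def by (cases "card ([V]\<^bsup>k\<^esup>) = 0") (simp_all add: binomial_eq_0)
  have sp01: "0 \<le> span_prob V E k l" "span_prob V E k l \<le> 1"
    unfolding span_prob_def using sub by (auto simp: divide_le_eq_1)
  have dnd: "d + nd = 1"
  proof -
    have "tuple_mean V k (\<lambda>xs. of_bool (distinct xs) + of_bool (\<not> distinct xs)) = tuple_mean V k (\<lambda>_. 1)"
      by (rule tuple_mean_cong) auto
    then show ?thesis unfolding d_def nd_def tuple_mean_add tuple_mean_const[OF V] .
  qed
  have "Pd \<le> P" unfolding Pd_def P_def by (rule tuple_mean_mono) auto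
  moreover have "P \<le> Pd + nd"
    unfolding Pd_def P_def nd_def tuple_mean_add[symmetric] by (rule tuple_mean_mono) auto
  moreover have nd: "nd \<le> (real k)\<^sup>2 / card V" "0 \<le> nd"
    unfolding nd_def using tuple_mean_not_distinct_le[OF V] by (auto intro: tuple_mean_nonneg)
  moreover have "span_prob V E k l - nd \<le> Pd" "Pd \<le> span_prob V E k l"
  proof -
    have eq: "Pd = span_prob V E k l - span_prob V E k l * nd"
      unfolding sp using dnd by (simp add: eq_diff_eq flip: distrib_left)
    have "span_prob V E k l * nd \<le> 1 * nd" using sp01 nd by (intro mult_right_mono) auto
    moreover have "0 \<le> span_prob V E k l * nd" using sp01 nd by simp
    ultimately show "span_prob V E k l - nd \<le> Pd" "Pd \<le> span_prob V E k l" using eq by linarith+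
  qed
  ultimately show ?thesis unfolding P_def[symmetric] by linarith
qed

section \<open>From a fixed sample size to a Bernoulli random set\<close>

lemma Bernstein_chebyshev:
  assumes p: "0 \<le> p" "p \<le> 1" and d: "0 < d" and J: "\<And>j. j \<le> n \<Longrightarrow> j \<notin> J \<Longrightarrow> d \<le> \<bar>real j - real n * p\<bar>"
  shows "(\<Sum>j\<in>{..n} - J. Bernstein n j p) \<le> real n * p / d\<^sup>2"
proof -
  \<comment> \<open>The square is expanded in \<open>j * (j - 1)\<close>, \<open>j\<close> and 1,
    whose Bernstein sums are known.\<close>
  have "(\<Sum>j\<le>n. (real j - real n * p)\<^sup>2 * Bernstein n j p)
     = (\<Sum>j\<le>n. real j * (real j - 1) * Bernstein n j p + (1 - 2 * (real n * p)) * (real j * Bernstein n j p)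
         + (real n * p)\<^sup>2 * Bernstein n j p)"
    by (rule sum.cong) (auto simp: power2_eq_square algebra_simps)
  also have "\<dots> = real n * (real n - 1) * p\<^sup>2 + (1 - 2 * (real n * p)) * (real n * p) + (real n * p)\<^sup>2"
    unfolding sum.distrib sum_distrib_left[symmetric] by simp
  also have "\<dots> = real n * p - real n * p\<^sup>2"
    by (simp add: power2_eq_square algebra_simps)
  also have "\<dots> \<le> real n * p" by simp
  finally have var: "(\<Sum>j\<le>n. (real j - real n * p)\<^sup>2 * Bernstein n j p) \<le> real n * p" .
  have "(\<Sum>j\<in>{..n} - J. Bernstein n j p) \<le> (\<Sum>j\<in>{..n} - J. (real j - real n * p)\<^sup>2 * Bernstein n j p / d\<^sup>2)"
  proof (rule sum_mono)
    fix j assume "j \<in> {..n} - J"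
    then have "d \<le> \<bar>real j - real n * p\<bar>" using J by simp
    then have "d\<^sup>2 \<le> (real j - real n * p)\<^sup>2" using d by (metis less_imp_le power2_abs power_mono)
    then have "d\<^sup>2 * Bernstein n j p \<le> (real j - real n * p)\<^sup>2 * Bernstein n j p"
      using p by (intro mult_right_mono Bernstein_nonneg) auto
    then show "Bernstein n j p \<le> (real j - real n * p)\<^sup>2 * Bernstein n j p / d\<^sup>2"
      using d by (simp add: field_simps)
  qed
  also have "\<dots> \<le> (\<Sum>j\<le>n. (real j - real n * p)\<^sup>2 * Bernstein n j p / d\<^sup>2)"
    using p by (intro sum_mono2) (auto intro!: divide_nonneg_nonneg mult_nonneg_nonneg Bernstein_nonneg)
  also have "\<dots> \<le> real n * p / d\<^sup>2"
    unfolding sum_divide_distrib[symmetric] using var by (intro divide_right_mono) auto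
  finally show ?thesis .
qed

text \<open>If the counts of the tuple and its prefix differ, there is a new edge; the expected
  number of new edges bounds the error.\<close>

lemma tuple_mean_prefix_le:
  assumes A: "finite A" "A \<noteq> {}" and sym: "symp r" and "j \<le> k"
  shows "tuple_mean A k (\<lambda>xs. of_bool (edge_count r xs = l))
    \<le> tuple_mean A j (\<lambda>xs. of_bool (edge_count r xs = l)) + real (k - j) * real k * edge_density r A"
proof -
  have "tuple_mean A k (\<lambda>xs. of_bool (edge_count r xs = l))
     \<le> tuple_mean A k (\<lambda>xs. of_bool (edge_count r (take j xs) = l)
         + (real (edge_count r xs) - real (edge_count r (take j xs))))"
  proof (rule tuple_mean_mono)
    fix xs :: "'a list"
    have "edge_count r (take j xs @ drop j xs) \<ge> edge_count r (take j xs)"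
      unfolding edge_count_append[OF sym] by simp
    then have "edge_count r (take j xs) \<le> edge_count r xs" by simp
    then show "of_bool (edge_count r xs = l) \<le> of_bool (edge_count r (take j xs) = l)
         + (real (edge_count r xs) - real (edge_count r (take j xs)))"
      by (cases "edge_count r (take j xs) = edge_count r xs") auto
  qed
  also have "\<dots> = tuple_mean A j (\<lambda>xs. of_bool (edge_count r xs = l))
      + (real (k choose 2) - real (j choose 2)) * edge_density r A"
    unfolding tuple_mean_add tuple_mean_diff
      tuple_mean_take[OF A \<open>j \<le> k\<close>, of "\<lambda>xs. of_bool (edge_count r xs = l)"]
      tuple_mean_take[OF A \<open>j \<le> k\<close>, of "\<lambda>xs. real (edge_count r xs)"] tuple_mean_edge_count[OF A]
    by (simp add: algebra_simps)
  also have "(real (k choose 2) - real (j choose 2)) * edge_density r A \<le> real (k - j) * real k * edge_density r A"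
  proof (rule mult_right_mono[OF _ edge_density_nonneg])
    obtain i where k: "k = j + i" using \<open>j \<le> k\<close> le_Suc_ex by blast
    have "2 * (real (k choose 2) - real (j choose 2)) = 2 * real i * real j + real i * real i - real i"
      unfolding right_diff_distrib two_mult_choose_two k by (simp add: algebra_simps)
    also have "\<dots> \<le> 2 * (real (k - j) * real k)"
      unfolding k by (simp add: algebra_simps)
    finally show "real (k choose 2) - real (j choose 2) \<le> real (k - j) * real k"
      by (metis mult_le_cancel_left_pos zero_less_numeral)
  qed
  finally show ?thesis by simp
qed

text \<open>For every size \<open>j\<close> slightly below \<open>k\<close> the probability is at
  most that of a uniform \<open>j\<close>-subset plus a small error. Averaging these bounds with
  binomial weights produces a Bernoulli random set, for which \<open>exp (p - 1)\<close> is
  available; sizes outside the window \<open>J\<close> are rare by Chebyshev.\<close>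

lemma sparse_bound:
  assumes V: "finite V" and E: "E \<subseteq> [W]\<^bsup>2\<^esup>" and k: "1 \<le> k" "k \<le> card V" and l: "1 \<le> l"
    and \<eta>: "0 < \<eta>" "\<eta> \<le> 1"
  shows "tuple_mean V k (\<lambda>xs. of_bool (edge_count (\<lambda>x y. {x, y} \<in> E) xs = l))
    \<le> exp (real k / card V - 1) + (real k)\<^sup>2 / card V
      + \<eta> * (real k)\<^sup>2 * edge_density (\<lambda>x y. {x, y} \<in> E) V + 4 / (\<eta>\<^sup>2 * k)"
proof -
  let ?r = "\<lambda>x y. {x, y} \<in> E"
  define n where "n = card V"
  \<comment> \<open>The binomial mean lies in the middle of the window \<open>J\<close>, at distance
    \<open>\<eta> * k / 2\<close> from both ends.\<close>
  define p where "p = (1 - \<eta> / 2) * real k / real n"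
  define P where "P j = tuple_mean V j (\<lambda>xs. of_bool (edge_count ?r xs = l))" for j
  define J where "J = {j. (1 - \<eta>) * real k \<le> real j \<and> j \<le> k}"
  define R where "R = (real k)\<^sup>2 / n + \<eta> * (real k)\<^sup>2 * edge_density ?r V"
  have ne: "V \<noteq> {}" using k by auto
  have sym: "symp ?r" by (auto simp: symp_def insert_commute)
  have n0: "0 < real n" "real k \<le> real n" using k by (auto simp: n_def)
  have np: "real n * p = (1 - \<eta> / 2) * real k" using n0 by (simp add: p_def)
  have pk: "p \<le> real k / n"
    unfolding p_def using \<eta> n0 by (intro divide_right_mono mult_left_le_one_le) auto
  moreover have "real k / n \<le> 1" using n0 by simp
  ultimately have "p \<le> 1" by linarith
  moreover have "0 \<le> p" using \<eta> n0 by (simp add: p_def)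
  ultimately have p: "0 \<le> p" "p \<le> 1" by blast+
  have Jn: "J \<subseteq> {..n}" using k by (auto simp: J_def n_def)
  have R0: "0 \<le> R"
    unfolding R_def using \<eta> n0 by (intro add_nonneg_nonneg mult_nonneg_nonneg edge_density_nonneg) auto
  have P1: "P k \<le> 1" unfolding P_def by (rule tuple_mean_le_const[OF V ne]) auto
  have PJ: "P k \<le> span_prob V E j l + R" if j: "j \<in> J" for j
  proof -
    have jk: "j \<le> k" "real (k - j) \<le> \<eta> * real k" using j by (auto simp: J_def of_nat_diff algebra_simps)
    have "P k \<le> P j + real (k - j) * real k * edge_density ?r V"
      unfolding P_def by (rule tuple_mean_prefix_le[OF V ne sym jk(1)])
    also have "real (k - j) * real k * edge_density ?r V \<le> \<eta> * real k * real k * edge_density ?r V"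
      using jk by (intro mult_right_mono edge_density_nonneg) auto
    also have "P j \<le> span_prob V E j l + (real j)\<^sup>2 / n"
      using tuple_mean_span_prob[OF V ne E, of j l] unfolding P_def n_def by linarith
    also have "(real j)\<^sup>2 / n \<le> (real k)\<^sup>2 / n"
      using jk by (intro divide_right_mono power_mono) auto
    finally show ?thesis by (simp add: R_def power2_eq_square algebra_simps)
  qed
  have "(\<Sum>j\<in>{..n} - J. Bernstein n j p) \<le> real n * p / (\<eta> * real k / 2)\<^sup>2"
  proof (rule Bernstein_chebyshev[OF p])
    have np': "real n * p = real k - \<eta> * real k / 2" unfolding np by (simp add: algebra_simps)
    show "0 < \<eta> * real k / 2" using \<eta> k by simp
    fix j assume "j \<le> n" "j \<notin> J"
    then consider "real j < (1 - \<eta>) * real k" | "real k < real j" by (auto simp: J_def)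
    then show "\<eta> * real k / 2 \<le> \<bar>real j - real n * p\<bar>"
    proof cases
      case 1
      then have "real j < real k - \<eta> * real k" by (simp add: algebra_simps)
      then show ?thesis unfolding np' by linarith
    next
      case 2
      then show ?thesis unfolding np' by linarith
    qed
  qed
  also have "\<dots> \<le> real k / (\<eta> * real k / 2)\<^sup>2"
    unfolding np using \<eta> by (intro divide_right_mono) (auto simp: mult_left_le_one_le)
  also have "\<dots> = 4 / (\<eta>\<^sup>2 * k)"
    using k \<eta> by (simp add: power2_eq_square field_simps)
  finally have tail: "(\<Sum>j\<in>{..n} - J. Bernstein n j p) \<le> 4 / (\<eta>\<^sup>2 * k)" .
  have "P k = (\<Sum>j\<le>n. Bernstein n j p * P k)"
    unfolding sum_distrib_right[symmetric] by simp
  also have "\<dots> = (\<Sum>j\<in>J. Bernstein n j p * P k) + (\<Sum>j\<in>{..n} - J. Bernstein n j p * P k)"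
    using Jn by (subst sum.subset_diff[of J]) auto
  also have "(\<Sum>j\<in>J. Bernstein n j p * P k) \<le> (\<Sum>j\<in>J. Bernstein n j p * (span_prob V E j l + R))"
    using p by (intro sum_mono mult_left_mono PJ Bernstein_nonneg) auto
  also have "\<dots> \<le> (\<Sum>j\<le>n. Bernstein n j p * (span_prob V E j l + R))"
    using p Jn R0 by (intro sum_mono2 mult_nonneg_nonneg Bernstein_nonneg add_nonneg_nonneg) (auto simp: span_prob_def)
  also have "\<dots> = (\<Sum>j\<le>n. Bernstein n j p * span_prob V E j l) + R"
    unfolding distrib_left sum.distrib sum_distrib_right[symmetric] by simp
  also have "(\<Sum>j\<le>n. Bernstein n j p * span_prob V E j l) \<le> exp (p - 1)"
    unfolding n_def bernoulli_mean_span_prob[OF V, symmetric]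
    using bernoulli_mean_edges_le[OF V p l E] .
  also have "exp (p - 1) \<le> exp (real k / n - 1)" using pk by simp
  also have "(\<Sum>j\<in>{..n} - J. Bernstein n j p * P k) \<le> (\<Sum>j\<in>{..n} - J. Bernstein n j p)"
    using p P1 by (intro sum_mono mult_left_le Bernstein_nonneg) auto
  also note tail
  finally show ?thesis unfolding P_def R_def n_def by (simp add: add.assoc)
qed

subsection \<open>The theorem\<close>

lemma exp_minus_one_bound:
  assumes "0 \<le> x" "x \<le> (1::real)"
  shows "exp (x - 1) \<le> exp (- 1) + 2 * x"
proof -
  have "exp x \<le> 1 + x + x\<^sup>2" using assms by (rule exp_bound)
  also have "x\<^sup>2 \<le> x" using assms by (simp add: power2_eq_square mult_left_le)
  finally have "exp (- 1) * exp x \<le> exp (- 1) * (1 + 2 * x)" by simp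
  also have "\<dots> = exp (- 1) + exp (- 1) * (2 * x)" by (simp add: algebra_simps)
  also have "exp (- 1) * (2 * x) \<le> 1 * (2 * x)" using assms by (intro mult_right_mono) auto
  finally show ?thesis by (simp flip: exp_add)
qed

lemma exp_minus_ln_le:
  assumes "0 < a" "0 < \<epsilon>" "ln (a / \<epsilon>) \<le> y"
  shows "a * exp (- y) \<le> (\<epsilon> :: real)"
proof -
  have "a * exp (- y) \<le> a * exp (- ln (a / \<epsilon>))" using assms by simp
  also have "\<dots> = \<epsilon>" using assms by (simp add: exp_minus)
  finally show ?thesis .
qed

text \<open>Either \<open>k\<^sup>2\<close> times the edge density is at least \<open>B\<close> and
  anti-concentration applies, or it is below \<open>B\<close> and \<open>sparse_bound\<close>
  applies. The clause with \<open>l0\<close> says that large \<open>l\<close> is unlikely in either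
  case; it drives the final dichotomy. \<open>W\<close> is kept apart from \<open>V\<close> because
  the lemma is used on a subset of the vertices with the edges of the whole graph.\<close>

lemma bounded_density_bound:
  fixes M \<epsilon> :: real
  assumes M: "1 \<le> M" and \<epsilon>: "0 < \<epsilon>" "\<epsilon> \<le> 1"
  shows "\<exists>l0 k0 :: nat. \<forall>k\<ge>k0. \<forall>(V :: 'a set) W E l. finite V \<and> k \<le> card V \<and> 3 * (real k)\<^sup>2 \<le> \<epsilon> * card V
    \<and> E \<subseteq> [W]\<^bsup>2\<^esup> \<and> 1 \<le> l \<and> (\<forall>x\<in>V. vertex_density (\<lambda>x y. {x, y} \<in> E) V x \<le> M / k) \<longrightarrow>
    tuple_mean V k (\<lambda>xs. of_bool (edge_count (\<lambda>x y. {x, y} \<in> E) xs = l)) \<le> exp (- 1) + 4 * \<epsilon> \<and>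
    (l0 \<le> l \<longrightarrow> tuple_mean V k (\<lambda>xs. of_bool (edge_count (\<lambda>x y. {x, y} \<in> E) xs = l)) \<le> 4 * \<epsilon>)"
proof -
  obtain w where w: "\<And>m j. w \<le> m \<Longrightarrow> real (m choose j) \<le> \<epsilon> * 2 ^ m"
    using binomial_small[OF \<epsilon>(1)] by blast
  define y where "y = ln (2 ^ w / \<epsilon>)"
  \<comment> \<open>The first two entries are demands of \<open>bounded_density_many_edges\<close>;
    the third makes its exponential term at most \<open>\<epsilon>\<close>.\<close>
  define B where "B = max 8 (max (32 * M * (1 + 2 * M)\<^sup>2 / \<epsilon>) ((16 * (1 + 2 * M) * y)\<^sup>2 / (2 * \<epsilon>)))"
  have B: "8 \<le> B" "32 * M * (1 + 2 * M)\<^sup>2 / \<epsilon> \<le> B" "(16 * (1 + 2 * M) * y)\<^sup>2 / (2 * \<epsilon>) \<le> B"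
    by (auto simp: B_def)
  have B4: "2 ^ w * exp (- (sqrt (2 * \<epsilon> * B) / (16 * (1 + 2 * M)))) \<le> \<epsilon>"
  proof (rule exp_minus_ln_le)
    have "(16 * (1 + 2 * M) * y)\<^sup>2 \<le> 2 * \<epsilon> * B" using B(3) \<epsilon> by (simp add: field_simps)
    then have "16 * (1 + 2 * M) * y \<le> sqrt (2 * \<epsilon> * B)" by (rule real_le_rsqrt)
    then show "ln (2 ^ w / \<epsilon>) \<le> sqrt (2 * \<epsilon> * B) / (16 * (1 + 2 * M))"
      unfolding y_def[symmetric] using M by (simp add: le_divide_eq mult.commute)
  qed (use \<epsilon> in auto)
  \<comment> \<open>In the sparse case the prefix loss \<open>\<eta> * k\<^sup>2 * d\<close> is then
    at most \<open>\<epsilon>\<close>.\<close>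
  define \<eta> where "\<eta> = min 1 (\<epsilon> / B)"
  have \<eta>: "0 < \<eta>" "\<eta> \<le> 1" "\<eta> * B \<le> \<epsilon>"
    using \<epsilon> B(1) by (auto simp: \<eta>_def min_def field_simps)
  define l0 where "l0 = Suc (nat \<lceil>B / \<epsilon>\<rceil>)"
  have l0: "B / \<epsilon> \<le> real l0" by (simp add: l0_def) linarith
  define k0 where "k0 = Suc (nat \<lceil>max (2 * M / \<epsilon>) (4 / (\<eta>\<^sup>2 * \<epsilon>))\<rceil>)"
  show ?thesis
  proof (rule exI[of _ l0], rule exI[of _ k0], intro allI impI)
    fix k :: nat and V W :: "'a set" and E and l :: nat
    assume k0k: "k0 \<le> k"
    assume as: "finite V \<and> k \<le> card V \<and> 3 * (real k)\<^sup>2 \<le> \<epsilon> * card V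
      \<and> E \<subseteq> [W]\<^bsup>2\<^esup> \<and> 1 \<le> l \<and> (\<forall>x\<in>V. vertex_density (\<lambda>x y. {x, y} \<in> E) V x \<le> M / k)"
    let ?r = "\<lambda>x y. {x, y} \<in> E"
    define P where "P = tuple_mean V k (\<lambda>xs. of_bool (edge_count ?r xs = l))"
    define d where "d = edge_density ?r V"
    have k1: "1 \<le> k" using k0k by (simp add: k0_def)
    have "max (2 * M / \<epsilon>) (4 / (\<eta>\<^sup>2 * \<epsilon>)) \<le> real k"
      using k0k unfolding k0_def by linarith
    then have k: "2 * M / \<epsilon> \<le> real k" "4 / (\<eta>\<^sup>2 * \<epsilon>) \<le> real k" by auto
    have V: "finite V" "V \<noteq> {}" using as k1 by auto
    have n: "0 < real (card V)" using V by (simp add: card_gt_0_iff)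
    have sym: "symp ?r" by (auto simp: symp_def insert_commute)
    have "P \<le> exp (- 1) + 4 * \<epsilon> \<and> (l0 \<le> l \<longrightarrow> P \<le> 4 * \<epsilon>)"
    proof (cases "B \<le> (real k)\<^sup>2 * d")
      case True
      have "P \<le> 4 * \<epsilon>"
        unfolding P_def by (rule bounded_density_many_edges[OF w V sym M \<epsilon> _ k(1) B(1,2) _ B4])
          (use as True in \<open>auto simp: d_def\<close>)
      then show ?thesis by (simp add: add_increasing)
    next
      case False
      have kV: "(real k)\<^sup>2 / card V \<le> \<epsilon> / 3" using as n by (simp add: field_simps)
      have "P \<le> exp (real k / card V - 1) + (real k)\<^sup>2 / card V + \<eta> * (real k)\<^sup>2 * d + 4 / (\<eta>\<^sup>2 * k)"
        unfolding P_def d_def using as k1 \<eta> by (intro sparse_bound) auto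
      also have "exp (real k / card V - 1) \<le> exp (- 1) + 2 * (real k / card V)"
        using as n by (intro exp_minus_one_bound) auto
      also have "real k / card V \<le> (real k)\<^sup>2 / card V"
        using k1 by (intro divide_right_mono) (auto simp: power2_eq_square)
      also have "\<eta> * (real k)\<^sup>2 * d \<le> \<eta> * B"
        using False \<eta> by (simp add: mult.assoc)
      also have "\<eta> * B \<le> \<epsilon>" by (rule \<eta>)
      also have "4 / (\<eta>\<^sup>2 * k) \<le> \<epsilon>" using k(2) \<eta> \<epsilon> k1 by (simp add: field_simps)
      finally have "P \<le> exp (- 1) + 4 * \<epsilon>" using kV \<epsilon> by linarith
      \<comment> \<open>Markov: in the sparse case the expected number of edges is below
        \<open>B\<close>, and \<open>B\<close> is at most \<open>\<epsilon> * l\<close>.\<close>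
      moreover have "P \<le> 4 * \<epsilon>" if l: "l0 \<le> l"
      proof -
        have lB: "B \<le> \<epsilon> * real l"
        proof -
          have "B / \<epsilon> \<le> real l" using l0 l by linarith
          then show ?thesis using \<epsilon> by (simp add: field_simps)
        qed
        have l1: "0 < real l" using as by linarith
        have "P \<le> tuple_mean V k (\<lambda>xs. (1 / l) * real (edge_count ?r xs))"
          unfolding P_def using l1 by (intro tuple_mean_mono) auto
        also have "\<dots> = (1 / l) * (real (k choose 2) * d)"
          unfolding tuple_mean_cmult tuple_mean_edge_count[OF V] d_def ..
        also have "real (k choose 2) * d \<le> (real k)\<^sup>2 * d"
        proof (rule mult_right_mono)
          have "2 * real (k choose 2) \<le> (real k)\<^sup>2"
            unfolding two_mult_choose_two by (simp add: power2_eq_square algebra_simps)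
          then show "real (k choose 2) \<le> (real k)\<^sup>2" by linarith
        qed (simp add: d_def edge_density_nonneg)
        also have "\<dots> \<le> \<epsilon> * real l" using False lB by linarith
        finally have "P \<le> \<epsilon>" using l1 by (simp add: divide_right_mono)
        then show ?thesis using \<epsilon> by linarith
      qed
      ultimately show ?thesis by blast
    qed
    then show "tuple_mean V k (\<lambda>xs. of_bool (edge_count ?r xs = l)) \<le> exp (- 1) + 4 * \<epsilon> \<and>
      (l0 \<le> l \<longrightarrow> tuple_mean V k (\<lambda>xs. of_bool (edge_count ?r xs = l)) \<le> 4 * \<epsilon>)"
      unfolding P_def .
  qed
qed

section \<open>Densities inside subsets of the vertices\<close>

lemma mean_subset_le:
  assumes "finite V" "L \<subseteq> V" "L \<noteq> {}" "card V \<le> 2 * card L" "\<And>x. x \<in> V \<Longrightarrow> 0 \<le> g x"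
  shows "mean L g \<le> 2 * mean V g"
proof -
  have L: "finite L" using assms finite_subset by blast
  then have cL: "0 < real (card L)" using assms by (simp add: card_gt_0_iff)
  moreover have "real (card V) \<le> 2 * real (card L)" using assms(4) by linarith
  moreover have "real (card L) \<le> real (card V)" using assms by (simp add: card_mono)
  moreover have s: "(\<Sum>x\<in>L. g x) \<le> (\<Sum>x\<in>V. g x)" "0 \<le> (\<Sum>x\<in>V. g x)"
    using assms by (auto intro: sum_mono2 sum_nonneg)
  ultimately have "(\<Sum>x\<in>L. g x) / card L \<le> (\<Sum>x\<in>V. g x) / (card V / 2)"
    by (intro frac_le) auto
  then show ?thesis by (simp add: mean_def mult.commute)
qed

lemma vertex_density_subset_le:
  assumes "finite V" "L \<subseteq> V" "L \<noteq> {}" "card V \<le> 2 * card L"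
  shows "vertex_density r L x \<le> 2 * vertex_density r V x"
  unfolding vertex_density_def by (rule mean_subset_le[OF assms]) auto

lemma edge_density_subset_le:
  assumes "finite V" "L \<subseteq> V" "L \<noteq> {}" "card V \<le> 2 * card L"
  shows "edge_density r L \<le> 4 * edge_density r V"
proof -
  have "edge_density r L \<le> mean L (\<lambda>x. 2 * vertex_density r V x)"
    unfolding edge_density_def by (rule mean_mono) (rule vertex_density_subset_le[OF assms])
  also have "\<dots> \<le> 2 * mean V (\<lambda>x. 2 * vertex_density r V x)"
    by (rule mean_subset_le[OF assms]) (auto simp: vertex_density_def intro: mean_nonneg)
  also have "\<dots> = 4 * edge_density r V" by (simp add: mean_cmult edge_density_def)
  finally show ?thesis .
qed

lemma vertex_density_subset_ge:
  assumes "finite V" "L \<subseteq> V" "L \<noteq> {}"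
  shows "vertex_density r V x - card (V - L) / card V \<le> vertex_density r L x"
proof -
  have L: "finite L" using assms finite_subset by blast
  have n: "0 < real (card V)" using assms by (auto simp: card_gt_0_iff)
  have "vertex_density r V x = card (V - L) / card V * mean (V - L) (\<lambda>y. of_bool (r x y)) + card L / card V * vertex_density r L x"
    unfolding vertex_density_def by (rule mean_union) (use assms in auto)
  also have "card (V - L) / card V * mean (V - L) (\<lambda>y. of_bool (r x y)) \<le> card (V - L) / card V * 1"
  proof (cases "V - L = {}")
    case False
    then show ?thesis using assms(1) by (intro mult_left_mono mean_le_const) auto
  next
    case True
    then show ?thesis by (simp only: card.empty of_nat_0 div_0 mult_zero_left order_refl)
  qed
  also have "card L / card V * vertex_density r L x \<le> 1 * vertex_density r L x"
    using assms n vertex_density_bounds[OF L assms(3)] by (intro mult_right_mono) (auto simp: card_mono)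
  finally show ?thesis by simp
qed

lemma tuple_mean_drop_le:
  assumes V: "finite V" "D \<subseteq> V" "V - D \<noteq> {}" and sym: "symp r"
  shows "tuple_mean V k (\<lambda>xs. of_bool (edge_count r xs = l))
    \<le> tuple_mean (V - D) k (\<lambda>xs. of_bool (edge_count r xs = l)) + k * (card D / card V)"
proof (cases "D = {}")
  case False
  define g where "g = tuple_mean (V - D) k (\<lambda>xs. of_bool (edge_count r xs = l))"
  have g: "0 \<le> g" unfolding g_def by (rule tuple_mean_nonneg) auto
  have p: "0 \<le> card D / card V" "card D / card V \<le> 1"
    using V by (auto simp: divide_le_eq_1 card_mono)
  \<comment> \<open>In \<open>split_bound\<close>, \<open>T = 0\<close> removes the sums over
    exchanges and \<open>c = l\<close> removes the term for \<open>c < l\<close>; what remains is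
    the expected number of draws in \<open>D\<close>.\<close>
  have "tuple_mean V k (\<lambda>xs. of_bool (edge_count r xs = l))
     \<le> (1 - card D / card V) ^ k * g + k * (card D / card V)"
    using split_bound[where H = D and L = "V - D" and T = 0 and c = l and \<sigma> = 0 and l = l and g = g and k = k,
        OF V(1) _ _ False V(3) sym refl] V g_def vertex_density_bounds[of "V - D" r] by auto
  also have "(1 - card D / card V) ^ k * g \<le> 1 * g"
    using p g by (intro mult_right_mono power_le_one) auto
  finally show ?thesis by (simp add: g_def)
qed simp

section \<open>Dense graphs, choice of constants and case analysis\<close>

text \<open>\<open>few_edges_bound\<close> with about half of the sample in each round:
  \<open>c\<close> is chosen to make the second error small, then \<open>K\<close> to make the first
  small.\<close>

lemma dense_graph_bound:
  fixes C \<epsilon> :: real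
  assumes C: "0 < C" and \<epsilon>: "0 < \<epsilon>"
  obtains K where "1 \<le> K" and "\<And>k l r (V :: 'a set). finite V \<Longrightarrow> V \<noteq> {} \<Longrightarrow> symp r \<Longrightarrow> 2 \<le> k \<Longrightarrow> real l \<le> C * real k
    \<Longrightarrow> K \<le> k * edge_density r V \<Longrightarrow> tuple_mean V k (\<lambda>xs. of_bool (edge_count r xs = l)) \<le> 2 * \<epsilon>"
proof -
  define c where "c = 2 * ln (2 powr (3 * C) / \<epsilon>)"
  define K where "K = max 1 (6 * ln (2 powr c / \<epsilon>))"
  have "tuple_mean V k (\<lambda>xs. of_bool (edge_count r xs = l)) \<le> 2 * \<epsilon>"
    if V: "finite V" "V \<noteq> {}" and sym: "symp r" and k: "2 \<le> k" and l: "real l \<le> C * real k"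
      and K: "K \<le> k * edge_density r V" for k l r and V :: "'a set"
  proof -
    define h where "h = k div 2"
    have h: "1 \<le> h" "2 * h \<le> k" using k by (auto simp: h_def)
    have "k \<le> 3 * h" using k unfolding h_def by presburger
    then have h3: "real k \<le> 3 * real h" by linarith
    have "tuple_mean V k (\<lambda>xs. of_bool (edge_count r xs = l))
        \<le> tuple_mean V k (\<lambda>xs. of_bool (real (edge_count r xs) \<le> C * real k))"
      using l by (intro tuple_mean_mono) auto
    also have "\<dots> \<le> 2 powr c * exp (- (real h * edge_density r V / 2)) + 2 powr (C * real k / h) * exp (- (c / 2))"
      by (rule few_edges_bound[OF V sym h])
    also have "2 powr c * exp (- (real h * edge_density r V / 2)) \<le> \<epsilon>"
    proof (rule exp_minus_ln_le)
      have "6 * ln (2 powr c / \<epsilon>) \<le> K" by (simp add: K_def)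
      also have "\<dots> \<le> 3 * real h * edge_density r V"
        using K mult_right_mono[OF h3 edge_density_nonneg[of r V]] by linarith
      finally show "ln (2 powr c / \<epsilon>) \<le> real h * edge_density r V / 2" by simp
    qed (use \<epsilon> in auto)
    also have "2 powr (C * real k / h) * exp (- (c / 2)) \<le> 2 powr (3 * C) * exp (- (c / 2))"
    proof (intro mult_right_mono powr_mono)
      have "C * real k \<le> C * (3 * real h)" using C h3 by (intro mult_left_mono) auto
      then show "C * real k / h \<le> 3 * C" using h by (simp add: divide_le_eq mult.commute mult.left_commute)
    qed auto
    also have "\<dots> \<le> \<epsilon>" by (rule exp_minus_ln_le) (use \<epsilon> in \<open>auto simp: c_def\<close>)
    finally show ?thesis by simp
  qed
  then show ?thesis using that[of K] by (simp add: K_def)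
qed

text \<open>The three errors of \<open>split_bound\<close> become at most \<open>\<epsilon>\<close>
  each, with constants chosen in the order \<open>T\<close>, \<open>c\<close>, \<open>M\<close>:
  \<open>T\<close> controls the number of high vertices, \<open>c\<close> the degrees of exchanged
  low vertices, and \<open>M\<close> the degrees of high vertices. The shift by 2 pays for the
  density that is lost on passing to \<open>L\<close>.\<close>

lemma high_low_bound:
  fixes V H L :: "'a set" and c T k l :: nat and \<epsilon> K M g :: real
  assumes V: "finite V" "V = H \<union> L" "H \<inter> L = {}" "H \<noteq> {}" "L \<noteq> {}" and sym: "symp r" and \<epsilon>: "0 < \<epsilon>"
    and T: "1 \<le> T" "2 \<le> \<epsilon> * T" and c: "4 * T * K \<le> \<epsilon> * c" and k: "2 * T \<le> k"
    and M: "2 + 4 * max 0 (ln (T * 2 powr (c + T) / \<epsilon>)) \<le> M"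
    and H: "k * card H \<le> 2 * card V" "\<And>a. a \<in> H \<Longrightarrow> (M - 2) / k \<le> vertex_density r L a"
    and L: "k * edge_density r L \<le> 4 * K"
    and g: "g = tuple_mean L k (\<lambda>xs. of_bool (edge_count r xs = l))"
  shows "tuple_mean V k (\<lambda>xs. of_bool (edge_count r xs = l))
    \<le> (1 - card H / card V) ^ k * g + of_bool (c < l) * (exp (card H / card V - 1) * (1 - g)) + 3 * \<epsilon>"
proof -
  define \<sigma> where "\<sigma> = (M - 2) / k"
  have k0: "0 < real k" using T k by linarith
  have n: "0 < real (card V)" using V by (auto simp: card_gt_0_iff)
  have "tuple_mean V k (\<lambda>xs. of_bool (edge_count r xs = l))
    \<le> (1 - card H / card V) ^ k * g + of_bool (c < l) * (exp (card H / card V - 1) * (1 - g))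
      + T * (2 powr (c + T) * exp (- (real (k - T) * \<sigma> / 2))) + T * (k * edge_density r L / (c + 1))
      + k * (card H / card V) / (T + 1)"
    using k H(2) by (intro split_bound[OF V sym refl _ _ g]) (auto simp: \<sigma>_def)
  also have "T * (2 powr (c + T) * exp (- (real (k - T) * \<sigma> / 2))) \<le> \<epsilon>"
  proof -
    have M2: "0 \<le> M - 2" using M by linarith
    define z where "z = ln (T * 2 powr (c + T) / \<epsilon>)"
    define z' where "z' = max 0 z"
    have "z \<le> z'" "2 + 4 * z' \<le> M" using M by (simp_all only: z_def z'_def max.cobounded2)
    then have "z \<le> (M - 2) / 4" by simp
    also have "\<dots> \<le> real (k - T) * \<sigma> / 2"
    proof -
      have "real k / 2 \<le> real (k - T)" using k by (simp add: of_nat_diff)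
      then have "real k / 2 * \<sigma> \<le> real (k - T) * \<sigma>"
        using M2 by (intro mult_right_mono) (auto simp: \<sigma>_def)
      moreover have "real k / 2 * \<sigma> = (M - 2) / 2" using k0 by (simp add: \<sigma>_def)
      ultimately show ?thesis by linarith
    qed
    finally have "T * 2 powr (c + T) * exp (- (real (k - T) * \<sigma> / 2)) \<le> \<epsilon>"
      unfolding z_def using T \<epsilon> by (intro exp_minus_ln_le) auto
    then show ?thesis by (simp add: mult.assoc)
  qed
  also have "T * (k * edge_density r L / (c + 1)) \<le> \<epsilon>"
  proof -
    have "T * (k * edge_density r L) \<le> T * (4 * K)" using L by (intro mult_left_mono) auto
    also have "\<dots> \<le> \<epsilon> * (c + 1)" using c \<epsilon> by (simp add: algebra_simps)
    finally show ?thesis by (simp add: divide_le_eq)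
  qed
  also have "k * (card H / card V) / (T + 1) \<le> \<epsilon>"
  proof -
    have "real (k * card H) \<le> real (2 * card V)" using H(1) by (rule of_nat_mono)
    then have "k * (card H / card V) \<le> 2" using n by (simp add: divide_le_eq)
    also have "\<dots> \<le> \<epsilon> * (T + 1)" using T \<epsilon> by (simp add: algebra_simps)
    finally show ?thesis by (intro mult_imp_div_pos_le) auto
  qed
  finally show ?thesis by simp
qed

lemma one_minus_power_le_exp_minus_one:
  fixes p :: real
  assumes "0 \<le> p" "p \<le> 1" "1 \<le> k * p"
  shows "(1 - p) ^ k \<le> exp (- 1)"
  using one_minus_power_le_exp[OF assms(1,2), of k] assms(3) by (smt (verit) exp_le_cancel_iff mult_minus_left)

lemma tuple_mean_edge_count_le:
  fixes C \<epsilon> :: real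
  assumes C: "0 < C" and \<epsilon>: "0 < \<epsilon>" "\<epsilon> \<le> 1"
  shows "\<exists>k0. \<forall>k\<ge>k0. \<forall>(V :: 'a set) E l. finite V \<and> 2 * k \<le> card V \<and> 6 * (real k)\<^sup>2 \<le> \<epsilon> * card V
    \<and> E \<subseteq> [V]\<^bsup>2\<^esup> \<and> 1 \<le> l \<and> real l \<le> C * real k \<longrightarrow>
    tuple_mean V k (\<lambda>xs. of_bool (edge_count (\<lambda>x y. {x, y} \<in> E) xs = l)) \<le> exp (- 1) + 9 * \<epsilon>"
proof -
  obtain K where K: "1 \<le> K" and dense: "\<And>k l r (V :: 'a set). finite V \<Longrightarrow> V \<noteq> {} \<Longrightarrow> symp r \<Longrightarrow> 2 \<le> k
    \<Longrightarrow> real l \<le> C * real k \<Longrightarrow> K \<le> k * edge_density r V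
    \<Longrightarrow> tuple_mean V k (\<lambda>xs. of_bool (edge_count r xs = l)) \<le> 2 * \<epsilon>"
    using dense_graph_bound[OF C \<epsilon>(1)] by blast
  define T where "T = nat \<lceil>2 / \<epsilon>\<rceil>"
  have "2 / \<epsilon> \<le> real T" unfolding T_def by linarith
  then have T2: "2 \<le> \<epsilon> * T" using \<epsilon> by (simp add: field_simps)
  have T1: "1 \<le> T" using T2 by (cases T) auto
  define c0 where "c0 = nat \<lceil>4 * T * K / \<epsilon>\<rceil>"
  have "4 * T * K / \<epsilon> \<le> real c0" unfolding c0_def by linarith
  then have c0: "4 * T * K \<le> \<epsilon> * c0" using \<epsilon> by (simp add: field_simps)
  have "\<forall>M. \<exists>l0 k0 :: nat. 1 \<le> M \<longrightarrow> (\<forall>k\<ge>k0. \<forall>(V :: 'a set) W E l. finite V \<and> k \<le> card V \<and> 3 * (real k)\<^sup>2 \<le> \<epsilon> * card V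
    \<and> E \<subseteq> [W]\<^bsup>2\<^esup> \<and> 1 \<le> l \<and> (\<forall>x\<in>V. vertex_density (\<lambda>x y. {x, y} \<in> E) V x \<le> M / k) \<longrightarrow>
    tuple_mean V k (\<lambda>xs. of_bool (edge_count (\<lambda>x y. {x, y} \<in> E) xs = l)) \<le> exp (- 1) + 4 * \<epsilon> \<and>
    (l0 \<le> l \<longrightarrow> tuple_mean V k (\<lambda>xs. of_bool (edge_count (\<lambda>x y. {x, y} \<in> E) xs = l)) \<le> 4 * \<epsilon>))"
    using bounded_density_bound[OF _ \<epsilon>] by blast
  then obtain lf kf :: "real \<Rightarrow> nat" where low: "\<And>M k (V :: 'a set) W E l. 1 \<le> M \<Longrightarrow> kf M \<le> k \<Longrightarrow> finite V \<Longrightarrow> k \<le> card V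
    \<Longrightarrow> 3 * (real k)\<^sup>2 \<le> \<epsilon> * card V \<Longrightarrow> E \<subseteq> [W]\<^bsup>2\<^esup> \<Longrightarrow> 1 \<le> l \<Longrightarrow> (\<forall>x\<in>V. vertex_density (\<lambda>x y. {x, y} \<in> E) V x \<le> M / k) \<Longrightarrow>
    tuple_mean V k (\<lambda>xs. of_bool (edge_count (\<lambda>x y. {x, y} \<in> E) xs = l)) \<le> exp (- 1) + 4 * \<epsilon> \<and>
    (lf M \<le> l \<longrightarrow> tuple_mean V k (\<lambda>xs. of_bool (edge_count (\<lambda>x y. {x, y} \<in> E) xs = l)) \<le> 4 * \<epsilon>)"
    by metis
  \<comment> \<open>The part \<open>c0\<close> controls the exchange error; the part
    \<open>lf\<close> makes \<open>L\<close> alone unlikely to span \<open>l\<close> edges whenever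
    \<open>c < l\<close>. The argument is doubled because densities may double on restriction to
    \<open>L\<close>.\<close>
  define cf where "cf M = max c0 (lf (2 * M))" for M
  define mf where "mf c = 2 + 4 * max 0 (ln (T * 2 powr (c + T) / \<epsilon>))" for c :: nat
  \<comment> \<open>Each threshold is large enough for \<open>high_low_bound\<close> with the
    \<open>c\<close> that the preceding threshold determines. This is the gap that the pigeonhole
    argument has to create.\<close>
  define Ms where "Ms = rec_nat (mf c0) (\<lambda>_ M. max M (mf (cf M)))"
  have Ms: "Ms 0 = mf c0" "Ms (Suc i) = max (Ms i) (mf (cf (Ms i)))" for i
    by (simp_all add: Ms_def)
  have Ms_mono: "Ms i \<le> Ms j" if "i \<le> j" for i j
    using that by (rule lift_Suc_mono_le[of Ms, rotated]) (simp add: Ms)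
  have Ms1: "1 \<le> Ms i" for i
    using Ms_mono[of 0 i] by (simp add: Ms mf_def)
  define q where "q = nat \<lceil>1 / \<epsilon>\<rceil>"
  have "1 / \<epsilon> \<le> real q" unfolding q_def by linarith
  then have q: "1 \<le> \<epsilon> * q" using \<epsilon> by (simp add: field_simps)
  define k0 where "k0 = 4 + 2 * T + nat \<lceil>4 / \<epsilon>\<rceil> + (\<Sum>i<q. kf (2 * Ms i))"
  show ?thesis
  proof (intro exI[of _ k0] allI impI)
    fix k :: nat and V :: "'a set" and E and l :: nat
    assume k0: "k0 \<le> k"
    assume as: "finite V \<and> 2 * k \<le> card V \<and> 6 * (real k)\<^sup>2 \<le> \<epsilon> * card V
      \<and> E \<subseteq> [V]\<^bsup>2\<^esup> \<and> 1 \<le> l \<and> real l \<le> C * real k"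
    let ?r = "\<lambda>x y. {x, y} \<in> E"
    let ?P = "\<lambda>A. tuple_mean A k (\<lambda>xs. of_bool (edge_count ?r xs = l))"
    define n where "n = card V"
    have k: "4 \<le> k" "2 * T \<le> k" using k0 by (auto simp: k0_def)
    have k\<epsilon>: "4 / k \<le> \<epsilon>"
    proof -
      have "nat \<lceil>4 / \<epsilon>\<rceil> \<le> k" using k0 unfolding k0_def by linarith
      then have "4 / \<epsilon> \<le> real k" by linarith
      then show ?thesis using \<epsilon> k by (simp add: field_simps)
    qed
    have kr: "4 \<le> real k" using k by simp
    have V: "finite V" "V \<noteq> {}" using as k by auto
    have n: "0 < real n" using V by (simp add: n_def card_gt_0_iff)
    have sym: "symp ?r" by (auto simp: symp_def insert_commute)
    have exp_p: "exp (p - 1) \<le> exp (- 1) + \<epsilon>" if "0 \<le> p" "p \<le> 2 / k" for p :: real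
    proof -
      have "p \<le> 1" using that kr by (smt (verit) divide_le_eq_1)
      then have "exp (p - 1) \<le> exp (- 1) + 2 * p" using that by (intro exp_minus_one_bound)
      moreover have "2 * p \<le> 4 / k" using that by simp
      ultimately show ?thesis using k\<epsilon> by linarith
    qed
    have g01: "0 \<le> ?P A" "?P A \<le> 1" if "finite A" "A \<noteq> {}" for A :: "'a set"
      using that by (auto intro!: tuple_mean_nonneg tuple_mean_le_const)
    show "?P V \<le> exp (- 1) + 9 * \<epsilon>"
    proof (cases "K \<le> k * edge_density ?r V")
      case True
      have "?P V \<le> 2 * \<epsilon>" using V sym k as True by (intro dense) auto
      also have "\<dots> \<le> exp (- 1) + 9 * \<epsilon>" using \<epsilon> exp_ge_zero[of "- 1 :: real"] by linarith
      finally show ?thesis .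
    next
      case sparse: False
      have dens_L: "k * edge_density ?r L \<le> 4 * K" if "L \<subseteq> V" "L \<noteq> {}" "n \<le> 2 * card L" for L
      proof -
        have "k * edge_density ?r L \<le> k * (4 * edge_density ?r V)"
          using that V by (intro mult_left_mono edge_density_subset_le) (auto simp: n_def)
        then show ?thesis using sparse by linarith
      qed
      define H0 where "H0 i = {x \<in> V. Ms i / k \<le> vertex_density ?r V x}" for i
      have H0V: "finite (H0 i)" "H0 i \<subseteq> V" for i using V by (auto simp: H0_def)
      show ?thesis
      proof (cases "n \<le> k * card (H0 0)")
        case True
        \<comment> \<open>The least size of measure at least \<open>1 / k\<close>: it gives
          \<open>(1 - p) ^ k\<close> at most \<open>exp (- 1)\<close>, while rounding up keeps
          \<open>p\<close> at most \<open>2 / k\<close>.\<close>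
        define h where "h = nat \<lceil>n / k\<rceil>"
        have h: "real n / k \<le> real h" "real h < real n / k + 1"
          using divide_nonneg_nonneg[of "real n" "real k"] unfolding h_def by linarith+
        have "real n \<le> real (k * card (H0 0))" using True by (rule of_nat_mono)
        then have "real n / k \<le> real (card (H0 0))" using kr by (simp add: divide_le_eq mult.commute)
        then have "h \<le> card (H0 0)" unfolding h_def by linarith
        then obtain H where H: "H \<subseteq> H0 0" "card H = h" "finite H"
          by (rule obtain_subset_with_card_n)
        have h_le: "real h \<le> 2 * real n / k"
        proof -
          have "1 \<le> real n / k" using as kr by (simp add: n_def le_divide_eq)
          then show ?thesis using h by linarith
        qed
        have kh: "k * h \<le> 2 * n"
        proof -
          have "real (k * h) \<le> real (2 * n)" using h_le kr by (simp add: le_divide_eq mult.commute)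
          then show ?thesis by linarith
        qed
        define L where "L = V - H"
        have cL: "card L = n - h" using H H0V(2)[of 0] V by (simp add: L_def n_def card_Diff_subset)
        have "4 * h \<le> k * h" using k by simp
        then have h2: "2 * h \<le> n" using kh by linarith
        have nn: "0 < n" using n by simp
        have L0: "L \<noteq> {}" "n \<le> 2 * card L"
        proof -
          show "n \<le> 2 * card L" using cL h2 by linarith
          then show "L \<noteq> {}" using nn by auto
        qed
        have h0: "0 < real h" using h n kr by (smt (verit) divide_pos_pos)
        define g where "g = ?P L"
        have L: "finite L" "L \<subseteq> V" using V by (auto simp: L_def)
        have g: "0 \<le> g" "g \<le> 1" using g01[OF L(1) L0(1)] by (auto simp: g_def)
        define p where "p = card H / card V"
        have p: "0 \<le> p" "p \<le> 2 / k" "1 \<le> k * p"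
        proof -
          show "0 \<le> p" by (simp add: p_def)
          show "p \<le> 2 / k" using h_le n kr by (simp add: p_def H n_def[symmetric] field_simps)
          show "1 \<le> k * p" using h(1) n kr by (simp add: p_def H n_def[symmetric] field_simps)
        qed
        have "?P V \<le> (1 - p) ^ k * g + of_bool (c0 < l) * (exp (p - 1) * (1 - g)) + 3 * \<epsilon>"
          unfolding p_def
        proof (rule high_low_bound[OF V(1) _ _ _ L0(1) sym \<epsilon>(1) T1 T2 c0 k(2) _ _ _ _ g_def])
          show "V = H \<union> L" "H \<inter> L = {}" using H H0V(2)[of 0] by (auto simp: L_def)
          show "H \<noteq> {}" using h0 H by auto
          show "k * card H \<le> 2 * card V" using kh H by (simp add: n_def)
          show "k * edge_density ?r L \<le> 4 * K" using dens_L[OF L(2) L0] .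
          show "2 + 4 * max 0 (ln (T * 2 powr (c0 + T) / \<epsilon>)) \<le> Ms 0" by (simp add: Ms mf_def)
          fix a assume a: "a \<in> H"
          have "V - L = H" using H H0V(2)[of 0] by (auto simp: L_def)
          then have "vertex_density ?r V a - h / n \<le> vertex_density ?r L a"
            using vertex_density_subset_ge[OF V(1) L(2) L0(1), of ?r a] H by (simp add: n_def)
          moreover have "h / n \<le> 2 / k" using h_le n kr by (simp add: field_simps)
          moreover have "Ms 0 / k \<le> vertex_density ?r V a" using a H(1) by (auto simp: H0_def)
          ultimately show "(Ms 0 - 2) / k \<le> vertex_density ?r L a"
            unfolding diff_divide_distrib by linarith
        qed
        \<comment> \<open>The cases \<open>N = 0\<close> and \<open>N > 0\<close> now both have
          weight at most \<open>exp (- 1) + \<epsilon>\<close>, and their probabilities are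
          \<open>g\<close> and \<open>1 - g\<close>.\<close>
        also have "(1 - p) ^ k * g \<le> (exp (- 1) + \<epsilon>) * g"
        proof (rule mult_right_mono)
          have "p \<le> 1" using p(2) kr by (smt (verit) divide_le_eq_1)
          then have "(1 - p) ^ k \<le> exp (- 1)" using p by (intro one_minus_power_le_exp_minus_one) auto
          then show "(1 - p) ^ k \<le> exp (- 1) + \<epsilon>" using \<epsilon> by linarith
        qed (rule g)
        also have "of_bool (c0 < l) * (exp (p - 1) * (1 - g)) \<le> 1 * ((exp (- 1) + \<epsilon>) * (1 - g))"
          using g exp_p[OF p(1,2)] \<epsilon> by (intro mult_mono mult_nonneg_nonneg) auto
        finally have "?P V \<le> (exp (- 1) + \<epsilon>) * (g + (1 - g)) + 3 * \<epsilon>" by (simp only: distrib_left) simp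
        then show ?thesis using \<epsilon> by simp
      next
        case False
        have H0_anti: "H0 j \<subseteq> H0 i" if "i \<le> j" for i j
        proof
          fix x assume x: "x \<in> H0 j"
          have "Ms i / k \<le> Ms j / k" using Ms_mono[OF that] kr by (intro divide_right_mono) auto
          then show "x \<in> H0 i" using x by (auto simp: H0_def)
        qed
        \<comment> \<open>The layers between consecutive thresholds are disjoint and together have
          measure below \<open>1 / k\<close>. Hence one of the \<open>q\<close> layers has measure
          at most \<open>\<epsilon> / k\<close> and can be deleted at cost
          \<open>\<epsilon>\<close>.\<close>
        define D where "D i = H0 i - H0 (Suc i)" for i
        have "(\<Sum>i<m. card (D i)) \<le> card (H0 0) - card (H0 m)" for m
        proof (induction m)
          case (Suc m)
          have "card (D m) = card (H0 m) - card (H0 (Suc m))"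
            unfolding D_def using H0V H0_anti[of m "Suc m"] by (intro card_Diff_subset) auto
          moreover have "card (H0 (Suc m)) \<le> card (H0 m)" "card (H0 m) \<le> card (H0 0)"
            using H0V by (auto intro!: card_mono H0_anti)
          ultimately show ?case using Suc by simp
        qed simp
        then have "(\<Sum>i<q. card (D i)) \<le> card (H0 0)" using diff_le_self order.trans by blast
        then have "k * (\<Sum>i<q. card (D i)) \<le> k * card (H0 0)" by simp
        also have "\<dots> < n" using False by simp
        finally have sumD: "(\<Sum>i<q. k * card (D i)) < n" by (simp add: sum_distrib_left)
        have "\<exists>i<q. q * (k * card (D i)) \<le> n"
        proof (rule ccontr)
          assume "\<not> ?thesis"
          then have "(\<Sum>i<q. n) \<le> (\<Sum>i<q. q * (k * card (D i)))" by (intro sum_mono) auto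
          also have "\<dots> = q * (\<Sum>i<q. k * card (D i))" by (simp add: sum_distrib_left)
          finally have "q * n \<le> q * (\<Sum>i<q. k * card (D i))" by simp
          moreover have "0 < q" using q by (cases q) auto
          ultimately show False using sumD by simp
        qed
        then obtain i where i: "i < q" "q * (k * card (D i)) \<le> n" by blast
        define V' where "V' = V - D i"
        define H where "H = H0 (Suc i)"
        define L where "L = V - H0 i"
        define c where "c = cf (Ms i)"
        define g where "g = ?P L"
        have "k * card (H0 i) \<le> k * card (H0 0)"
          using H0V H0_anti[of 0 i] by (intro mult_le_mono2 card_mono) auto
        then have kH0: "k * card (H0 i) < n" using False by linarith
        have "4 * card (H0 i) \<le> k * card (H0 i)" using k by simp
        then have c4: "4 * card (H0 i) < n" using kH0 by linarith
        have cL: "card L = n - card (H0 i)" using H0V V by (simp add: L_def n_def card_Diff_subset)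
        have L2: "n \<le> 2 * card L" using cL c4 by linarith
        have L0: "L \<noteq> {}" using cL c4 by auto
        have L: "finite L" "L \<subseteq> V" "L \<subseteq> V'" using V by (auto simp: L_def V'_def D_def)
        have HL: "V' = H \<union> L" "H \<inter> L = {}"
          using H0V H0_anti[of i "Suc i"] by (auto simp: V'_def H_def L_def D_def)
        have V': "finite V'" "V' \<noteq> {}" using V L L0 by (auto simp: V'_def)
        have cV': "n \<le> 2 * card V'" using L2 card_mono[OF V'(1) L(3)] by linarith
        have Dk: "k * (card (D i) / card V) \<le> \<epsilon>"
        proof -
          have "real (q * (k * card (D i))) \<le> real n" using i(2) by (rule of_nat_mono)
          then have "\<epsilon> * (real q * (real k * real (card (D i)))) \<le> \<epsilon> * real n"
            using \<epsilon> by simp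
          moreover have "1 * (real k * real (card (D i))) \<le> (\<epsilon> * real q) * (real k * real (card (D i)))"
            using q by (intro mult_right_mono) auto
          ultimately have "real k * real (card (D i)) \<le> \<epsilon> * real n" by (simp add: mult.assoc)
          then show ?thesis using n by (simp add: n_def[symmetric] divide_le_eq)
        qed
        have "?P V \<le> ?P V' + k * (card (D i) / card V)"
          unfolding V'_def using V H0V V'(2) sym by (intro tuple_mean_drop_le) (auto simp: D_def V'_def)
        then have drop: "?P V \<le> ?P V' + \<epsilon>" using Dk by linarith
        have lowL: "g \<le> exp (- 1) + 4 * \<epsilon>" "lf (2 * Ms i) \<le> l \<Longrightarrow> g \<le> 4 * \<epsilon>"
        proof -
          have "kf (2 * Ms i) \<le> (\<Sum>i<q. kf (2 * Ms i))" using i by (intro member_le_sum) auto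
          then have kfk: "kf (2 * Ms i) \<le> k" using k0 by (simp add: k0_def)
          have dens: "\<forall>x\<in>L. vertex_density ?r L x \<le> 2 * Ms i / k"
          proof
            fix x assume "x \<in> L"
            then have "vertex_density ?r V x < Ms i / k" by (auto simp: L_def H0_def)
            moreover have "vertex_density ?r L x \<le> 2 * vertex_density ?r V x"
              using V L L0 L2 by (intro vertex_density_subset_le) (auto simp: n_def)
            ultimately show "vertex_density ?r L x \<le> 2 * Ms i / k" by simp
          qed
          have "2 * k \<le> n" using as by (simp add: n_def)
          then have kL: "k \<le> card L" using L2 by linarith
          have "real n \<le> 2 * real (card L)" using L2 by linarith
          then have "\<epsilon> * real n \<le> \<epsilon> * (2 * real (card L))" using \<epsilon> by (intro mult_left_mono) auto
          moreover have "6 * (real k)\<^sup>2 \<le> \<epsilon> * real n" using as by (simp add: n_def)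
          ultimately have k2L: "3 * (real k)\<^sup>2 \<le> \<epsilon> * card L" by linarith
          have M1: "1 \<le> 2 * Ms i" using Ms1[of i] by linarith
          have "g \<le> exp (- 1) + 4 * \<epsilon> \<and> (lf (2 * Ms i) \<le> l \<longrightarrow> g \<le> 4 * \<epsilon>)"
            unfolding g_def using as by (intro low[OF M1 kfk L(1) kL k2L _ _ dens]) auto
          then show "g \<le> exp (- 1) + 4 * \<epsilon>" "lf (2 * Ms i) \<le> l \<Longrightarrow> g \<le> 4 * \<epsilon>" by auto
        qed
        have g: "0 \<le> g" "g \<le> 1" using g01[OF L(1) L0] by (auto simp: g_def)
        have "?P V' \<le> exp (- 1) + 8 * \<epsilon>"
        proof (cases "H = {}")
          case True
          then have "?P V' = g" using HL by (simp add: g_def)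
          then show ?thesis using lowL \<epsilon> by linarith
        next
          case Hne: False
          define p where "p = card H / card V'"
          have cV'0: "0 < real (card V')" using V' by (simp add: card_gt_0_iff)
          have "card H \<le> card (H0 i)" unfolding H_def using H0V H0_anti[of i "Suc i"] by (intro card_mono) auto
          then have "k * card H \<le> k * card (H0 i)" by simp
          then have kH: "k * card H \<le> 2 * card V'" using kH0 cV' by linarith
          have p: "0 \<le> p" "p \<le> 2 / k"
          proof -
            have "real (k * card H) \<le> real (2 * card V')" using kH by (rule of_nat_mono)
            then show "p \<le> 2 / k" using cV'0 kr by (simp add: p_def field_simps)
          qed (simp add: p_def)
          have "?P V' \<le> (1 - p) ^ k * g + of_bool (c < l) * (exp (p - 1) * (1 - g)) + 3 * \<epsilon>"
            unfolding p_def
          proof (rule high_low_bound[OF V'(1) HL Hne L0 sym \<epsilon>(1) T1 T2 _ k(2) _ kH _ _ g_def])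
            have "\<epsilon> * c0 \<le> \<epsilon> * c" using \<epsilon> by (intro mult_left_mono) (auto simp: c_def cf_def)
            then show "4 * T * K \<le> \<epsilon> * c" using c0 by linarith
            show "2 + 4 * max 0 (ln (T * 2 powr (c + T) / \<epsilon>)) \<le> Ms (Suc i)" by (simp add: Ms mf_def c_def)
            show "k * edge_density ?r L \<le> 4 * K" by (rule dens_L[OF L(2) L0 L2])
            fix a assume a: "a \<in> H"
            have "V - L = H0 i" using H0V by (auto simp: L_def)
            then have "vertex_density ?r V a - card (H0 i) / n \<le> vertex_density ?r L a"
              using vertex_density_subset_ge[OF V(1) L(2) L0, of ?r a] by (simp add: n_def)
            moreover have "card (H0 i) / n \<le> 2 / k"
            proof -
              have "real (k * card (H0 i)) \<le> real n" using kH0 by linarith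
              then show ?thesis using n kr by (simp add: field_simps)
            qed
            moreover have "Ms (Suc i) / k \<le> vertex_density ?r V a" using a by (auto simp: H_def H0_def)
            ultimately show "(Ms (Suc i) - 2) / k \<le> vertex_density ?r L a"
              unfolding diff_divide_distrib by linarith
          qed
          also have "(1 - p) ^ k * g \<le> 1 * g"
          proof (intro mult_right_mono power_le_one)
            show "0 \<le> 1 - p" "1 - p \<le> 1" using p kr by (smt (verit) divide_le_eq_1)+
          qed (rule g)
          finally have P: "?P V' \<le> g + of_bool (c < l) * (exp (p - 1) * (1 - g)) + 3 * \<epsilon>" by simp
          show ?thesis
          \<comment> \<open>For \<open>c < l\<close> the low part alone is unlikely to span
            \<open>l\<close> edges, so only the weight of a single \<open>N > 0\<close> remains.
            Otherwise no \<open>N > 0\<close> contributes and \<open>g\<close> itself is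
            bounded.\<close>
          proof (cases "c < l")
            case True
            then have "lf (2 * Ms i) \<le> l" by (simp add: c_def cf_def)
            then have "g \<le> 4 * \<epsilon>" by (rule lowL)
            moreover have "exp (p - 1) * (1 - g) \<le> (exp (- 1) + \<epsilon>) * 1"
              using exp_p[OF p] g \<epsilon> by (intro mult_mono) auto
            ultimately show ?thesis using P True by simp
          next
            case False
            then show ?thesis using P lowL(1) \<epsilon> by simp
          qed
        qed
        with drop show ?thesis by linarith
      qed
    qed
  qed
qed

theorem theorem1p2:
  fixes C \<delta> :: real
  assumes "C > 0" and "\<delta> > 0"
  shows "\<exists>k0::nat. \<forall>k::nat. k0 \<le> k \<longrightarrow>
           (\<forall>l::nat. 1 \<le> l \<and> real l \<le> C * real k \<longrightarrow>
             edge_inducibility k l \<le> 1 / exp 1 + \<delta>)"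
proof -
  \<comment> \<open>Nine parts are spent on tuples and one on the passage to subsets.\<close>
  define \<epsilon> where "\<epsilon> = min 1 (\<delta> / 10)"
  have \<epsilon>: "0 < \<epsilon>" "\<epsilon> \<le> 1" "10 * \<epsilon> \<le> \<delta>" using assms by (auto simp: \<epsilon>_def)
  obtain k0 where k0: "\<And>k (V :: nat set) E l. k0 \<le> k \<Longrightarrow> finite V \<Longrightarrow> 2 * k \<le> card V \<Longrightarrow> 6 * (real k)\<^sup>2 \<le> \<epsilon> * card V
      \<Longrightarrow> E \<subseteq> [V]\<^bsup>2\<^esup> \<Longrightarrow> 1 \<le> l \<Longrightarrow> real l \<le> C * real k \<Longrightarrow>
      tuple_mean V k (\<lambda>xs. of_bool (edge_count (\<lambda>x y. {x, y} \<in> E) xs = l)) \<le> exp (- 1) + 9 * \<epsilon>"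
    using tuple_mean_edge_count_le[OF assms(1) \<epsilon>(1,2)] by blast
  have "edge_inducibility k l \<le> 1 / exp 1 + \<delta>" if k: "k0 \<le> k" and l: "1 \<le> l" "real l \<le> C * real k" for k l
  proof (rule LIMSEQ_le_const2[OF max_span_prob_tendsto_edge_inducibility])
    \<comment> \<open>Chosen after \<open>k\<close>, so \<open>k0\<close> depends only on
      \<open>C\<close> and \<open>\<delta>\<close>; a bound for all large \<open>n\<close> is enough
      for the limit.\<close>
    define n0 where "n0 = Suc (2 * k + nat \<lceil>6 * (real k)\<^sup>2 / \<epsilon>\<rceil>)"
    have "max_span_prob n k l \<le> 1 / exp 1 + \<delta>" if n: "n0 \<le> n" for n
    proof -
      have n0: "0 < n" "2 * k \<le> n" using n by (auto simp: n0_def)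
      have "6 * (real k)\<^sup>2 / \<epsilon> \<le> real n" using n unfolding n0_def by linarith
      then have k2: "6 * (real k)\<^sup>2 \<le> \<epsilon> * n" using \<epsilon> by (simp add: field_simps)
      obtain E where E: "E \<subseteq> [{..<n}]\<^bsup>2\<^esup>" "max_span_prob n k l = span_prob {..<n} E k l"
        using max_span_prob_attained by blast
      have "tuple_mean {..<n} k (\<lambda>xs. of_bool (edge_count (\<lambda>x y. {x, y} \<in> E) xs = l)) \<le> exp (- 1) + 9 * \<epsilon>"
        using k n0 k2 E l by (intro k0) auto
      moreover have "\<bar>tuple_mean {..<n} k (\<lambda>xs. of_bool (edge_count (\<lambda>x y. {x, y} \<in> E) xs = l)) - span_prob {..<n} E k l\<bar>
          \<le> (real k)\<^sup>2 / card {..<n}"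
        using n0 E by (intro tuple_mean_span_prob) auto
      moreover have "(real k)\<^sup>2 / card {..<n} \<le> \<epsilon>"
      proof -
        have "(real k)\<^sup>2 \<le> \<epsilon> * n" using k2 zero_le_power2[of "real k"] by linarith
        then show ?thesis using n0 by (simp add: divide_le_eq)
      qed
      ultimately have "max_span_prob n k l \<le> exp (- 1) + 10 * \<epsilon>" using E(2) by linarith
      also have "\<dots> \<le> 1 / exp 1 + \<delta>" using \<epsilon> by (simp add: exp_minus inverse_eq_divide)
      finally show ?thesis .
    qed
    then show "\<exists>N. \<forall>n\<ge>N. max_span_prob n k l \<le> 1 / exp 1 + \<delta>" by blast
  qed
  then show ?thesis by blast
qed

end
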